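(* Let $f:S_d\to[0,+\infty]$ be convex, positively $1$-homogeneous and lower semicontinuous, with $\operatorname{dom}(f)\subset S_d^+$, $\operatorname{dom}(f)\neq\emptyset$, and $\operatorname{dom}(f)\cap S_d^{++}$ dense in $\operatorname{dom}(f)$. Assume that $f$ is coercive, and let $\psi\in C_b(\mathbb R^d)$. Then $-\psi=(-\psi)^G$ on $\mathbb R^d$ if and only if $\psi$ is a viscosity solution of $-f^*\left(\tfrac12\nabla^2u\right)=0$ in $\mathbb R^d$.
   Context: $S_d$ is the space of real symmetric $d\times d$ matrices with inner product $A:B=\operatorname{tr}(A^{T}B)$ and norm $\|A\|=\sqrt{A:A}$; $S_d^+$ (resp. $S_d^{++}$) is the set of nonnegative (resp. positive) definite ones. $\operatorname{dom}(f)=\{M\in S_d: f(M)<+\infty\}$. Positively $1$-homogeneous means $f(tA)=tf(A)$ for all $A\in S_d$, $t\ge 0$. Coercive means $f(A)\to+\infty$ as $\|A\|\to\infty$. Fenchel conjugate: $f^*(A)=\sup\{A:M-f(M): M\in S_d\}$ (it takes values in $\{0,+\infty\}$). $C_b(\mathbb R^d)$ is the space of bounded continuous functions $\mathbb R^d\to\mathbb R$. $\mathcal P_2(\mathbb R^d)$ is the set of Borel probability measures on $\mathbb R^d$ with finite second moment; $\mathcal P_2((0,1)\times\mathbb R^d)$ is the set of Borel probability measures $\varrho$ on $(0,1)\times\mathbb R^d$ with $\int |x|^2\,d\varrho(t,x)<\infty$. $\mathcal M((0,1)\times\mathbb R^d,S_d^+)$ is the set of $S_d$-valued Borel measures $\lambda$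 on $(0,1)\times\mathbb R^d$ with $\lambda(E)\in S_d^+$ for every Borel $E$; $|\cdot|$ of a measure is its total variation measure. $C_b^{1,2}((0,1)\times\mathbb R^d)$ is the space of functions $\varphi$ that are once continuously differentiable in $t$ and twice in $x$ with $\partial_t\varphi$ and $\nabla_x^2\varphi$ uniformly bounded. Viscosity solutions. Let $\mathscr F:S_d\to\mathbb R\cup\{-\infty\}$ (possibly discontinuous) be proper: $\mathscr F(A_2)\le\mathscr F(A_1)$ whenever $A_1\le A_2$. A lower semicontinuous $u:\mathbb R^d\to\mathbb R$ is a viscosity supersolution of $\mathscr F=0$ if $\mathscr F(\nabla^2\varphi(x))\ge0$ whenever $\varphi\in C^2(\mathbb R^d)$ and $x$ is a local minimum of $u-\varphi$; an upper semicontinuous $u$ is a viscosity subsolution if $\mathscr F(\nabla^2\varphi(x))\le0$ whenever $\varphi\in C^2(\mathbb R^d)$ and $x$ is a local maximum of $u-\varphi$; a viscosity solution is both. Here this is applied with the proper function $\mathscr F(A)=-f^*(\frac12A)\in\{0,-\infty\}$. Fokker-Planck equation. A pair $(\varrho,\lambda)\in\mathcal P_2((0,1)\times\mathbb R^d)\times\mathcal M((0,1)\times\mathbb R^d,S_d^+)$ which can be disintegrated as $\varrho=\varrho_t\otimes\mathcal L^1|_{(0,1)}$, $\lambda=\lambda_t\otimes\mathcal L^1|_{(0,1)}$ solves $\partial_t\varrho=\operatorname{tr}(\frac12\nabla^2\lambda)$ if $\int_0^1|\lambda_t|(\mathbb R^d)\,dt<\infty$ and $$\int_0^1\int_{\mathbb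 R^d}\partial_t\varphi\,d\varrho_t\,dt=-\int_0^1\int_{\mathbb R^d}\tfrac12\nabla_x^2\varphi:d\lambda_t\,dt$$ for all $\varphi\in C_b^{1,2}((0,1)\times\mathbb R^d)$ whose closed support is contained in $(0,1)\times\mathbb R^d$. For such a solution $t\mapsto\varrho_t$ has a narrowly continuous representative on $[0,1]$ with values in $\mathcal P_2(\mathbb R^d)$, which is always used; $\varrho_0,\varrho_1$ denote its endpoint values. Dynamic cost: $$F(\mu,\nu)=\inf\left\{\int_0^1\int_{\mathbb R^d}f\left(\frac{d\lambda_t}{d|\lambda_t|}\right)d|\lambda_t|\,dt \;:\; \partial_t\varrho=\operatorname{tr}\left(\tfrac12\nabla^2\lambda\right),\ \varrho_0=\mu,\ \varrho_1=\nu\right\},$$ with $\inf\emptyset=+\infty$. $G$-transform. $G(x,p)=F(\delta_x,p)$ for $x\in\mathbb R^d$, $p\in\mathcal P_2(\mathbb R^d)$. For a universally measurable $\varphi:\mathbb R^d\to\mathbb R$ with $|\varphi(x)|\le C(1+|x|^2)$ for some $C>0$, $\varphi^G(x)=\inf\{\int_{\mathbb R^d}\varphi\,dp+G(x,p): p\in\mathcal P_2(\mathbb R^d)\}$. *)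

theory Defs
  imports "HOL-Probability.Probability"
begin

section \<open>Symmetric matrices\<close>

text \<open>The inner product of the library on \<^typ>\<open>real^'d^'d\<close> is
  \<open>A \<bullet> B = (\<Sum>i j. A $ i $ j * B $ i $ j) = tr (A\<^sup>T B)\<close>, so \<open>\<bullet>\<close> and \<open>norm\<close> are \<open>A : B\<close> and
  the Frobenius norm. Functions on \<open>S\<^sub>d\<close> are total functions on matrices of which only
  the values on \<open>sym_mats\<close> are used.\<close>

definition sym_mats :: "(real^'d^'d) set" where
  "sym_mats = {A. transpose A = A}"

definition psd_mats :: "(real^'d^'d) set" where
  "psd_mats = {A \<in> sym_mats. \<forall>x. 0 \<le> x \<bullet> (A *v x)}"

definition pd_mats :: "(real^'d^'d) set" where
  "pd_mats = {A \<in> sym_mats. \<forall>x. x \<noteq> 0 \<longrightarrow> 0 < x \<bullet> (A *v x)}"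

definition edom :: "(real^'d^'d \<Rightarrow> ennreal) \<Rightarrow> (real^'d^'d) set" where
  "edom f = {A \<in> sym_mats. f A < top}"

definition convex_fun :: "(real^'d^'d \<Rightarrow> ennreal) \<Rightarrow> bool" where
  "convex_fun f \<longleftrightarrow> (\<forall>A\<in>sym_mats. \<forall>B\<in>sym_mats. \<forall>t\<in>{0..1::real}.
     f ((1 - t) *\<^sub>R A + t *\<^sub>R B) \<le> ennreal (1 - t) * f A + ennreal t * f B)"

text \<open>In \<^typ>\<open>ennreal\<close> one has \<open>0 * \<infinity> = 0\<close>, so the case \<open>t = 0\<close> reads \<open>f 0 = 0\<close>.\<close>

definition pos_homogeneous :: "(real^'d^'d \<Rightarrow> ennreal) \<Rightarrow> bool" where
  "pos_homogeneous f \<longleftrightarrow> (\<forall>A\<in>sym_mats. \<forall>t\<ge>0. f (t *\<^sub>R A) = ennreal t * f A)"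

definition lsc_on :: "'a::topological_space set \<Rightarrow> ('a \<Rightarrow> 'b::complete_lattice) \<Rightarrow> bool" where
  "lsc_on S f \<longleftrightarrow> (\<forall>x\<in>S. f x \<le> Liminf (at x within S) f)"

definition usc_on :: "'a::topological_space set \<Rightarrow> ('a \<Rightarrow> 'b::complete_lattice) \<Rightarrow> bool" where
  "usc_on S f \<longleftrightarrow> (\<forall>x\<in>S. Limsup (at x within S) f \<le> f x)"

definition coercive :: "(real^'d^'d \<Rightarrow> ennreal) \<Rightarrow> bool" where
  "coercive f \<longleftrightarrow> (f \<longlongrightarrow> top) (inf at_infinity (principal sym_mats))"

definition fenchel_conj :: "(real^'d^'d \<Rightarrow> ennreal) \<Rightarrow> real^'d^'d \<Rightarrow> ereal" where
  "fenchel_conj f A = (SUP M\<in>sym_mats. ereal (A \<bullet> M) - enn2ereal (f M))"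


section \<open>Viscosity solutions\<close>

definition C2_with_hessian :: "(real^'d \<Rightarrow> real) \<Rightarrow> (real^'d \<Rightarrow> real^'d^'d) \<Rightarrow> bool" where
  "C2_with_hessian \<phi> H \<longleftrightarrow> (\<exists>g :: real^'d \<Rightarrow> real^'d.
     (\<forall>x. (\<phi> has_derivative (\<lambda>h. g x \<bullet> h)) (at x)) \<and>
     (\<forall>x. (g has_derivative (\<lambda>h. H x *v h)) (at x)) \<and>
     continuous_on UNIV H)"

definition local_minimum :: "(real^'d \<Rightarrow> real) \<Rightarrow> real^'d \<Rightarrow> bool" where
  "local_minimum w x \<longleftrightarrow> (\<forall>\<^sub>F y in nhds x. w x \<le> w y)"

definition local_maximum :: "(real^'d \<Rightarrow> real) \<Rightarrow> real^'d \<Rightarrow> bool" where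
  "local_maximum w x \<longleftrightarrow> (\<forall>\<^sub>F y in nhds x. w y \<le> w x)"

definition viscosity_supersolution ::
  "(real^'d^'d \<Rightarrow> ereal) \<Rightarrow> (real^'d \<Rightarrow> real) \<Rightarrow> bool" where
  "viscosity_supersolution \<F> u \<longleftrightarrow> lsc_on UNIV (\<lambda>x. ereal (u x)) \<and>
     (\<forall>\<phi> H x. C2_with_hessian \<phi> H \<longrightarrow> local_minimum (\<lambda>y. u y - \<phi> y) x \<longrightarrow> 0 \<le> \<F> (H x))"

definition viscosity_subsolution ::
  "(real^'d^'d \<Rightarrow> ereal) \<Rightarrow> (real^'d \<Rightarrow> real) \<Rightarrow> bool" where
  "viscosity_subsolution \<F> u \<longleftrightarrow> usc_on UNIV (\<lambda>x. ereal (u x)) \<and>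
     (\<forall>\<phi> H x. C2_with_hessian \<phi> H \<longrightarrow> local_maximum (\<lambda>y. u y - \<phi> y) x \<longrightarrow> \<F> (H x) \<le> 0)"

definition viscosity_solution ::
  "(real^'d^'d \<Rightarrow> ereal) \<Rightarrow> (real^'d \<Rightarrow> real) \<Rightarrow> bool" where
  "viscosity_solution \<F> u \<longleftrightarrow> viscosity_supersolution \<F> u \<and> viscosity_subsolution \<F> u"


section \<open>Matrix-valued measures\<close>

text \<open>A vector measure is a set function of which only the values on \<open>sets M\<close> are used.\<close>

definition mat_measures :: "'a measure \<Rightarrow> ('a set \<Rightarrow> real^'d^'d) set" where
  "mat_measures M = {\<Lambda>. (\<forall>E\<in>sets M. \<Lambda> E \<in> psd_mats) \<and>
     (\<forall>A :: nat \<Rightarrow> 'a set. range A \<subseteq> sets M \<longrightarrow> disjoint_family A \<longrightarrow>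
        (\<lambda>n. \<Lambda> (A n)) sums \<Lambda> (\<Union>n. A n))}"

definition total_var :: "'a measure \<Rightarrow> ('a set \<Rightarrow> real^'d^'d) \<Rightarrow> 'a measure" where
  "total_var M \<Lambda> = measure_of (space M) (sets M)
     (\<lambda>E. SUP A\<in>{A :: nat \<Rightarrow> 'a set. range A \<subseteq> sets M \<and> disjoint_family A \<and> (\<Union>n. A n) = E}.
        (\<Sum>n. ennreal (norm (\<Lambda> (A n)))))"

text \<open>The Radon-Nikodym density \<open>d\<Lambda>/d|\<Lambda>|\<close>, unique up to \<open>|\<Lambda>|\<close>-null sets.\<close>

definition polar_density :: "'a measure \<Rightarrow> ('a set \<Rightarrow> real^'d^'d) \<Rightarrow> 'a \<Rightarrow> real^'d^'d" where
  "polar_density M \<Lambda> = (SOME \<sigma>. integrable (total_var M \<Lambda>) \<sigma> \<and>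
     (\<forall>E\<in>sets M. \<Lambda> E = (\<integral>x\<in>E. \<sigma> x \<partial>total_var M \<Lambda>)))"

text \<open>The integral \<open>\<integral> \<Phi> : d\<Lambda>\<close>.\<close>

definition mat_integral ::
  "'a measure \<Rightarrow> ('a set \<Rightarrow> real^'d^'d) \<Rightarrow> ('a \<Rightarrow> real^'d^'d) \<Rightarrow> real" where
  "mat_integral M \<Lambda> \<Phi> = (\<integral>x. \<Phi> x \<bullet> polar_density M \<Lambda> x \<partial>total_var M \<Lambda>)"


section \<open>The Fokker-Planck equation\<close>

abbreviation cylinder :: "(real \<times> (real^'d)) set" where
  "cylinder \<equiv> {0<..<1} \<times> UNIV"

abbreviation cylinder_borel :: "(real \<times> (real^'d)) measure" where
  "cylinder_borel \<equiv> restrict_space borel cylinder"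

definition P2 :: "(real^'d) measure set" where
  "P2 = {p. sets p = sets borel \<and> prob_space p \<and> (\<integral>\<^sup>+x. ennreal ((norm x)\<^sup>2) \<partial>p) < top}"

definition P2_cylinder :: "(real \<times> (real^'d)) measure set" where
  "P2_cylinder = {\<rho>. sets \<rho> = sets cylinder_borel \<and> prob_space \<rho> \<and>
     (\<integral>\<^sup>+z. ennreal ((norm (snd z))\<^sup>2) \<partial>\<rho>) < top}"

text \<open>\<open>\<rho> = r\<^sub>t \<otimes> \<L>\<^sup>1\<close> on \<open>(0,1)\<close>; here \<open>Pair t -` E\<close> is the section \<open>{x. (t, x) \<in> E}\<close>.\<close>

definition disintegrates ::
  "(real \<times> (real^'d)) measure \<Rightarrow> (real \<Rightarrow> (real^'d) measure) \<Rightarrow> bool" where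
  "disintegrates \<rho> r \<longleftrightarrow>
     (\<forall>t\<in>{0<..<1}. sets (r t) = sets borel \<and> prob_space (r t)) \<and>
     (\<forall>B\<in>sets borel. (\<lambda>t. emeasure (r t) B) \<in> borel_measurable (restrict_space borel {0<..<1})) \<and>
     (\<forall>E\<in>sets cylinder_borel.
        emeasure \<rho> E = (\<integral>\<^sup>+t\<in>{0<..<1}. emeasure (r t) (Pair t -` E) \<partial>lborel))"

definition mat_disintegrates ::
  "((real \<times> (real^'d)) set \<Rightarrow> real^'d^'d) \<Rightarrow> (real \<Rightarrow> (real^'d) set \<Rightarrow> real^'d^'d) \<Rightarrow> bool" where
  "mat_disintegrates \<Lambda> l \<longleftrightarrow>
     (\<forall>t\<in>{0<..<1}. l t \<in> mat_measures borel) \<and>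
     (\<forall>B\<in>sets borel. (\<lambda>t. l t B) \<in> borel_measurable (restrict_space borel {0<..<1})) \<and>
     (\<forall>E\<in>sets cylinder_borel.
        set_integrable lborel {0<..<1} (\<lambda>t. l t (Pair t -` E)) \<and>
        \<Lambda> E = (\<integral>t\<in>{0<..<1}. l t (Pair t -` E) \<partial>lborel))"

text \<open>\<open>\<phi>\<close> is an admissible test function with \<open>\<partial>\<^sub>t\<phi> = \<phi>t\<close> and \<open>\<nabla>\<^sub>x\<^sup>2\<phi> = H\<close>. The closure in
  \<open>\<real> \<times> \<real>\<^sup>d\<close> of the support must avoid the times \<open>0\<close> and \<open>1\<close>, but need not be compact.\<close>

definition test_function ::
  "(real \<times> (real^'d) \<Rightarrow> real) \<Rightarrow> (real \<times> (real^'d) \<Rightarrow> real) \<Rightarrow> (real \<times> (real^'d) \<Rightarrow> real^'d^'d) \<Rightarrow> bool"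
where
  "test_function \<phi> \<phi>t H \<longleftrightarrow> (\<exists>g :: real \<times> (real^'d) \<Rightarrow> real^'d.
     (\<forall>t\<in>{0<..<1}. \<forall>x.
        ((\<lambda>s. \<phi> (s, x)) has_real_derivative \<phi>t (t, x)) (at t) \<and>
        ((\<lambda>y. \<phi> (t, y)) has_derivative (\<lambda>h. g (t, x) \<bullet> h)) (at x) \<and>
        ((\<lambda>y. g (t, y)) has_derivative (\<lambda>h. H (t, x) *v h)) (at x)) \<and>
     continuous_on cylinder \<phi>t \<and> continuous_on cylinder g \<and> continuous_on cylinder H \<and>
     bounded (\<phi>t ` cylinder) \<and> bounded (H ` cylinder) \<and>
     closure {z \<in> cylinder. \<phi> z \<noteq> 0} \<subseteq> cylinder)"

text \<open>\<open>(\<rho>, \<Lambda>)\<close>, disintegrated as \<open>(r\<^sub>t)\<close> and \<open>(l\<^sub>t)\<close>, solves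
  \<open>\<partial>\<^sub>t\<rho> = tr (\<nabla>\<^sup>2\<Lambda> / 2)\<close> in the weak sense.\<close>

definition fokker_planck ::
  "(real \<times> (real^'d)) measure \<Rightarrow> ((real \<times> (real^'d)) set \<Rightarrow> real^'d^'d) \<Rightarrow>
   (real \<Rightarrow> (real^'d) measure) \<Rightarrow> (real \<Rightarrow> (real^'d) set \<Rightarrow> real^'d^'d) \<Rightarrow> bool" where
  "fokker_planck \<rho> \<Lambda> r l \<longleftrightarrow>
     \<rho> \<in> P2_cylinder \<and> \<Lambda> \<in> mat_measures cylinder_borel \<and>
     disintegrates \<rho> r \<and> mat_disintegrates \<Lambda> l \<and>
     (\<integral>\<^sup>+t\<in>{0<..<1}. emeasure (total_var borel (l t)) UNIV \<partial>lborel) < top \<and>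
     (\<forall>\<phi> \<phi>t H. test_function \<phi> \<phi>t H \<longrightarrow>
        (\<integral>t\<in>{0<..<1}. (\<integral>x. \<phi>t (t, x) \<partial>r t) \<partial>lborel) =
        - (\<integral>t\<in>{0<..<1}. mat_integral borel (l t) (\<lambda>x. (1/2) *\<^sub>R H (t, x)) \<partial>lborel))"

definition narrowly_continuous :: "(real \<Rightarrow> (real^'d) measure) \<Rightarrow> bool" where
  "narrowly_continuous r \<longleftrightarrow> (\<forall>g \<in> bcontfun. continuous_on {0..1} (\<lambda>t. \<integral>x. g x \<partial>r t :: real))"

definition action ::
  "(real^'d^'d \<Rightarrow> ennreal) \<Rightarrow> (real \<Rightarrow> (real^'d) set \<Rightarrow> real^'d^'d) \<Rightarrow> ennreal" where
  "action f l = (\<integral>\<^sup>+t\<in>{0<..<1}.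
     (\<integral>\<^sup>+x. f (polar_density borel (l t) x) \<partial>total_var borel (l t)) \<partial>lborel)"

text \<open>The disintegration \<open>r\<close> is taken to be the narrowly continuous representative on \<open>[0,1]\<close>,
  whose values at \<open>0\<close> and \<open>1\<close> are prescribed. The action does not depend on the choice of the
  disintegration \<open>l\<close> of \<open>\<Lambda>\<close>, which is unique for almost every \<open>t\<close>.\<close>

definition dyn_cost ::
  "(real^'d^'d \<Rightarrow> ennreal) \<Rightarrow> (real^'d) measure \<Rightarrow> (real^'d) measure \<Rightarrow> ennreal" where
  "dyn_cost f \<mu> \<nu> = Inf {action f l | \<rho> \<Lambda> r l.
     fokker_planck \<rho> \<Lambda> r l \<and> narrowly_continuous r \<and> (\<forall>t\<in>{0..1}. r t \<in> P2) \<and>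
     r 0 = \<mu> \<and> r 1 = \<nu>}"


section \<open>The G-transform\<close>

definition G_cost :: "(real^'d^'d \<Rightarrow> ennreal) \<Rightarrow> real^'d \<Rightarrow> (real^'d) measure \<Rightarrow> ennreal" where
  "G_cost f x p = dyn_cost f (return borel x) p"

text \<open>The completion makes the integral meaningful for universally measurable \<open>\<phi>\<close>; for Borel
  \<open>\<phi>\<close> it can be dropped.\<close>

definition G_transform ::
  "(real^'d^'d \<Rightarrow> ennreal) \<Rightarrow> (real^'d \<Rightarrow> real) \<Rightarrow> real^'d \<Rightarrow> ereal" where
  "G_transform f \<phi> x =
     (INF p\<in>P2. ereal (\<integral>y. \<phi> y \<partial>completion p) + enn2ereal (G_cost f x p))"

end

theory Submission
  imports Defs
begin

text \<open>Write \<open>L\<^sub>M \<phi> = 1/2 M : \<nabla>\<^sup>2\<phi>\<close>. Both sides of the equivalence are restated as families of inequalities.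

The conjugate \<open>f\<^sup>*\<close> is nonnegative, so the subsolution half of the equation is automatic, and the
supersolution half says that \<open>L\<^sub>M \<phi> (x) \<le> f M\<close> for all symmetric \<open>M\<close> whenever a \<open>C\<^sup>2\<close> function \<open>\<phi>\<close>
touches \<open>\<psi>\<close> from below at \<open>x\<close> (\<open>touch_bound\<close>). Staying at \<open>x\<close> costs nothing, so
\<open>(-\<psi>)\<^sup>G \<le> -\<psi>\<close>, and the fixed point identity says that \<open>\<integral> \<psi> dp - \<psi> x \<le> G x p\<close> for all \<open>x\<close> and \<open>p\<close>.

From the cost bound to the touching bound (\<open>touch_bound_if_G_bound\<close>), one explicit competitor
suffices. Factor \<open>M = B B\<^sup>T\<close> and let \<open>r\<^sub>t\<close> be the law of \<open>x + \<surd>t B y\<close>, where \<open>y\<close> has a density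
proportional to \<open>4 (1 - |y|\<^sup>2)\<^sub>+\<close>. Since \<open>\<nabla> (1 - |y|\<^sup>2)\<^sub>+\<^sup>2 = - 4 (1 - |y|\<^sup>2)\<^sub>+ y\<close>, an integration by
parts shows that \<open>r\<close> solves the Fokker-Planck equation with \<open>\<lambda>\<^sub>t = M \<nu>\<^sub>t\<close>, where \<open>\<nu>\<^sub>t\<close> is the
distribution of the same points under the weight \<open>(1 - |y|\<^sup>2)\<^sub>+\<^sup>2\<close>. This is a compactly supported
substitute for Brownian motion: its cost is a constant times \<open>f M\<close>, and with \<open>s B\<close> in place of \<open>B\<close>
it stays so close to \<open>x\<close> that \<open>\<psi>\<close> may be replaced by \<open>\<phi>\<close>. The mean value theorem in \<open>t\<close> concludes.

From the touching bound to the cost bound (\<open>G_bound_if_touch_bound\<close>), a smooth \<open>\<psi>\<close> with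
\<open>L\<^sub>M \<psi> \<le> f M\<close> everywhere can be tested against the equation, which gives the inequality at once
(\<open>smooth_duality\<close>). A general \<open>\<psi>\<close> is mollified. The constraints are linear in the Hessian with
constant coefficients, so they should pass to averages of translates, and the point is to prove
this for constraints in the viscosity sense (\<open>mollified_supersolution\<close>). For a fixed
\<open>M = B B\<^sup>T\<close> let \<open>L\<^sub>h\<close> be the second difference quotient with steps along the columns of \<open>B\<close>. Its
resolvent \<open>R = (1 - \<alpha> L\<^sub>h)\<^sup>-\<^sup>1\<close> is the average over a random walk stopped at a geometric time,
hence it keeps smooth functions smooth, is monotone, and commutes with the mollification \<open>T\<close>. If \<open>w \<le> \<psi>\<close> is smooth,
then \<open>R w\<close> is a legitimate test function and comparison gives
\<open>R w \<le> \<psi> + \<alpha> (c + o(1))\<close> with \<open>c = f M\<close>. Applying \<open>T\<close>, expanding \<open>R T w = T w + \<alpha> L\<^sub>h R T w\<close> and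
letting \<open>w\<close> tend to \<open>\<psi>\<close> leaves \<open>L\<^sub>M (T \<psi>) \<le> c\<close>, because the error terms only see derivatives
of the kernel of \<open>T\<close>.

The duality argument also needs that the total variation of a matrix-valued measure is a measure
and that the polar density exists and is symmetric; both come from the density with respect to
the trace measure.\<close>

section \<open>Differentiation under the integral sign\<close>

text \<open>The difference quotients are dominated by \<open>2 w\<close> through the mean value inequality, so that
dominated convergence applies along every sequence of increments.\<close>
lemma has_derivative_integral_dominated:
  fixes F :: "'a \<Rightarrow> 'x::real_normed_vector \<Rightarrow> 'y::{banach,second_countable_topology}"
  assumes r: "r > 0"
    and int: "\<And>x. x \<in> ball x0 r \<Longrightarrow> integrable M (\<lambda>\<omega>. F \<omega> x)"
    and der: "\<And>\<omega> x. \<omega> \<in> space M \<Longrightarrow> x \<in> ball x0 r \<Longrightarrow> (F \<omega> has_derivative F' \<omega> x) (at x)"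
    and w: "integrable M w"
    and bnd: "\<And>\<omega> x h. \<omega> \<in> space M \<Longrightarrow> x \<in> ball x0 r \<Longrightarrow> norm (F' \<omega> x h) \<le> w \<omega> * norm h"
    and meas: "\<And>h. (\<lambda>\<omega>. F' \<omega> x0 h) \<in> borel_measurable M"
  shows "((\<lambda>x. \<integral>\<omega>. F \<omega> x \<partial>M) has_derivative (\<lambda>h. \<integral>\<omega>. F' \<omega> x0 h \<partial>M)) (at x0)"
proof -
  have x0: "x0 \<in> ball x0 r" using r by simp
  have lin: "linear (F' \<omega> x0)" if "\<omega> \<in> space M" for \<omega>
    using der[OF that x0] by (simp add: has_derivative_linear)
  have intF': "integrable M (\<lambda>\<omega>. F' \<omega> x0 h)" for h
    by (rule Bochner_Integration.integrable_bound[OF integrable_mult_left[OF w, of "norm h"] meas])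
      (use bnd[OF _ x0] in \<open>auto intro!: AE_I2 order_trans[OF _ abs_ge_self]\<close>)
  have bl: "bounded_linear (\<lambda>h. \<integral>\<omega>. F' \<omega> x0 h \<partial>M)"
  proof (rule bounded_linear_intro[where K = "\<integral>\<omega>. w \<omega> \<partial>M"])
    fix a b
    have "(\<integral>\<omega>. F' \<omega> x0 (a + b) \<partial>M) = (\<integral>\<omega>. F' \<omega> x0 a + F' \<omega> x0 b \<partial>M)"
      by (rule Bochner_Integration.integral_cong) (auto simp: linear_add[OF lin])
    then show "(\<integral>\<omega>. F' \<omega> x0 (a + b) \<partial>M) = (\<integral>\<omega>. F' \<omega> x0 a \<partial>M) + (\<integral>\<omega>. F' \<omega> x0 b \<partial>M)"
      using intF' by simp
  next
    fix c a
    have "(\<integral>\<omega>. F' \<omega> x0 (c *\<^sub>R a) \<partial>M) = (\<integral>\<omega>. c *\<^sub>R F' \<omega> x0 a \<partial>M)"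
      by (rule Bochner_Integration.integral_cong) (auto simp: linear_cmul[OF lin])
    then show "(\<integral>\<omega>. F' \<omega> x0 (c *\<^sub>R a) \<partial>M) = c *\<^sub>R (\<integral>\<omega>. F' \<omega> x0 a \<partial>M)" by simp
  next
    fix a
    have "norm (\<integral>\<omega>. F' \<omega> x0 a \<partial>M) \<le> (\<integral>\<omega>. norm (F' \<omega> x0 a) \<partial>M)" by (rule integral_norm_bound)
    also have "\<dots> \<le> (\<integral>\<omega>. w \<omega> * norm a \<partial>M)"
      by (intro integral_mono integrable_norm intF' integrable_mult_left w bnd x0)
    finally show "norm (\<integral>\<omega>. F' \<omega> x0 a \<partial>M) \<le> norm a * (\<integral>\<omega>. w \<omega> \<partial>M)" by (simp add: mult.commute)
  qed
  show ?thesis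
    unfolding has_derivative_at
  proof (intro conjI bl)
    let ?R = "\<lambda>\<omega> h. F \<omega> (x0 + h) - F \<omega> x0 - F' \<omega> x0 h"
    show "(\<lambda>h. norm ((\<integral>\<omega>. F \<omega> (x0 + h) \<partial>M) - (\<integral>\<omega>. F \<omega> x0 \<partial>M) - (\<integral>\<omega>. F' \<omega> x0 h \<partial>M)) / norm h)
             \<midarrow>0\<rightarrow> 0"
      unfolding tendsto_at_iff_sequentially comp_def
    proof (intro allI impI)
      fix X :: "nat \<Rightarrow> 'x" assume X: "\<forall>i. X i \<in> UNIV - {0}" "X \<longlonglongrightarrow> 0"
      obtain N where N: "\<And>n. n \<ge> N \<Longrightarrow> norm (X n) < r"
        using tendstoD[OF X(2) r] by (auto simp: eventually_sequentially)
      define Y where "Y n = X (n + N)" for n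
      have Y: "Y \<longlonglongrightarrow> 0" "\<And>n. Y n \<noteq> 0" "\<And>n. x0 + Y n \<in> ball x0 r"
        using X N LIMSEQ_ignore_initial_segment[OF X(2), of N]
        by (auto simp: Y_def[abs_def] dist_norm)
      define Q where "Q n \<omega> = (1 / norm (Y n)) *\<^sub>R ?R \<omega> (Y n)" for n \<omega>
      have mF: "(\<lambda>\<omega>. F \<omega> (x0 + Y n)) \<in> borel_measurable M" for n
        using int[OF Y(3)] by (rule borel_measurable_integrable)
      have mF0: "(\<lambda>\<omega>. F \<omega> x0) \<in> borel_measurable M"
        using int[OF x0] by (rule borel_measurable_integrable)
      have "(\<lambda>n. \<integral>\<omega>. Q n \<omega> \<partial>M) \<longlonglongrightarrow> (\<integral>\<omega>. 0 \<partial>M)"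
      proof (rule integral_dominated_convergence[where w = "\<lambda>\<omega>. 2 * w \<omega>"])
        show "Q n \<in> borel_measurable M" for n
          unfolding Q_def using mF mF0 meas by measurable
        show "AE \<omega> in M. (\<lambda>n. Q n \<omega>) \<longlonglongrightarrow> 0"
        proof (rule AE_I2)
          fix \<omega> assume "\<omega> \<in> space M"
          from der[OF this x0] have "(\<lambda>h. norm (?R \<omega> h) / norm h) \<midarrow>0\<rightarrow> 0"
            unfolding has_derivative_at by blast
          then have "(\<lambda>n. norm (?R \<omega> (Y n)) / norm (Y n)) \<longlonglongrightarrow> 0"
            using Y(1,2) unfolding tendsto_at_iff_sequentially comp_def by auto
          then have "(\<lambda>n. norm (Q n \<omega>)) \<longlonglongrightarrow> 0" by (simp add: Q_def)
          then show "(\<lambda>n. Q n \<omega>) \<longlonglongrightarrow> 0" by (rule tendsto_norm_zero_cancel)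
        qed
        show "AE \<omega> in M. norm (Q n \<omega>) \<le> 2 * w \<omega>" for n
        proof (rule AE_I2)
          fix \<omega> assume om: "\<omega> \<in> space M"
          have "norm (F \<omega> (x0 + Y n) - F \<omega> x0) \<le> w \<omega> * norm (x0 + Y n - x0)"
          proof (rule differentiable_bound[where S = "ball x0 r" and f' = "F' \<omega>"])
            show "(F \<omega> has_derivative F' \<omega> x) (at x within ball x0 r)" if "x \<in> ball x0 r" for x
              using der[OF om that] by (rule has_derivative_at_withinI)
            show "onorm (F' \<omega> x) \<le> w \<omega>" if "x \<in> ball x0 r" for x
            proof (rule onorm_bound)
              have "0 \<le> w \<omega> * norm (Y n)" using bnd[OF om x0, of "Y n"] norm_ge_zero order_trans by blast
              then show "0 \<le> w \<omega>" using Y(2)[of n] by (simp add: zero_le_mult_iff)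
            qed (rule bnd[OF om that])
          qed (use Y x0 in auto)
          then have "norm (?R \<omega> (Y n)) \<le> w \<omega> * norm (Y n) + w \<omega> * norm (Y n)"
            using bnd[OF om x0, of "Y n"] norm_triangle_ineq4[of "F \<omega> (x0 + Y n) - F \<omega> x0" "F' \<omega> x0 (Y n)"]
            by simp
          then show "norm (Q n \<omega>) \<le> 2 * w \<omega>"
            using Y(2)[of n] by (simp add: Q_def divide_simps mult_ac)
        qed
      qed (use w in auto)
      then have "(\<lambda>n. norm (\<integral>\<omega>. Q n \<omega> \<partial>M)) \<longlonglongrightarrow> 0" by (simp add: tendsto_norm_zero)
      moreover have "norm (\<integral>\<omega>. Q n \<omega> \<partial>M) =
          norm ((\<integral>\<omega>. F \<omega> (x0 + Y n) \<partial>M) - (\<integral>\<omega>. F \<omega> x0 \<partial>M) - (\<integral>\<omega>. F' \<omega> x0 (Y n) \<partial>M)) / norm (Y n)" for n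
        unfolding Q_def using int[OF Y(3)] int[OF x0] intF' by simp
      ultimately show "(\<lambda>n. norm ((\<integral>\<omega>. F \<omega> (x0 + X n) \<partial>M) - (\<integral>\<omega>. F \<omega> x0 \<partial>M) - (\<integral>\<omega>. F' \<omega> x0 (X n) \<partial>M)) / norm (X n)) \<longlonglongrightarrow> 0"
        unfolding Y_def by (simp add: LIMSEQ_offset[where k=N])
    qed
  qed
qed

section \<open>Polynomial bumps and mollification\<close>

text \<open>The bumps \<open>(r\<^sup>2 - |y|\<^sup>2)\<^sub>+\<^sup>k\<close> are \<open>C\<^sup>k\<^sup>-\<^sup>1\<close> with support in the ball of radius \<open>r\<close>, and the gradient
of one is a multiple of \<open>y\<close> times the previous one. The exponent 3 serves as a \<open>C\<^sup>2\<close> mollifier,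
the exponents 1 and 2 describe a spreading mass and its flux.\<close>
definition bump :: "real \<Rightarrow> nat \<Rightarrow> real^'d \<Rightarrow> real" where
  "bump r k y = (max 0 (r\<^sup>2 - y \<bullet> y)) ^ k"

lemma bump_nonneg: "0 \<le> bump r k y"
  by (simp add: bump_def)

lemma bump_outside: "0 < r \<Longrightarrow> 0 < k \<Longrightarrow> r \<le> norm y \<Longrightarrow> bump r k y = 0"
  using power_mono[of r "norm y" 2] by (simp add: bump_def dot_square_norm max_def)

lemma bump_le: "bump r k y \<le> (r\<^sup>2) ^ k"
  unfolding bump_def by (rule power_mono) auto

lemma continuous_on_bump [continuous_intros]: "continuous_on UNIV (bump r k)"
  unfolding bump_def[abs_def] by (intro continuous_intros)

lemma DERIV_pos_part_power:
  "((\<lambda>t::real. (max 0 t) ^ (k + 2)) has_real_derivative real (k + 2) * (max 0 t) ^ (k + 1)) (at t)"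
proof -
  consider "t > 0" | "t < 0" | "t = 0" by linarith
  then show ?thesis
  proof cases
    case 1
    have "((\<lambda>t::real. t ^ (k + 2)) has_real_derivative real (k + 2) * t ^ (k + 1)) (at t)"
      using DERIV_pow[of "k + 2" t] by simp
    then have "((\<lambda>t::real. (max 0 t) ^ (k + 2)) has_real_derivative real (k + 2) * t ^ (k + 1)) (at t)"
      by (rule has_field_derivative_transform_within_open[where S = "{0<..}"]) (use 1 in auto)
    with 1 show ?thesis by simp
  next
    case 2
    have "((\<lambda>t::real. 0) has_real_derivative 0) (at t)" by simp
    then have "((\<lambda>t::real. (max 0 t) ^ (k + 2)) has_real_derivative 0) (at t)"
      by (rule has_field_derivative_transform_within_open[where S = "{..<0}"]) (use 2 in auto)
    with 2 show ?thesis by simp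
  next
    case 3
    have "((\<lambda>y::real. \<bar>y\<bar> ^ (k + 1)) \<longlongrightarrow> \<bar>0\<bar> ^ (k + 1)) (at 0)" by (intro tendsto_intros)
    then have lim: "((\<lambda>y::real. \<bar>y\<bar> ^ (k + 1)) \<longlongrightarrow> 0) (at 0)" by simp
    have "((\<lambda>y::real. ((max 0 y) ^ (k + 2)) / y) \<longlongrightarrow> 0) (at 0)"
    proof (rule Lim_null_comparison[OF _ lim])
      have "norm ((max 0 y) ^ (k + 2) / y) \<le> \<bar>y\<bar> ^ (k + 1)" for y :: real
      proof (cases "y > 0")
        case True
        then show ?thesis by (simp add: power_add)
      next
        case False
        then have "max 0 y = 0" by simp
        then have "norm ((max 0 y) ^ (k + 2) / y) = 0" by simp
        also have "0 \<le> \<bar>y\<bar> ^ (k + 1)" by (rule zero_le_power) simp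
        finally show ?thesis .
      qed
      then show "\<forall>\<^sub>F y in at 0. norm ((max 0 y) ^ (k + 2) / y) \<le> \<bar>y\<bar> ^ (k + 1)" by simp
    qed
    then show ?thesis unfolding has_field_derivative_iff using 3 by simp
  qed
qed

lemma has_derivative_bump:
  "(bump r (k + 2) has_derivative (\<lambda>h. (- 2 * real (k + 2) * bump r (k + 1) y) * (y \<bullet> h))) (at y)"
proof -
  have "((\<lambda>y. r\<^sup>2 - y \<bullet> y) has_derivative (\<lambda>h. - 2 * (y \<bullet> h))) (at y)"
    by (auto intro!: derivative_eq_intros simp: inner_commute)
  from has_derivative_compose[OF this DERIV_pos_part_power[unfolded has_field_derivative_def, of k "r\<^sup>2 - y \<bullet> y"]]
  show ?thesis unfolding bump_def[abs_def]
    by (rule has_derivative_eq_rhs) (simp add: fun_eq_iff algebra_simps)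
qed

lemma integrable_compact_support:
  fixes F :: "real^'d \<Rightarrow> 'b::euclidean_space"
  assumes "continuous_on UNIV F" "\<And>y. r \<le> norm y \<Longrightarrow> F y = 0"
  shows "integrable lborel F"
proof -
  have "integrable lborel (\<lambda>x. indicator (cball 0 r) x *\<^sub>R F x)"
    using assms(1) by (intro borel_integrable_compact) (auto intro: continuous_on_subset)
  moreover have "(\<lambda>x. indicator (cball 0 r) x *\<^sub>R F x) = F"
    using assms(2) by (auto simp: indicator_def fun_eq_iff dist_norm)
  ultimately show ?thesis by simp
qed

lemma integrable_bump: "0 < r \<Longrightarrow> 0 < k \<Longrightarrow> integrable lborel (bump r k)"
  by (rule integrable_compact_support[OF continuous_on_bump]) (rule bump_outside)

lemma integral_lborel_shift:
  fixes F :: "real^'d \<Rightarrow> 'b::euclidean_space"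
  assumes "F \<in> borel_measurable borel"
  shows "(\<integral>y. F (y - x) \<partial>lborel) = (\<integral>y. F y \<partial>lborel)"
proof -
  have "(\<integral>y. F y \<partial>lborel) = (\<integral>y. F y \<partial>distr lborel borel ((+) (-x)))"
    by (simp add: lborel_distr_plus)
  also have "\<dots> = (\<integral>y. F ((+) (-x) y) \<partial>lborel)"
    by (rule integral_distr) (use assms in auto)
  finally show ?thesis by (simp add: add.commute)
qed

lemma integrable_lborel_shift:
  fixes F :: "real^'d \<Rightarrow> 'b::euclidean_space"
  assumes "integrable lborel F"
  shows "integrable lborel (\<lambda>y. F (y - x))"
proof -
  have "integrable (distr lborel borel ((+) (-x))) F"
    using assms by (simp add: lborel_distr_plus)
  then have "integrable lborel (\<lambda>y. F ((+) (-x) y))"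
    by (subst (asm) integrable_distr_eq) (use assms in auto)
  then show ?thesis by (simp add: add.commute)
qed

lemma integral_bump_pos:
  assumes "0 < r" "0 < k" shows "0 < (\<integral>y. bump r k (y::real^'d) \<partial>lborel)"
proof -
  have "0 < (3/4 * r\<^sup>2) ^ k * measure lborel (ball (0::real^'d) (r/2))"
    using assms by (simp add: content_ball_pos)
  also have "\<dots> = (\<integral>y. (3/4 * r\<^sup>2) ^ k * indicator (ball 0 (r/2)) (y::real^'d) \<partial>lborel)"
    by (simp)
  also have "\<dots> \<le> (\<integral>y. bump r k (y::real^'d) \<partial>lborel)"
  proof (rule integral_mono)
    show "integrable lborel (\<lambda>y::real^'d. (3/4 * r\<^sup>2) ^ k * indicator (ball 0 (r/2)) y)"
      by (intro integrable_mult_right integrable_real_indicator) (auto simp: emeasure_lborel_ball_finite[unfolded infinity_ennreal_def])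
    show "integrable lborel (bump r k :: real^'d \<Rightarrow> real)" by (rule integrable_bump[OF assms])
    fix y :: "real^'d"
    show "(3/4 * r\<^sup>2) ^ k * indicator (ball 0 (r/2)) y \<le> bump r k y"
    proof (cases "norm y < r/2")
      case True
      then have "(norm y)\<^sup>2 \<le> (r/2)\<^sup>2" by (intro power_mono) auto
      then have "3/4 * r\<^sup>2 \<le> max 0 (r\<^sup>2 - y \<bullet> y)" by (simp add: dot_square_norm power_divide le_max_iff_disj)
      then have "(3/4 * r\<^sup>2) ^ k \<le> bump r k y" unfolding bump_def by (rule power_mono) simp
      with True show ?thesis by simp
    qed (simp add: bump_nonneg)
  qed
  finally show ?thesis .
qed

text \<open>All derivatives of the convolution fall on the kernel, which is how a merely bounded \<open>u\<close> becomes \<open>C\<^sup>2\<close>.\<close>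
lemma has_derivative_kernel_integral:
  fixes k :: "real^'d \<Rightarrow> 'b::euclidean_space"
  assumes u: "u \<in> borel_measurable borel" "\<And>y. \<bar>u y\<bar> \<le> K"
    and ck: "continuous_on UNIV k"
    and k: "\<And>y. (k has_derivative k' y) (at y)" "\<And>y. r \<le> norm y \<Longrightarrow> k y = 0"
    and k': "\<And>y h. norm (k' y h) \<le> B * norm h" "\<And>y h. r \<le> norm y \<Longrightarrow> k' y h = 0"
      "\<And>h. continuous_on UNIV (\<lambda>y. k' y h)"
  shows "((\<lambda>x. \<integral>y. u y *\<^sub>R k (y - x) \<partial>lborel) has_derivative
           (\<lambda>h. - (\<integral>y. u y *\<^sub>R k' (y - x) h \<partial>lborel))) (at x)"
proof -
  have K: "0 \<le> K" using u(2)[of 0] by linarith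
  have bu: "integrable lborel (\<lambda>y. u y *\<^sub>R F y)" if "integrable lborel F" for F :: "real^'d \<Rightarrow> 'b"
    by (rule Bochner_Integration.integrable_bound[where f = "\<lambda>y. K *\<^sub>R F y"])
      (use that u in \<open>auto intro!: mult_right_mono order_trans[OF _ abs_ge_self] simp: abs_of_nonneg[OF K]\<close>)
  have mk': "(\<lambda>y. k' y h) \<in> borel_measurable borel" for h
    using k'(3) by (rule borel_measurable_continuous_onI)
  have "((\<lambda>x. \<integral>y. u y *\<^sub>R k (y - x) \<partial>lborel) has_derivative
           (\<lambda>h. \<integral>y. - (u y *\<^sub>R k' (y - x) h) \<partial>lborel)) (at x)"
  proof (rule has_derivative_integral_dominated[where r = 1
        and w = "\<lambda>y. (K * B) * indicator (cball x (r + 1)) y"])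
    show "integrable lborel (\<lambda>y. u y *\<^sub>R k (y - x'))" for x'
      by (intro bu integrable_lborel_shift integrable_compact_support[OF ck k(2)])
    show "((\<lambda>x. u y *\<^sub>R k (y - x)) has_derivative (\<lambda>h. - (u y *\<^sub>R k' (y - x') h))) (at x')" for y x'
    proof -
      have "((\<lambda>x. y - x) has_derivative (\<lambda>h. - h)) (at x')" by (auto intro!: derivative_eq_intros)
      from has_derivative_compose[OF this k(1)]
      have "((\<lambda>x. k (y - x)) has_derivative (\<lambda>h. k' (y - x') (- h))) (at x')" .
      then have "((\<lambda>x. k (y - x)) has_derivative (\<lambda>h. - k' (y - x') h)) (at x')"
        by (simp add: linear_neg[OF has_derivative_linear[OF k(1)]])
      then show ?thesis by (auto intro!: derivative_eq_intros)
    qed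
    show "integrable lborel (\<lambda>y. (K * B) * indicator (cball x (r + 1)) y)"
      by (intro integrable_mult_right integrable_real_indicator) (auto simp: emeasure_lborel_cball_finite[unfolded infinity_ennreal_def])
    show "norm (- (u y *\<^sub>R k' (y - x') h)) \<le> ((K * B) * indicator (cball x (r + 1)) y) * norm h"
      if "x' \<in> ball x 1" for y x' h
    proof (cases "norm (y - x') < r")
      case True
      have "dist x y \<le> r + 1" using True that dist_triangle[of x y x'] by (simp add: dist_norm norm_minus_commute)
      moreover have "\<bar>u y\<bar> * norm (k' (y - x') h) \<le> K * (B * norm h)"
        by (intro mult_mono u k' K norm_ge_zero)
      ultimately show ?thesis by (simp add: mult_ac)
    next
      case False
      have "0 \<le> B * norm h" using k'(1)[of 0 h] norm_ge_zero order_trans by blast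
      then have "0 \<le> K * (B * norm h)" using K by simp
      then show ?thesis using False k'(2)[of "y - x'" h] by (auto simp: indicator_def mult_ac)
    qed
    show "(\<lambda>y. - (u y *\<^sub>R k' (y - x) h)) \<in> borel_measurable lborel" for h
      using u(1) mk'[of h] by measurable
  qed simp
  then show ?thesis by simp
qed

text \<open>The modulus of continuity of the Hessian controls second difference quotients uniformly in the
base point, and averaging over translations preserves it. The bounds on \<open>w\<close> and \<open>g\<close> make these
averages differentiable under the integral sign.\<close>
definition C2b :: "(real^'d \<Rightarrow> real) \<Rightarrow> (real^'d \<Rightarrow> real^'d) \<Rightarrow> (real^'d \<Rightarrow> real^'d^'d) \<Rightarrow> bool" where
  "C2b w g H \<longleftrightarrow> (\<forall>x. (w has_derivative (\<lambda>h. g x \<bullet> h)) (at x)) \<and>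
     (\<forall>x. (g has_derivative (\<lambda>h. H x *v h)) (at x)) \<and>
     bounded (range w) \<and> bounded (range g) \<and> bounded (range H) \<and> uniformly_continuous_on UNIV H"

definition bump_grad :: "real \<Rightarrow> real^'d \<Rightarrow> real^'d" where
  "bump_grad r y = (- 6 * bump r 2 y) *\<^sub>R y"

definition bump_hess :: "real \<Rightarrow> real^'d \<Rightarrow> real^'d^'d" where
  "bump_hess r y = (\<chi> i j. (if i = j then - 6 * bump r 2 y else 0) + 24 * bump r 1 y * (y $ i * y $ j))"

lemma bump_hess_mult:
  "bump_hess r y *v h = (- 6 * bump r 2 y) *\<^sub>R h + (24 * bump r 1 y * (y \<bullet> h)) *\<^sub>R y"
proof -
  have "(\<Sum>j\<in>UNIV. ((if i = j then a else 0) + b * (y $ i * y $ j)) * h $ j)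
      = a * h $ i + (b * (\<Sum>j\<in>UNIV. y $ j * h $ j)) * y $ i" for a b :: real and i
  proof -
    have "(\<Sum>j\<in>UNIV. ((if i = j then a else 0) + b * (y $ i * y $ j)) * h $ j)
        = (\<Sum>j\<in>UNIV. (if i = j then a * h $ j else 0) + (b * y $ i) * (y $ j * h $ j))"
      by (rule sum.cong) (auto simp: algebra_simps)
    also have "\<dots> = (\<Sum>j\<in>UNIV. if i = j then a * h $ j else 0) + (b * y $ i) * (\<Sum>j\<in>UNIV. y $ j * h $ j)"
      by (simp only: sum.distrib sum_distrib_left)
    finally show ?thesis by simp
  qed
  then show ?thesis
    unfolding bump_hess_def matrix_vector_mult_def vec_eq_iff by (simp add: inner_vec_def)
qed

lemma has_derivative_bump3: "(bump r 3 has_derivative (\<lambda>h. bump_grad r y \<bullet> h)) (at y)"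
  using has_derivative_bump[of r 1 y] by (simp add: bump_grad_def numeral_3_eq_3 numeral_2_eq_2)

lemma has_derivative_bump_grad: "(bump_grad r has_derivative (\<lambda>h. bump_hess r y *v h)) (at y)"
proof -
  have "(bump r 2 has_derivative (\<lambda>h. (- 4 * bump r 1 y) * (y \<bullet> h))) (at y)"
    using has_derivative_bump[of r 0 y] by (simp add: numeral_2_eq_2)
  then show ?thesis unfolding bump_grad_def[abs_def] bump_hess_mult
    by (auto intro!: derivative_eq_intros simp: algebra_simps)
qed

lemma continuous_on_bump_grad: "continuous_on UNIV (bump_grad r)"
  unfolding bump_grad_def[abs_def] by (intro continuous_intros)

lemma continuous_on_bump_hess: "continuous_on UNIV (bump_hess r)"
  unfolding bump_hess_def[abs_def] 
proof (intro continuous_on_vec_lambda continuous_on_add)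
  show "continuous_on UNIV (\<lambda>y. if i = j then - 6 * bump r 2 y else 0)" for i j :: 'd
    by (cases "i = j") (auto intro!: continuous_intros)
qed (intro continuous_intros)

lemma bump_grad_outside: "0 < r \<Longrightarrow> r \<le> norm y \<Longrightarrow> bump_grad r y = 0"
  by (simp add: bump_grad_def bump_outside)

lemma bump_hess_outside: "0 < r \<Longrightarrow> r \<le> norm y \<Longrightarrow> bump_hess r y = 0"
  by (simp add: bump_hess_def bump_outside vec_eq_iff)

lemma bounded_compact_support:
  fixes F :: "real^'d \<Rightarrow> 'b::real_normed_vector"
  assumes "continuous_on UNIV F" "\<And>y. r \<le> norm y \<Longrightarrow> F y = 0"
  shows "\<exists>B\<ge>0. \<forall>y. norm (F y) \<le> B"
proof -
  have "bounded (F ` cball 0 r)"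
    using assms(1) by (intro compact_imp_bounded compact_continuous_image) (auto intro: continuous_on_subset)
  then obtain B where B: "\<And>y. norm y \<le> r \<Longrightarrow> norm (F y) \<le> B"
    unfolding bounded_iff by fastforce
  have "norm (F y) \<le> max 0 B" for y
    using B[of y] assms(2)[of y] by (cases "norm y \<le> r") auto
  then show ?thesis by (intro exI[of _ "max 0 B"]) auto
qed

lemma uniform_compact_support:
  fixes F :: "real^'d \<Rightarrow> 'b::real_normed_vector"
  assumes "continuous_on UNIV F" "\<And>y. r \<le> norm y \<Longrightarrow> F y = 0" "e > 0"
  shows "\<exists>d>0. d < 1 \<and> (\<forall>y y'. dist y y' < d \<longrightarrow> norm (F y - F y') \<le> e)"
proof -
  have "uniformly_continuous_on (cball 0 (r + 1)) F"
    using assms(1) by (intro compact_uniformly_continuous) (auto intro: continuous_on_subset)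
  then obtain d where d: "d > 0" "\<And>y y'. y \<in> cball 0 (r+1) \<Longrightarrow> y' \<in> cball 0 (r+1) \<Longrightarrow> dist y' y < d \<Longrightarrow> dist (F y') (F y) < e"
    using \<open>e > 0\<close> unfolding uniformly_continuous_on_def by metis
  have "norm (F y - F y') \<le> e" if "dist y y' < min d (1/2)" for y y'
  proof (cases "norm y \<le> r + 1 \<and> norm y' \<le> r + 1")
    case True
    then show ?thesis using d(2)[of y' y] that by (auto simp: dist_norm)
  next
    case False
    have "norm (y - y') < 1" using that by (simp add: dist_norm)
    then have "r \<le> norm y \<and> r \<le> norm y'"
      using False norm_triangle_ineq2[of y y'] norm_triangle_ineq2[of y' y] by (auto simp: norm_minus_commute)
    then show ?thesis using assms by simp
  qed
  then show ?thesis using d(1) by (intro exI[of _ "min d (1/2)"]) auto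
qed

lemma norm_matrix_vector_mult_le: "norm (A *v h) \<le> norm A * norm (h :: real^'n)" for A :: "real^'n^'m"
proof -
  have "norm (A *v h) \<le> L2_set (\<lambda>i. norm (A $ i) * norm h) UNIV"
    unfolding norm_vec_def[of "A *v h"]
    by (rule L2_set_mono) (auto simp: matrix_vector_mul_component Cauchy_Schwarz_ineq2)
  also have "\<dots> = norm A * norm h" by (simp add: norm_vec_def L2_set_left_distrib)
  finally show ?thesis .
qed

lemma bounded_linear_matrix_vector_mult_left: "bounded_linear (\<lambda>A :: real^'n^'m. A *v h)"
  by (rule bounded_linear_intro[where K = "norm h"])
    (auto simp: matrix_vector_mult_add_rdistrib scaleR_matrix_vector_assoc norm_matrix_vector_mult_le)

definition mollify :: "real \<Rightarrow> (real^'d \<Rightarrow> real) \<Rightarrow> real^'d \<Rightarrow> real" where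
  "mollify r u x = (\<integral>y. u y *\<^sub>R bump r 3 (y - x) \<partial>lborel) / (\<integral>y. bump r 3 (y::real^'d) \<partial>lborel)"

definition mollify_grad :: "real \<Rightarrow> (real^'d \<Rightarrow> real) \<Rightarrow> real^'d \<Rightarrow> real^'d" where
  "mollify_grad r u x = (- 1 / (\<integral>y. bump r 3 (y::real^'d) \<partial>lborel)) *\<^sub>R (\<integral>y. u y *\<^sub>R bump_grad r (y - x) \<partial>lborel)"

definition mollify_hess :: "real \<Rightarrow> (real^'d \<Rightarrow> real) \<Rightarrow> real^'d \<Rightarrow> real^'d^'d" where
  "mollify_hess r u x = (1 / (\<integral>y. bump r 3 (y::real^'d) \<partial>lborel)) *\<^sub>R (\<integral>y. u y *\<^sub>R bump_hess r (y - x) \<partial>lborel)"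

lemma integrable_bounded_mult:
  fixes F :: "'a \<Rightarrow> 'b::{banach,second_countable_topology}"
  assumes "u \<in> borel_measurable M" "\<And>y. \<bar>u y\<bar> \<le> (K::real)" "integrable M F"
  shows "integrable M (\<lambda>y. u y *\<^sub>R F y)"
proof (rule Bochner_Integration.integrable_bound[where f = "\<lambda>y. K *\<^sub>R F y"])
  show "AE y in M. norm (u y *\<^sub>R F y) \<le> norm (K *\<^sub>R F y)"
    using assms(2) by (auto intro!: mult_right_mono order_trans[OF _ abs_ge_self])
qed (use assms in auto)

lemma norm_kernel_integral_le:
  fixes k :: "real^'d \<Rightarrow> 'b::euclidean_space"
  assumes u: "u \<in> borel_measurable borel" "\<And>y. \<bar>u y\<bar> \<le> K"
    and mk: "k \<in> borel_measurable borel"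
    and k: "\<And>y. norm (k y) \<le> B * indicator (cball x R) y"
  shows "norm (\<integral>y. u y *\<^sub>R k y \<partial>lborel) \<le> K * B * measure lborel (cball (0::real^'d) R)"
proof -
  have K: "0 \<le> K" using u(2)[of 0] by linarith
  have int: "integrable lborel (\<lambda>y. K * B * indicator (cball x R) y)"
    by (intro integrable_mult_right integrable_real_indicator) (auto simp: emeasure_lborel_cball_finite[unfolded infinity_ennreal_def])
  have le: "norm (u y *\<^sub>R k y) \<le> K * B * indicator (cball x R) y" for y
    using mult_mono[OF u(2)[of y] k[of y]] K by (simp add: mult_ac)
  have ge: "0 \<le> K * B * indicator (cball x R) y" for y using le[of y] norm_ge_zero order_trans by blast
  have int2: "integrable lborel (\<lambda>y. u y *\<^sub>R k y)"
    by (rule Bochner_Integration.integrable_bound[OF int]) (use u mk le ge in \<open>auto simp del: norm_scaleR\<close>)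
  have "norm (\<integral>y. u y *\<^sub>R k y \<partial>lborel) \<le> (\<integral>y. norm (u y *\<^sub>R k y) \<partial>lborel)" by (rule integral_norm_bound)
  also have "\<dots> \<le> (\<integral>y. K * B * indicator (cball x R) y \<partial>lborel)"
    by (intro integral_mono le integrable_norm int int2)
  also have "\<dots> = K * B * measure lborel (cball x R)" by simp
  also have "measure lborel (cball x R) = measure lborel (cball (0::real^'d) R)"
    by (cases "R \<ge> 0") (auto simp: content_cball)
  finally show ?thesis .
qed

context
  fixes r :: real
  assumes r: "0 < r"
begin

text \<open>The modulus depends on \<open>u\<close> only through a bound on \<open>\<bar>u\<bar>\<close>. This uniformity allows \<open>u\<close> to vary in the
comparison argument while the mollification is kept fixed.\<close>
lemma mollify_hess_modulus:
  assumes "0 < e"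
  shows "\<exists>d>0. \<forall>u :: real^'d \<Rightarrow> real. u \<in> borel_measurable borel \<longrightarrow> (\<forall>y. \<bar>u y\<bar> \<le> K) \<longrightarrow>
     (\<forall>x x'. dist x x' < d \<longrightarrow> norm (mollify_hess r u x - mollify_hess r u x') \<le> e)"
proof -
  define C where "C = (\<integral>y. bump r 3 (y::real^'d) \<partial>lborel)"
  have C: "C > 0" unfolding C_def using r by (intro integral_bump_pos) auto
  define V where "V = measure lborel (cball (0::real^'d) (r + 1))"
  have V: "V \<ge> 0" by (simp add: V_def)
  define e' where "e' = e * C / ((\<bar>K\<bar> + 1) * (V + 1))"
  have e': "e' > 0" using assms C V by (simp add: e'_def)
  obtain d where d: "d > 0" "d < 1" "\<And>y y'::real^'d. dist y y' < d \<Longrightarrow> norm (bump_hess r y - bump_hess r y') \<le> e'"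
    using uniform_compact_support[OF continuous_on_bump_hess bump_hess_outside[OF r] e'] by metis
  have "norm (mollify_hess r u x - mollify_hess r u x') \<le> e"
    if u: "u \<in> borel_measurable borel" "\<And>y. \<bar>u y\<bar> \<le> K" and xx: "dist x x' < d" for u :: "real^'d \<Rightarrow> real" and x x'
  proof -
    have K: "0 \<le> K" using u(2)[of 0] by linarith
    have ib: "integrable lborel (\<lambda>y. u y *\<^sub>R bump_hess r (y - x))" for x
      by (intro integrable_bounded_mult[OF _ u(2)] integrable_lborel_shift
          integrable_compact_support[OF continuous_on_bump_hess bump_hess_outside[OF r]]) (use u in auto)
    have mb: "bump_hess r \<in> borel_measurable borel"
      by (rule borel_measurable_continuous_onI[OF continuous_on_bump_hess])
    have "norm (\<integral>y. u y *\<^sub>R (bump_hess r (y - x) - bump_hess r (y - x')) \<partial>lborel)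
        \<le> K * e' * measure lborel (cball (0::real^'d) (r + 1))"
    proof (rule norm_kernel_integral_le[OF u, where x = x])
      show "(\<lambda>y. bump_hess r (y - x) - bump_hess r (y - x')) \<in> borel_measurable borel"
        using mb by measurable
      fix y
      show "norm (bump_hess r (y - x) - bump_hess r (y - x')) \<le> e' * indicator (cball x (r + 1)) y"
      proof (cases "y \<in> cball x (r + 1)")
        case True
        have "dist (y - x) (y - x') < d" using xx by (simp add: dist_norm norm_minus_commute)
        from d(3)[OF this] True show ?thesis by simp
      next
        case False
        then have "r \<le> norm (y - x)" by (simp add: dist_norm norm_minus_commute)
        moreover have "r \<le> norm (y - x')"
          using False xx d(2) dist_triangle[of x y x'] by (simp add: dist_norm norm_minus_commute)
        ultimately show ?thesis using False by (simp add: bump_hess_outside[OF r])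
      qed
    qed
    moreover have "mollify_hess r u x - mollify_hess r u x' =
        (1 / C) *\<^sub>R (\<integral>y. u y *\<^sub>R (bump_hess r (y - x) - bump_hess r (y - x')) \<partial>lborel)"
      unfolding mollify_hess_def C_def[symmetric] scaleR_diff_right
      by (subst Bochner_Integration.integral_diff[OF ib ib]) (simp add: scaleR_diff_right)
    ultimately have "norm (mollify_hess r u x - mollify_hess r u x') \<le> K * e' * V / C"
      using C by (simp add: V_def divide_simps)
    also have "\<dots> = e * (K / (\<bar>K\<bar> + 1)) * (V / (V + 1))"
      using C V by (simp add: e'_def divide_simps)
    also have "\<dots> \<le> e * 1 * 1"
      using assms K V by (intro mult_mono) (auto simp: divide_simps)
    finally show ?thesis by simp
  qed
  then show ?thesis using d(1) by blast
qed

lemma mollify_hess_bound: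
  shows "\<exists>D\<ge>0. \<forall>u :: real^'d \<Rightarrow> real. u \<in> borel_measurable borel \<longrightarrow> (\<forall>y. \<bar>u y\<bar> \<le> K) \<longrightarrow> (\<forall>x. norm (mollify_hess r u x) \<le> D)"
proof -
  define C where "C = (\<integral>y. bump r 3 (y::real^'d) \<partial>lborel)"
  have C: "C > 0" unfolding C_def using r by (intro integral_bump_pos) auto
  obtain Bh where Bh: "Bh \<ge> 0" "\<And>y::real^'d. norm (bump_hess r y) \<le> Bh"
    using bounded_compact_support[OF continuous_on_bump_hess bump_hess_outside[OF r]] by metis
  have "norm (mollify_hess r u x) \<le> \<bar>K * Bh * measure lborel (cball (0::real^'d) r) / C\<bar>"
    if u: "u \<in> borel_measurable borel" "\<And>y. \<bar>u y\<bar> \<le> K" for u :: "real^'d \<Rightarrow> real" and x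
  proof -
    have "norm (\<integral>y. u y *\<^sub>R bump_hess r (y - x) \<partial>lborel) \<le> K * Bh * measure lborel (cball (0::real^'d) r)"
    proof (rule norm_kernel_integral_le[OF u, where x = x])
      have "bump_hess r \<in> borel_measurable (borel :: (real^'d) measure)"
        by (rule borel_measurable_continuous_onI[OF continuous_on_bump_hess])
      then show "(\<lambda>y. bump_hess r (y - x)) \<in> borel_measurable borel" by measurable
      show "norm (bump_hess r (y - x)) \<le> Bh * indicator (cball x r) y" for y
        using bump_hess_outside[OF r, of "y - x"] Bh(2)[of "y - x"]
        by (cases "norm (y - x) \<le> r") (auto simp: indicator_def dist_norm norm_minus_commute)
    qed
    then have "norm (mollify_hess r u x) \<le> K * Bh * measure lborel (cball (0::real^'d) r) / C"
      using C by (simp add: mollify_hess_def C_def[symmetric] divide_right_mono)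
    then show ?thesis by linarith
  qed
  then show ?thesis by (intro exI[of _ "\<bar>K * Bh * measure lborel (cball (0::real^'d) r) / C\<bar>"]) auto
qed

lemma C2b_mollify:
  fixes u :: "real^'d \<Rightarrow> real"
  assumes u: "u \<in> borel_measurable borel" "\<And>y. \<bar>u y\<bar> \<le> K"
  shows "C2b (mollify r u) (mollify_grad r u) (mollify_hess r u)"
proof -
  define C where "C = (\<integral>y. bump r 3 (y::real^'d) \<partial>lborel)"
  have C: "C > 0" unfolding C_def using r by (intro integral_bump_pos) auto
  obtain Bg where Bg: "Bg \<ge> 0" "\<And>y::real^'d. norm (bump_grad r y) \<le> Bg"
    using bounded_compact_support[OF continuous_on_bump_grad bump_grad_outside[OF r]] by metis
  obtain Bh where Bh: "Bh \<ge> 0" "\<And>y::real^'d. norm (bump_hess r y) \<le> Bh"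
    using bounded_compact_support[OF continuous_on_bump_hess bump_hess_outside[OF r]] by metis
  have Bhh: "norm (bump_hess r y *v h) \<le> Bh * norm h" for y h :: "real^'d"
    using norm_matrix_vector_mult_le[of "bump_hess r y" h] mult_right_mono[OF Bh(2) norm_ge_zero[of h], of y] by linarith
  have ib: "integrable lborel (\<lambda>y. u y *\<^sub>R bump_hess r (y - x))" for x
    by (intro integrable_bounded_mult[OF _ u(2)] integrable_lborel_shift
        integrable_compact_support[OF continuous_on_bump_hess bump_hess_outside[OF r]]) (use u in auto)
  have ig: "integrable lborel (\<lambda>y. u y *\<^sub>R bump_grad r (y - x))" for x
    by (intro integrable_bounded_mult[OF _ u(2)] integrable_lborel_shift
        integrable_compact_support[OF continuous_on_bump_grad bump_grad_outside[OF r]]) (use u in auto)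
  have 1: "(mollify r u has_derivative (\<lambda>h. mollify_grad r u x \<bullet> h)) (at x)" for x
  proof -
    have "((\<lambda>x. \<integral>y. u y *\<^sub>R bump r 3 (y - x) \<partial>lborel) has_derivative
           (\<lambda>h. - (\<integral>y. u y *\<^sub>R (bump_grad r (y - x) \<bullet> h) \<partial>lborel))) (at x)"
      by (rule has_derivative_kernel_integral[OF u, where r = r and B = Bg])
        (use r Bg in \<open>auto intro!: continuous_on_bump has_derivative_bump3 continuous_intros continuous_on_bump_grad
          order_trans[OF Cauchy_Schwarz_ineq2 mult_right_mono] simp: bump_grad_outside bump_outside\<close>)
    then have "((\<lambda>x. (\<integral>y. u y *\<^sub>R bump r 3 (y - x) \<partial>lborel) / C) has_derivative
           (\<lambda>h. - (\<integral>y. u y *\<^sub>R (bump_grad r (y - x) \<bullet> h) \<partial>lborel) / C)) (at x)"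
      using C by (auto intro!: derivative_eq_intros)
    moreover have "- (\<integral>y. u y *\<^sub>R (bump_grad r (y - x) \<bullet> h) \<partial>lborel) / C = mollify_grad r u x \<bullet> h" for h
      using integral_inner_left[OF ig] by (simp add: mollify_grad_def C_def)
    ultimately show ?thesis unfolding mollify_def[abs_def] C_def by simp
  qed
  note bl = bounded_linear_matrix_vector_mult_left
  have 2: "(mollify_grad r u has_derivative (\<lambda>h. mollify_hess r u x *v h)) (at x)" for x
  proof -
    have "((\<lambda>x. \<integral>y. u y *\<^sub>R bump_grad r (y - x) \<partial>lborel) has_derivative
           (\<lambda>h. - (\<integral>y. u y *\<^sub>R (bump_hess r (y - x) *v h) \<partial>lborel))) (at x)"
      by (rule has_derivative_kernel_integral[OF u, where r = r and B = Bh])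
        (use r Bhh in \<open>auto intro!: has_derivative_bump_grad continuous_on_bump_grad
          bounded_linear.continuous_on[OF bl] continuous_on_bump_hess simp: bump_grad_outside bump_hess_outside\<close>)
    then have "((\<lambda>x. (-1/C) *\<^sub>R (\<integral>y. u y *\<^sub>R bump_grad r (y - x) \<partial>lborel)) has_derivative
           (\<lambda>h. (-1/C) *\<^sub>R (- (\<integral>y. u y *\<^sub>R (bump_hess r (y - x) *v h) \<partial>lborel)))) (at x)"
      by (rule has_derivative_scaleR_right)
    moreover have "(-1/C) *\<^sub>R (- (\<integral>y. u y *\<^sub>R (bump_hess r (y - x) *v h) \<partial>lborel)) = mollify_hess r u x *v h" for h
    proof -
      have "(-1/C) *\<^sub>R (- I) = (1/C) *\<^sub>R I" for I :: "real^'d" by simp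
      then show ?thesis
        by (simp only: integral_bounded_linear[OF bl ib] mollify_hess_def C_def[symmetric] scaleR_matrix_vector_assoc)
    qed
    ultimately show ?thesis unfolding mollify_grad_def[abs_def] C_def by simp
  qed
  have 3: "norm (\<integral>y. u y *\<^sub>R k (y - x) \<partial>lborel) \<le> K * B * measure lborel (cball (0::real^'d) r)"
    if "continuous_on UNIV k" "\<And>y. r \<le> norm y \<Longrightarrow> k y = 0" "\<And>y. norm (k y) \<le> B"
    for k :: "real^'d \<Rightarrow> 'b::euclidean_space" and B x
  proof (rule norm_kernel_integral_le[OF u, where x = x])
    have "k \<in> borel_measurable borel" using that(1) by (rule borel_measurable_continuous_onI)
    then show "(\<lambda>y. k (y - x)) \<in> borel_measurable borel" by measurable
    show "norm (k (y - x)) \<le> B * indicator (cball x r) y" for y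
      using that(2)[of "y - x"] that(3)[of "y - x"]
      by (cases "norm (y - x) \<le> r") (auto simp: indicator_def dist_norm norm_minus_commute)
  qed
  have 4: "norm (\<integral>y. u y *\<^sub>R bump r 3 (y - x) \<partial>lborel) \<le> K * (r\<^sup>2)^3 * measure lborel (cball (0::real^'d) r)" for x
  proof (rule 3[OF continuous_on_bump])
    show "norm (bump r 3 y) \<le> (r\<^sup>2)^3" for y :: "real^'d"
      using bump_le[of r 3 y] by (simp only: real_norm_def abs_of_nonneg[OF bump_nonneg])
  qed (use r in \<open>auto simp: bump_outside\<close>)
  have b1: "bounded (range (mollify r u))"
    unfolding bounded_iff
    using 4 C by (intro exI[of _ "K * (r\<^sup>2)^3 * measure lborel (cball (0::real^'d) r) / C"])
      (auto simp: mollify_def C_def[symmetric] divide_right_mono)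
  have b2: "bounded (range (mollify_grad r u))"
    unfolding bounded_iff
    using 3[OF continuous_on_bump_grad bump_grad_outside[OF r] Bg(2)] C
    by (intro exI[of _ "K * Bg * measure lborel (cball (0::real^'d) r) / C"])
      (auto simp: mollify_grad_def C_def[symmetric] divide_right_mono)
  have b3: "bounded (range (mollify_hess r u))"
    using mollify_hess_bound[of K] u unfolding bounded_iff by blast
  have b4: "uniformly_continuous_on UNIV (mollify_hess r u)"
    unfolding uniformly_continuous_on_def
  proof (intro allI impI)
    fix e :: real assume "e > 0"
    then have "e / 2 > 0" by simp
    from mollify_hess_modulus[OF this, of K] u
    obtain d where "d > 0" "\<And>x x'. dist x x' < d \<Longrightarrow> norm (mollify_hess r u x - mollify_hess r u x') \<le> e / 2"
      by metis
    then show "\<exists>d>0. \<forall>x\<in>UNIV. \<forall>x'\<in>UNIV. dist x' x < d \<longrightarrow> dist (mollify_hess r u x') (mollify_hess r u x) < e"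
      using \<open>e > 0\<close> by (intro exI[of _ d]) (force simp: dist_norm)
  qed
  show ?thesis unfolding C2b_def using 1 2 b1 b2 b3 b4 by blast
qed

lemma mollify_const: "mollify r (\<lambda>_. c) (x::real^'d) = c"
proof -
  have "bump r 3 \<in> borel_measurable (borel :: (real^'d) measure)"
    by (rule borel_measurable_continuous_onI[OF continuous_on_bump])
  moreover have "(\<integral>y. bump r 3 (y::real^'d) \<partial>lborel) > 0" using r by (intro integral_bump_pos) auto
  ultimately show ?thesis by (simp add: mollify_def integral_lborel_shift)
qed

lemma mollify_mono:
  fixes u v :: "real^'d \<Rightarrow> real"
  assumes u: "u \<in> borel_measurable borel" "\<And>y. \<bar>u y\<bar> \<le> K"
    and v: "v \<in> borel_measurable borel" "\<And>y. \<bar>v y\<bar> \<le> L"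
    and le: "\<And>y. norm (y - x) < r \<Longrightarrow> u y \<le> v y"
  shows "mollify r u x \<le> mollify r v x"
  unfolding mollify_def
proof (rule divide_right_mono)
  have i: "integrable lborel (\<lambda>y. bump r 3 (y - x))"
    using r by (intro integrable_lborel_shift integrable_bump) auto
  show "(\<integral>y. u y *\<^sub>R bump r 3 (y - x) \<partial>lborel) \<le> (\<integral>y. v y *\<^sub>R bump r 3 (y - x) \<partial>lborel)"
  proof (rule integral_mono)
    show "integrable lborel (\<lambda>y. u y *\<^sub>R bump r 3 (y - x))" "integrable lborel (\<lambda>y. v y *\<^sub>R bump r 3 (y - x))"
      using u v by (auto intro!: integrable_bounded_mult i simp del: real_scaleR_def)
    show "u y *\<^sub>R bump r 3 (y - x) \<le> v y *\<^sub>R bump r 3 (y - x)" for y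
      using le[of y] bump_outside[OF r, of 3 "y - x"] bump_nonneg[of r 3 "y - x"]
      by (cases "norm (y - x) < r") (auto intro: mult_right_mono)
  qed
  show "0 \<le> (\<integral>y. bump r 3 (y::real^'d) \<partial>lborel)" by (simp add: bump_nonneg)
qed

lemma mollify_add_const:
  fixes u :: "real^'d \<Rightarrow> real"
  assumes u: "u \<in> borel_measurable borel" "\<And>y. \<bar>u y\<bar> \<le> K"
  shows "mollify r (\<lambda>y. u y + c) x = mollify r u x + c"
proof -
  have i: "integrable lborel (\<lambda>y. bump r 3 (y - x))"
    using r by (intro integrable_lborel_shift integrable_bump) auto
  have "integrable lborel (\<lambda>y. u y *\<^sub>R bump r 3 (y - x))"
    using u by (auto intro!: integrable_bounded_mult i simp del: real_scaleR_def)
  then have "mollify r (\<lambda>y. u y + c) x = mollify r u x + mollify r (\<lambda>_. c) x"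
    using i unfolding mollify_def by (simp add: distrib_right add_divide_distrib)
  then show ?thesis by (simp add: mollify_const)
qed

lemma tendsto_kernel_integral:
  fixes k :: "real^'d \<Rightarrow> 'b::euclidean_space"
  assumes u: "\<And>n. u n \<in> borel_measurable borel" "\<And>n y. \<bar>u n y\<bar> \<le> K" "\<And>y. (\<lambda>n. u n y) \<longlonglongrightarrow> v y"
    and k: "integrable lborel k"
  shows "(\<lambda>n. \<integral>y. u n y *\<^sub>R k y \<partial>lborel) \<longlonglongrightarrow> (\<integral>y. v y *\<^sub>R k y \<partial>lborel)"
proof (rule integral_dominated_convergence[where w = "\<lambda>y. K * norm (k y)"])
  have "v \<in> borel_measurable borel" using u(3,1) by (rule borel_measurable_LIMSEQ_real)
  then show "(\<lambda>y. v y *\<^sub>R k y) \<in> borel_measurable lborel" using k by measurable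
  show "(\<lambda>y. u n y *\<^sub>R k y) \<in> borel_measurable lborel" for n using k u(1) by measurable
  show "AE y in lborel. (\<lambda>n. u n y *\<^sub>R k y) \<longlonglongrightarrow> v y *\<^sub>R k y"
    using u(3) by (intro AE_I2 tendsto_intros)
qed (use k u(2) in \<open>auto intro!: AE_I2 mult_right_mono\<close>)

lemma tendsto_mollify:
  fixes u :: "nat \<Rightarrow> real^'d \<Rightarrow> real"
  assumes "\<And>n. u n \<in> borel_measurable borel" "\<And>n y. \<bar>u n y\<bar> \<le> K" "\<And>y. (\<lambda>n. u n y) \<longlonglongrightarrow> v y"
  shows "(\<lambda>n. mollify r (u n) x) \<longlonglongrightarrow> mollify r v x"
    and "(\<lambda>n. mollify_hess r (u n) x) \<longlonglongrightarrow> mollify_hess r v x"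
  unfolding mollify_def mollify_hess_def using r
  by (auto intro!: tendsto_intros tendsto_kernel_integral[OF assms] integrable_lborel_shift integrable_bump
     integrable_compact_support[OF continuous_on_bump_hess bump_hess_outside[OF r]] less_imp_neq[THEN not_sym] integral_bump_pos
      simp del: real_scaleR_def)

end

section \<open>Averages over translations and a discrete resolvent\<close>

definition avg :: "(real^'d) pmf \<Rightarrow> (real^'d \<Rightarrow> 'b) \<Rightarrow> real^'d \<Rightarrow> 'b::{banach,second_countable_topology}" where
  "avg \<kappa> w x = measure_pmf.expectation \<kappa> (\<lambda>z. w (x + z))"

lemma integrable_pmf_bounded:
  fixes w :: "'a \<Rightarrow> 'b::{banach,second_countable_topology}"
  assumes "bounded (range w)"
  shows "integrable (measure_pmf \<kappa>) (\<lambda>z. w (f z))"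
proof -
  obtain B where "\<And>y. norm (w y) \<le> B" using assms by (auto simp: bounded_iff)
  then show ?thesis by (intro measure_pmf.integrable_const_bound[where B = B]) auto
qed

lemma norm_avg_le:
  assumes "\<And>y. norm (w y) \<le> B"
  shows "norm (avg \<kappa> w x) \<le> B"
  unfolding avg_def
proof (rule order_trans[OF integral_norm_bound measure_pmf.integral_le_const])
  have "bounded (range w)" using assms by (auto simp: bounded_iff)
  then show "integrable (measure_pmf \<kappa>) (\<lambda>z. norm (w (x + z)))"
    by (intro integrable_norm integrable_pmf_bounded)
qed (use assms in auto)

lemma bounded_avg: "bounded (range w) \<Longrightarrow> bounded (range (avg \<kappa> w))"
  unfolding bounded_iff using norm_avg_le[of w] by blast

lemma avg_diff:
  assumes "bounded (range v)" "bounded (range w)"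
  shows "avg \<kappa> v x - avg \<kappa> w x' = measure_pmf.expectation \<kappa> (\<lambda>z. v (x + z) - w (x' + z))"
  unfolding avg_def using assms by (simp add: integrable_pmf_bounded)

lemma avg_modulus:
  assumes "bounded (range w)" "\<And>y y'. dist y y' < d \<Longrightarrow> norm (w y - w y') \<le> e" "dist x x' < d"
  shows "norm (avg \<kappa> w x - avg \<kappa> w x') \<le> e"
  unfolding avg_diff[OF assms(1,1)]
proof (rule order_trans[OF integral_norm_bound measure_pmf.integral_le_const])
  show "integrable (measure_pmf \<kappa>) (\<lambda>z. norm (w (x + z) - w (x' + z)))"
    using assms(1) by (intro integrable_norm Bochner_Integration.integrable_diff integrable_pmf_bounded)
qed (use assms in \<open>auto simp: dist_norm\<close>)

lemma has_derivative_avg: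
  fixes w :: "real^'d \<Rightarrow> 'b::euclidean_space"
  assumes bw: "bounded (range w)" and d: "\<And>y. (w has_derivative w' y) (at y)"
    and B: "\<And>y h. norm (w' y h) \<le> B * norm h"
  shows "(avg \<kappa> w has_derivative (\<lambda>h. measure_pmf.expectation \<kappa> (\<lambda>z. w' (x + z) h))) (at x)"
  unfolding avg_def[abs_def]
proof (rule has_derivative_integral_dominated[where r = 1 and w = "\<lambda>_. B"])
  show "integrable (measure_pmf \<kappa>) (\<lambda>z. w (x + z))" for x by (rule integrable_pmf_bounded[OF bw])
  show "((\<lambda>x. w (x + z)) has_derivative w' (x' + z)) (at x')" for z x'
  proof -
    have "((\<lambda>x. x + z) has_derivative (\<lambda>h. h)) (at x')" by (auto intro!: derivative_eq_intros)
    from has_derivative_compose[OF this d] show ?thesis .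
  qed
qed (use B in auto)

lemma C2b_avg:
  assumes "C2b w g H"
  shows "C2b (avg \<kappa> w) (avg \<kappa> g) (avg \<kappa> H)"
proof -
  note A = assms[unfolded C2b_def]
  obtain G where G: "\<And>y. norm (g y) \<le> G" using A by (auto simp: bounded_iff)
  obtain K where K: "\<And>y. norm (H y) \<le> K" using A by (auto simp: bounded_iff)
  have "(avg \<kappa> w has_derivative (\<lambda>h. avg \<kappa> g x \<bullet> h)) (at x)" for x
  proof -
    have "norm (g y \<bullet> h) \<le> G * norm h" for y h
      using Cauchy_Schwarz_ineq2[of "g y" h] mult_right_mono[OF G norm_ge_zero, of y h] by simp
    then have "(avg \<kappa> w has_derivative (\<lambda>h. measure_pmf.expectation \<kappa> (\<lambda>z. g (x + z) \<bullet> h))) (at x)"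
      using A by (intro has_derivative_avg) auto
    moreover have "measure_pmf.expectation \<kappa> (\<lambda>z. g (x + z) \<bullet> h) = avg \<kappa> g x \<bullet> h" for h
      unfolding avg_def using A by (intro integral_inner_left integrable_pmf_bounded) auto
    ultimately show ?thesis by simp
  qed
  moreover have "(avg \<kappa> g has_derivative (\<lambda>h. avg \<kappa> H x *v h)) (at x)" for x
  proof -
    have "norm (H y *v h) \<le> K * norm h" for y h
      using norm_matrix_vector_mult_le[of "H y" h] mult_right_mono[OF K norm_ge_zero, of y h] by simp
    then have "(avg \<kappa> g has_derivative (\<lambda>h. measure_pmf.expectation \<kappa> (\<lambda>z. H (x + z) *v h))) (at x)"
      using A by (intro has_derivative_avg) auto
    moreover have "measure_pmf.expectation \<kappa> (\<lambda>z. H (x + z) *v h) = avg \<kappa> H x *v h" for h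
      unfolding avg_def using A
      by (intro integral_bounded_linear[OF bounded_linear_matrix_vector_mult_left] integrable_pmf_bounded) auto
    ultimately show ?thesis by simp
  qed
  moreover have "uniformly_continuous_on UNIV (avg \<kappa> H)"
    unfolding uniformly_continuous_on_def
  proof (intro allI impI)
    fix e :: real assume "e > 0"
    then obtain d where d: "d > 0" "\<And>y y'. dist y y' < d \<Longrightarrow> dist (H y) (H y') < e / 2"
      using A unfolding uniformly_continuous_on_def by (metis UNIV_I half_gt_zero)
    have "dist (avg \<kappa> H y') (avg \<kappa> H y) < e" if "dist y' y < d" for y y'
      using avg_modulus[of H d "e/2" y' y \<kappa>] d(2) that A \<open>e > 0\<close> by (force simp: dist_norm)
    then show "\<exists>d>0. \<forall>x\<in>UNIV. \<forall>x'\<in>UNIV. dist x' x < d \<longrightarrow> dist (avg \<kappa> H x') (avg \<kappa> H x) < e"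
      using d(1) by blast
  qed
  ultimately show ?thesis unfolding C2b_def using A by (simp add: bounded_avg)
qed

text \<open>The finite difference version of \<open>1/2 (B B\<^sup>T) : \<nabla>\<^sup>2\<close>, the sum running over the columns of \<open>B\<close>.\<close>
definition second_diff :: "real^'d^'d \<Rightarrow> real \<Rightarrow> (real^'d \<Rightarrow> real) \<Rightarrow> real^'d \<Rightarrow> real" where
  "second_diff B h w x =
     (\<Sum>i\<in>UNIV. w (x + h *\<^sub>R column i B) + w (x - h *\<^sub>R column i B) - 2 * w x) / (2 * h\<^sup>2)"

lemma inner_matrix_mult_transpose:
  "(B ** transpose B) \<bullet> H = (\<Sum>i\<in>UNIV. column i B \<bullet> (H *v column i B))" for B H :: "real^'d^'d"
proof -
  have "(B ** transpose B) \<bullet> H = (\<Sum>k\<in>UNIV. \<Sum>l\<in>UNIV. \<Sum>i\<in>UNIV. B $ k $ i * B $ l $ i * H $ k $ l)"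
    by (simp add: inner_vec_def matrix_matrix_mult_def transpose_def sum_distrib_right)
  also have "\<dots> = (\<Sum>k\<in>UNIV. \<Sum>i\<in>UNIV. \<Sum>l\<in>UNIV. B $ k $ i * B $ l $ i * H $ k $ l)"
    by (intro sum.cong refl sum.swap)
  also have "\<dots> = (\<Sum>i\<in>UNIV. \<Sum>k\<in>UNIV. \<Sum>l\<in>UNIV. B $ k $ i * B $ l $ i * H $ k $ l)"
    by (rule sum.swap)
  also have "\<dots> = (\<Sum>i\<in>UNIV. column i B \<bullet> (H *v column i B))"
    by (simp add: inner_vec_def matrix_vector_mult_def column_def sum_distrib_left mult_ac)
  finally show ?thesis .
qed

text \<open>Two applications of the mean value theorem in the step size: the second derivative of the
remainder is the deviation of the Hessian at two nearby points from its value at \<open>x\<close>.\<close>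
lemma second_difference_bound:
  fixes w :: "real^'d \<Rightarrow> real"
  assumes w: "\<And>x. (w has_derivative (\<lambda>h. g x \<bullet> h)) (at x)" "\<And>x. (g has_derivative (\<lambda>h. H x *v h)) (at x)"
    and mod: "\<And>y. dist y x < d \<Longrightarrow> norm (H y - H x) \<le> e"
    and h: "0 < h" "h * norm m < d"
  shows "\<bar>w (x + h *\<^sub>R m) + w (x - h *\<^sub>R m) - 2 * w x - h\<^sup>2 * (m \<bullet> (H x *v m))\<bar> \<le> 2 * h\<^sup>2 * e * (norm m)\<^sup>2"
proof -
  define \<xi> where "\<xi> t = w (x + t *\<^sub>R m) + w (x - t *\<^sub>R m) - 2 * w x - t\<^sup>2 * (m \<bullet> (H x *v m))" for t
  define \<xi>' where "\<xi>' t = g (x + t *\<^sub>R m) \<bullet> m - g (x - t *\<^sub>R m) \<bullet> m - 2 * t * (m \<bullet> (H x *v m))" for t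
  define \<xi>'' where "\<xi>'' t = ((H (x + t *\<^sub>R m) - H x) *v m) \<bullet> m + ((H (x - t *\<^sub>R m) - H x) *v m) \<bullet> m" for t
  have lp: "((\<lambda>t. x + t *\<^sub>R m) has_derivative (\<lambda>s. s *\<^sub>R m)) (at t)" for t
    by (auto intro!: derivative_eq_intros)
  have lm: "((\<lambda>t. x - t *\<^sub>R m) has_derivative (\<lambda>s. - (s *\<^sub>R m))) (at t)" for t
    by (auto intro!: derivative_eq_intros)
  have e1: "((\<lambda>t. w (x + t *\<^sub>R m)) has_real_derivative g (x + t *\<^sub>R m) \<bullet> m) (at t)" for t
    by (rule has_derivative_imp_has_field_derivative[OF has_derivative_compose[OF lp w(1)]]) simp
  have e2: "((\<lambda>t. w (x - t *\<^sub>R m)) has_real_derivative - (g (x - t *\<^sub>R m) \<bullet> m)) (at t)" for t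
    by (rule has_derivative_imp_has_field_derivative[OF has_derivative_compose[OF lm w(1)]]) simp
  have e3: "((\<lambda>t. g (x + t *\<^sub>R m) \<bullet> m) has_real_derivative (H (x + t *\<^sub>R m) *v m) \<bullet> m) (at t)" for t
    by (rule has_derivative_imp_has_field_derivative[OF has_derivative_inner_left[OF has_derivative_compose[OF lp w(2)]]])
      (simp add: matrix_vector_mult_scaleR)
  have e4: "((\<lambda>t. g (x - t *\<^sub>R m) \<bullet> m) has_real_derivative - ((H (x - t *\<^sub>R m) *v m) \<bullet> m)) (at t)" for t
    by (rule has_derivative_imp_has_field_derivative[OF has_derivative_inner_left[OF has_derivative_compose[OF lm w(2)]]])
      (simp add: matrix_vector_mult_scaleR linear_neg[OF matrix_vector_mul_linear])
  have d1: "(\<xi> has_real_derivative \<xi>' t) (at t)" for t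
  proof -
    have "(\<xi> has_real_derivative (g (x + t *\<^sub>R m) \<bullet> m + - (g (x - t *\<^sub>R m) \<bullet> m) - 0) - 2 * t * (m \<bullet> (H x *v m))) (at t)"
      unfolding \<xi>_def[abs_def]
      by (intro DERIV_diff DERIV_add e1 e2 DERIV_const) (auto intro!: derivative_eq_intros)
    then show ?thesis by (simp add: \<xi>'_def)
  qed
  have d2: "(\<xi>' has_real_derivative \<xi>'' t) (at t)" for t
  proof -
    have "(\<xi>' has_real_derivative ((H (x + t *\<^sub>R m) *v m) \<bullet> m - - ((H (x - t *\<^sub>R m) *v m) \<bullet> m)) - 2 * (m \<bullet> (H x *v m))) (at t)"
      unfolding \<xi>'_def[abs_def]
      by (intro DERIV_diff e3 e4) (auto intro!: derivative_eq_intros)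
    then show ?thesis
      by (simp add: \<xi>''_def matrix_vector_mult_diff_rdistrib inner_diff_left inner_diff_right inner_commute)
  qed
  have b2: "\<bar>\<xi>'' t\<bar> \<le> 2 * e * (norm m)\<^sup>2" if "0 \<le> t" "t \<le> h" for t
  proof -
    have tm: "t * norm m < d" using that h mult_right_mono[of t h "norm m"] by simp
    have *: "\<bar>((H y - H x) *v m) \<bullet> m\<bar> \<le> e * (norm m)\<^sup>2" if "dist y x < d" for y
    proof -
      have "\<bar>((H y - H x) *v m) \<bullet> m\<bar> \<le> norm ((H y - H x) *v m) * norm m" by (rule Cauchy_Schwarz_ineq2)
      also have "\<dots> \<le> (norm (H y - H x) * norm m) * norm m"
        by (intro mult_right_mono norm_matrix_vector_mult_le norm_ge_zero)
      also have "\<dots> \<le> (e * norm m) * norm m" using mod[OF that] by (intro mult_right_mono) auto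
      finally show ?thesis by (simp add: power2_eq_square mult_ac)
    qed
    have "dist (x + t *\<^sub>R m) x < d" "dist (x - t *\<^sub>R m) x < d" using tm that by (auto simp: dist_norm)
    from *[OF this(1)] *[OF this(2)] show ?thesis unfolding \<xi>''_def by linarith
  qed
  have b1: "\<bar>\<xi>' t\<bar> \<le> 2 * e * (norm m)\<^sup>2 * h" if t: "0 \<le> t" "t \<le> h" for t
  proof (cases "t = 0")
    case True
    have "0 \<le> 2 * e * (norm m)\<^sup>2" using b2[of 0] h by linarith
    then show ?thesis using h True by (simp add: \<xi>'_def)
  next
    case False
    then obtain s where s: "0 < s" "s < t" "\<xi>' t - \<xi>' 0 = (t - 0) * \<xi>'' s"
      using MVT2[of 0 t \<xi>' \<xi>''] t d2 by auto
    have "\<bar>\<xi>' t\<bar> = t * \<bar>\<xi>'' s\<bar>" using s t by (simp add: \<xi>'_def[of 0] abs_mult)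
    also have "\<dots> \<le> h * (2 * e * (norm m)\<^sup>2)" using s t by (intro mult_mono b2) auto
    finally show ?thesis by (simp add: mult_ac)
  qed
  obtain s where s: "0 < s" "s < h" "\<xi> h - \<xi> 0 = (h - 0) * \<xi>' s"
    using MVT2[of 0 h \<xi> \<xi>'] h d1 by auto
  have "\<bar>\<xi> h\<bar> = h * \<bar>\<xi>' s\<bar>" using s h by (simp add: \<xi>_def[of 0] abs_mult)
  also have "\<dots> \<le> h * (2 * e * (norm m)\<^sup>2 * h)" using s h by (intro mult_left_mono b1) auto
  finally show ?thesis by (simp add: \<xi>_def power2_eq_square mult_ac)
qed

lemma second_diff_approx:
  fixes w :: "real^'d \<Rightarrow> real"
  assumes w: "\<And>x. (w has_derivative (\<lambda>h. g x \<bullet> h)) (at x)" "\<And>x. (g has_derivative (\<lambda>h. H x *v h)) (at x)"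
    and mod: "\<And>y. dist y x < d \<Longrightarrow> norm (H y - H x) \<le> e"
    and h: "0 < h" "\<And>i. h * norm (column i B) < d"
  shows "\<bar>second_diff B h w x - 1/2 * ((B ** transpose B) \<bullet> H x)\<bar> \<le> e * (\<Sum>i\<in>UNIV. (norm (column i B))\<^sup>2)"
proof -
  let ?t = "\<lambda>i. w (x + h *\<^sub>R column i B) + w (x - h *\<^sub>R column i B) - 2 * w x - h\<^sup>2 * (column i B \<bullet> (H x *v column i B))"
  have "second_diff B h w x - 1/2 * ((B ** transpose B) \<bullet> H x) = (\<Sum>i\<in>UNIV. ?t i) / (2 * h\<^sup>2)"
  proof -
    have "(\<Sum>i\<in>UNIV. ?t i) = (\<Sum>i\<in>UNIV. w (x + h *\<^sub>R column i B) + w (x - h *\<^sub>R column i B) - 2 * w x)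
        - h\<^sup>2 * ((B ** transpose B) \<bullet> H x)"
      by (simp only: sum_subtractf sum_distrib_left inner_matrix_mult_transpose)
    then show ?thesis using h(1) by (simp add: second_diff_def diff_divide_distrib)
  qed
  also have "\<bar>\<dots>\<bar> \<le> (\<Sum>i\<in>UNIV. 2 * h\<^sup>2 * e * (norm (column i B))\<^sup>2) / (2 * h\<^sup>2)"
  proof -
    have "\<bar>\<Sum>i\<in>UNIV. ?t i\<bar> \<le> (\<Sum>i\<in>UNIV. 2 * h\<^sup>2 * e * (norm (column i B))\<^sup>2)"
      by (intro order_trans[OF sum_abs] sum_mono second_difference_bound[OF w mod] h(1)) (use h in auto)
    then show ?thesis by (simp add: abs_divide divide_right_mono)
  qed
  also have "\<dots> = e * (\<Sum>i\<in>UNIV. (norm (column i B))\<^sup>2)"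
    using h(1) by (simp add: sum_distrib_left[symmetric] mult_ac)
  finally show ?thesis .
qed

lemma pmf_expectation_bind_bounded:
  fixes f :: "'b \<Rightarrow> real"
  assumes "bounded (range f)"
  shows "measure_pmf.expectation (bind_pmf p K) f = measure_pmf.expectation p (\<lambda>x. measure_pmf.expectation (K x) f)"
proof -
  obtain B where B: "\<And>y. \<bar>f y\<bar> \<le> B" using assms by (auto simp: bounded_iff)
  show ?thesis unfolding measure_pmf_bind
    by (rule integral_bind[where K = "count_space UNIV" and B = B and B' = 1])
      (use B measurable_measure_pmf[of K] in auto)
qed

fun walk :: "'a::monoid_add pmf \<Rightarrow> nat \<Rightarrow> 'a pmf" where
  "walk s 0 = return_pmf 0"
| "walk s (Suc n) = bind_pmf s (\<lambda>z. map_pmf ((+) z) (walk s n))"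

text \<open>The position of a random walk at a geometric time: with probability \<open>p\<close> the walk has not started,
otherwise one step is made and the same law is used again.\<close>
lemma geometric_walk_unfold:
  fixes s :: "'a::monoid_add pmf"
  assumes p: "p \<in> {0<..1}"
  defines "\<kappa> \<equiv> bind_pmf (geometric_pmf p) (walk s)"
  shows "\<kappa> = bind_pmf (bernoulli_pmf p) (\<lambda>b. if b then return_pmf 0 else bind_pmf s (\<lambda>z. map_pmf ((+) z) \<kappa>))"
proof -
  have "\<kappa> = bind_pmf (bernoulli_pmf p) (\<lambda>b. bind_pmf (if b then return_pmf 0 else map_pmf Suc (geometric_pmf p)) (walk s))"
    unfolding \<kappa>_def by (subst geometric_bind_pmf_unfold[OF p]) (simp add: bind_assoc_pmf)
  also have "\<dots> = bind_pmf (bernoulli_pmf p) (\<lambda>b. if b then return_pmf 0 else bind_pmf s (\<lambda>z. map_pmf ((+) z) \<kappa>))"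
    unfolding \<kappa>_def
    by (intro bind_pmf_cong refl)
      (simp add: bind_return_pmf bind_map_pmf map_bind_pmf bind_commute_pmf[of "geometric_pmf p"])
  finally show ?thesis .
qed

text \<open>The equation \<open>v = w + \<alpha> L\<^sub>h v\<close> can be read as \<open>v = p w + (1 - p) P v\<close>, where \<open>P\<close> averages over one step
\<open>\<plusminus>h\<close> along a random column of \<open>B\<close>. The average over the geometrically stopped walk satisfies it.\<close>
lemma resolvent_exists:
  fixes B :: "real^'d^'d"
  assumes \<alpha>: "0 < \<alpha>" and h: "0 < h"
  shows "\<exists>\<kappa>. \<forall>w :: real^'d \<Rightarrow> real. bounded (range w) \<longrightarrow>
     (\<forall>x. avg \<kappa> w x = w x + \<alpha> * second_diff B h (avg \<kappa> w) x)"
proof -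
  define N where "N = real CARD('d)"
  have N: "N > 0" by (simp add: N_def)
  \<comment> \<open>\<open>L\<^sub>h = (N / h\<^sup>2) (P - 1)\<close>, so \<open>p\<close> solves \<open>(1 - p) / p = \<alpha> N / h\<^sup>2\<close>\<close>
  define p where "p = 1 / (1 + \<alpha> * N / h\<^sup>2)"
  have p: "0 < p" "p \<le> 1" using \<alpha> h N by (auto simp: p_def add_pos_nonneg)
  define s where "s = map_pmf (\<lambda>(i, b). (if b then h else - h) *\<^sub>R column i B) (pmf_of_set (UNIV :: ('d \<times> bool) set))"
  define \<kappa> where "\<kappa> = bind_pmf (geometric_pmf p) (walk s)"
  have "avg \<kappa> w x = w x + \<alpha> * second_diff B h (avg \<kappa> w) x" if bw: "bounded (range w)" for w :: "real^'d \<Rightarrow> real" and x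
  proof -
    have bws: "bounded (range (\<lambda>z. w (x + z)))" for x
      by (rule bounded_subset[OF bw]) auto
    have step: "measure_pmf.expectation s (\<lambda>z. avg \<kappa> w (x + z)) =
      (\<Sum>i\<in>UNIV. avg \<kappa> w (x + h *\<^sub>R column i B) + avg \<kappa> w (x - h *\<^sub>R column i B)) / (2 * N)"
    proof -
      have "measure_pmf.expectation s (\<lambda>z. avg \<kappa> w (x + z)) =
        (\<Sum>(i,b)\<in>UNIV \<times> UNIV. avg \<kappa> w (x + (if b then h else - h) *\<^sub>R column i B)) / real CARD('d \<times> bool)"
        unfolding s_def by (simp add: integral_pmf_of_set case_prod_unfold UNIV_Times_UNIV)
      also have "(\<Sum>(i,b)\<in>UNIV \<times> UNIV. avg \<kappa> w (x + (if b then h else - h) *\<^sub>R column i B))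
        = (\<Sum>i\<in>UNIV. \<Sum>b\<in>UNIV. avg \<kappa> w (x + (if b then h else - h) *\<^sub>R column i B))"
        by (rule sum.cartesian_product[symmetric])
      finally show ?thesis by (simp add: UNIV_bool N_def add.commute mult.commute)
    qed
    have "avg \<kappa> w x = p * w x + (1 - p) * measure_pmf.expectation s (\<lambda>z. avg \<kappa> w (x + z))"
    proof -
      have "avg \<kappa> w x = measure_pmf.expectation (bind_pmf (bernoulli_pmf p) (\<lambda>b. if b then return_pmf 0 else bind_pmf s (\<lambda>z. map_pmf ((+) z) \<kappa>))) (\<lambda>z. w (x + z))"
        unfolding avg_def \<kappa>_def using p by (subst geometric_walk_unfold) auto
      also have "\<dots> = w x * p + measure_pmf.expectation (bind_pmf s (\<lambda>z. map_pmf ((+) z) \<kappa>)) (\<lambda>z. w (x + z)) * (1 - p)"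
        using p by (simp add: pmf_expectation_bind_bounded[OF bws])
      also have "measure_pmf.expectation (bind_pmf s (\<lambda>z. map_pmf ((+) z) \<kappa>)) (\<lambda>z. w (x + z))
         = measure_pmf.expectation s (\<lambda>z. avg \<kappa> w (x + z))"
        by (simp add: pmf_expectation_bind_bounded[OF bws] avg_def add.assoc)
      finally show ?thesis by (simp add: mult.commute)
    qed
    then have e: "avg \<kappa> w x = p * w x + (1 - p) * ((\<Sum>i\<in>UNIV. avg \<kappa> w (x + h *\<^sub>R column i B) + avg \<kappa> w (x - h *\<^sub>R column i B)) / (2 * N))"
      unfolding step .
    define v where "v = avg \<kappa> w x"
    define S where "S = (\<Sum>i\<in>UNIV. avg \<kappa> w (x + h *\<^sub>R column i B) + avg \<kappa> w (x - h *\<^sub>R column i B))"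
    have sd: "second_diff B h (avg \<kappa> w) x = (S - 2 * N * v) / (2 * h\<^sup>2)"
      by (simp add: second_diff_def S_def v_def N_def sum_subtractf)
    have q: "1 + \<alpha> * N / h\<^sup>2 > 0" using \<alpha> h N by (simp add: add_pos_nonneg)
    have "(1 + \<alpha> * N / h\<^sup>2) * v = (1 + \<alpha> * N / h\<^sup>2) * (p * w x + (1 - p) * (S / (2 * N)))"
      using e by (simp add: v_def S_def)
    also have "\<dots> = w x + (1 + \<alpha> * N / h\<^sup>2 - 1) * (S / (2 * N))"
    proof -
      have "(1 + \<alpha> * N / h\<^sup>2) * p = 1" using q by (simp add: p_def)
      moreover have "Q * (p * w x + (1 - p) * X) = (Q * p) * w x + (Q - Q * p) * X" for Q X
        by (simp add: algebra_simps)
      ultimately show ?thesis by (simp only: mult_1_left)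
    qed
    also have "\<dots> = w x + \<alpha> * S / (2 * h\<^sup>2)" using N by simp
    finally have *: "(1 + \<alpha> * N / h\<^sup>2) * v = w x + \<alpha> * S / (2 * h\<^sup>2)" .
    have "\<alpha> * ((S - 2 * N * v) / (2 * h\<^sup>2)) = \<alpha> * S / (2 * h\<^sup>2) - \<alpha> * N / h\<^sup>2 * v"
      by (simp add: diff_divide_distrib algebra_simps)
    with * have "v = w x + \<alpha> * ((S - 2 * N * v) / (2 * h\<^sup>2))"
      by (simp only: distrib_right mult_1_left)
    then show ?thesis by (simp add: sd v_def)
  qed
  then show ?thesis by blast
qed

section \<open>Mollified supersolutions\<close>

lemma C2b_quadratic_perturbation:
  assumes "C2b v g H"
  shows "C2_with_hessian (\<lambda>y. v y - \<epsilon> * (y \<bullet> y)) (\<lambda>y. H y - (2 * \<epsilon>) *\<^sub>R mat 1)"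
  unfolding C2_with_hessian_def
proof (intro exI[of _ "\<lambda>y. g y - (2 * \<epsilon>) *\<^sub>R y"] conjI allI)
  note A = assms[unfolded C2b_def]
  fix x
  have v: "(v has_derivative (\<lambda>h. g x \<bullet> h)) (at x)" and g: "(g has_derivative (\<lambda>h. H x *v h)) (at x)"
    using A by auto
  show "((\<lambda>y. v y - \<epsilon> * (y \<bullet> y)) has_derivative (\<lambda>h. (g x - (2 * \<epsilon>) *\<^sub>R x) \<bullet> h)) (at x)"
    by (auto intro!: derivative_eq_intros v simp: inner_diff_left inner_diff_right inner_commute)
  show "((\<lambda>y. g y - (2 * \<epsilon>) *\<^sub>R y) has_derivative (\<lambda>h. (H x - (2 * \<epsilon>) *\<^sub>R mat 1) *v h)) (at x)"
    by (auto intro!: derivative_eq_intros g simp: matrix_vector_mult_diff_rdistrib scaleR_matrix_vector_assoc[symmetric])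
  show "continuous_on UNIV (\<lambda>y. H y - (2 * \<epsilon>) *\<^sub>R mat 1)"
    using A by (intro continuous_intros) (auto intro: uniformly_continuous_imp_continuous)
qed

lemma C2b_continuous: "C2b w g H \<Longrightarrow> continuous_on UNIV w"
  unfolding C2b_def by (auto intro!: continuous_at_imp_continuous_on has_derivative_continuous)

text \<open>The quadratic term makes up for the missing compactness of the whole space.\<close>
lemma attains_min_quadratic:
  fixes F :: "real^'d \<Rightarrow> real"
  assumes F: "continuous_on UNIV F" "\<And>y. \<bar>F y\<bar> \<le> K" and \<epsilon>: "\<epsilon> > 0"
  shows "\<exists>y0. \<forall>y. F y0 + \<epsilon> * (y0 \<bullet> y0) \<le> F y + \<epsilon> * (y \<bullet> y)"
proof -
  define R where "R = sqrt (2 * K / \<epsilon>)"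
  have K: "0 \<le> K" using F(2)[of 0] by linarith
  have R: "R \<ge> 0" "\<epsilon> * R\<^sup>2 = 2 * K" using K \<epsilon> by (auto simp: R_def)
  have "continuous_on (cball 0 R) (\<lambda>y. F y + \<epsilon> * (y \<bullet> y))"
    using F(1) by (intro continuous_intros) (auto intro: continuous_on_subset)
  then obtain y0 where "\<forall>y\<in>cball 0 R. F y0 + \<epsilon> * (y0 \<bullet> y0) \<le> F y + \<epsilon> * (y \<bullet> y)"
    using continuous_attains_inf[of "cball 0 R" "\<lambda>y. F y + \<epsilon> * (y \<bullet> y)"] R(1) by auto
  then have y0: "\<And>y. y \<in> cball 0 R \<Longrightarrow> F y0 + \<epsilon> * (y0 \<bullet> y0) \<le> F y + \<epsilon> * (y \<bullet> y)" by blast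
  have "F y0 + \<epsilon> * (y0 \<bullet> y0) \<le> F y + \<epsilon> * (y \<bullet> y)" for y
  proof (cases "y \<in> cball 0 R")
    case False
    then have "R\<^sup>2 \<le> (norm y)\<^sup>2" using R(1) by (intro power_mono) auto
    then have "2 * K \<le> \<epsilon> * (y \<bullet> y)" using R(2) \<epsilon> by (simp add: dot_square_norm flip: R(2))
    moreover have "F y0 + \<epsilon> * (y0 \<bullet> y0) \<le> F 0" using y0[of 0] R(1) by simp
    ultimately show ?thesis using F(2)[of 0] F(2)[of y] by linarith
  qed (rule y0)
  then show ?thesis by blast
qed

text \<open>Comparison principle. With \<open>v = avg \<kappa> w\<close>, the difference \<open>u - v\<close> plus a small multiple of \<open>|y|\<^sup>2\<close>
attains its minimum at some \<open>y0\<close>, where a perturbation of \<open>v\<close> touches \<open>u\<close> from below. There the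
touching bound controls the second difference of \<open>v\<close>, and the resolvent equation together with
\<open>w \<le> u\<close> bounds \<open>v - u\<close> at \<open>y0\<close>, which is its largest value up to the perturbation.\<close>
lemma resolvent_comparison:
  fixes B :: "real^'d^'d" and u w :: "real^'d \<Rightarrow> real"
  defines "S \<equiv> (\<Sum>i\<in>UNIV. (norm (column i B))\<^sup>2)"
  assumes u: "continuous_on UNIV u" "\<And>y. \<bar>u y\<bar> \<le> K"
    and touch: "\<And>\<phi> H x. C2_with_hessian \<phi> H \<Longrightarrow> local_minimum (\<lambda>y. u y - \<phi> y) x \<Longrightarrow>
        1/2 * ((B ** transpose B) \<bullet> H x) \<le> c"
    and w: "C2b w g H" "\<And>y. w y \<le> u y"
    and mod: "\<And>y y'. dist y y' < d \<Longrightarrow> norm (H y - H y') \<le> e"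
    and h: "0 < h" "\<And>i. h * norm (column i B) < d"
    and \<alpha>: "0 < \<alpha>"
    and res: "\<And>x. avg \<kappa> w x = w x + \<alpha> * second_diff B h (avg \<kappa> w) x"
  shows "avg \<kappa> w x \<le> u x + \<alpha> * (c + e * S)"
proof -
  define M where "M = B ** transpose B"
  define \<tau> where "\<tau> = \<bar>M \<bullet> mat 1\<bar>"
  define v where "v = avg \<kappa> w"
  have C2v: "C2b v (avg \<kappa> g) (avg \<kappa> H)" unfolding v_def by (rule C2b_avg[OF w(1)])
  note A = C2v[unfolded C2b_def]
  obtain L where L: "\<And>y. \<bar>v y\<bar> \<le> L" using A by (auto simp: bounded_iff)
  have bH: "bounded (range H)" using w(1) by (simp add: C2b_def)
  have eps: "v x \<le> u x + \<alpha> * (c + e * S) + \<epsilon> * (\<alpha> * \<tau> + x \<bullet> x)" if \<epsilon>: "\<epsilon> > 0" for \<epsilon>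
  proof -
    have "continuous_on UNIV (\<lambda>y. u y - v y)" by (intro continuous_intros u(1) C2b_continuous[OF C2v])
    moreover have "\<bar>u y - v y\<bar> \<le> K + L" for y using u(2)[of y] L[of y] by linarith
    ultimately obtain y0 where y0: "\<And>y. u y0 - v y0 + \<epsilon> * (y0 \<bullet> y0) \<le> u y - v y + \<epsilon> * (y \<bullet> y)"
      using attains_min_quadratic[of "\<lambda>y. u y - v y", OF _ _ \<epsilon>] by blast
    have "local_minimum (\<lambda>y. u y - (v y - \<epsilon> * (y \<bullet> y))) y0"
      unfolding local_minimum_def using y0 by (intro always_eventually) (auto simp: algebra_simps)
    from touch[OF C2b_quadratic_perturbation[OF C2v] this]
    have "1/2 * (M \<bullet> avg \<kappa> H y0) \<le> c + \<epsilon> * (M \<bullet> mat 1)"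
      by (simp add: M_def inner_diff_right)
    also have "\<dots> \<le> c + \<epsilon> * \<tau>" using \<epsilon> by (simp add: \<tau>_def)
    finally have 1: "1/2 * (M \<bullet> avg \<kappa> H y0) \<le> c + \<epsilon> * \<tau>" .
    have "\<bar>second_diff B h v y0 - 1/2 * ((B ** transpose B) \<bullet> avg \<kappa> H y0)\<bar> \<le> e * S"
      unfolding S_def
      by (rule second_diff_approx[where g = "avg \<kappa> g" and d = d])
        (use A h avg_modulus[OF bH mod] in auto)
    with 1 have "second_diff B h v y0 \<le> c + \<epsilon> * \<tau> + e * S" by (simp add: M_def)
    then have "v y0 \<le> u y0 + \<alpha> * (c + \<epsilon> * \<tau> + e * S)"
      using res[of y0] w(2)[of y0] mult_left_mono[of _ _ \<alpha>] \<alpha> unfolding v_def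
      by (smt (verit, best))
    moreover have "0 \<le> \<epsilon> * (y0 \<bullet> y0)" using \<epsilon> by simp
    ultimately show ?thesis using y0[of x] by (simp add: algebra_simps)
  qed
  have "v x \<le> u x + \<alpha> * (c + e * S) + \<delta>" if \<delta>: "\<delta> > 0" for \<delta>
  proof -
    define q where "q = \<alpha> * \<tau> + x \<bullet> x"
    have q: "q \<ge> 0" using \<alpha> by (simp add: q_def \<tau>_def)
    have "\<delta> / (q + 1) * q \<le> \<delta>" using \<delta> q by (simp add: field_simps)
    then show ?thesis using eps[of "\<delta> / (q + 1)"] \<delta> q unfolding q_def[symmetric] by simp
  qed
  then show ?thesis unfolding v_def by (rule field_le_epsilon)
qed

lemma mollify_avg:
  fixes w :: "real^'d \<Rightarrow> real"
  assumes r: "0 < r" and w: "w \<in> borel_measurable borel" "\<And>y. \<bar>w y\<bar> \<le> K"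
  shows "mollify r (avg \<kappa> w) x = avg \<kappa> (mollify r w) x"
proof -
  have mb: "bump r 3 \<in> borel_measurable (borel :: (real^'d) measure)"
    by (rule borel_measurable_continuous_onI[OF continuous_on_bump])
  have ib: "integrable lborel (\<lambda>y. bump r 3 (y - x))"
    using r by (intro integrable_lborel_shift integrable_bump) auto
  interpret P: pair_sigma_finite "measure_pmf \<kappa>" "lborel :: (real^'d) measure"
    by unfold_locales
  let ?f = "\<lambda>z y. w (y + z) * bump r 3 (y - x)"
  have madd: "(\<lambda>p. snd p + fst p) \<in> measure_pmf \<kappa> \<Otimes>\<^sub>M lborel \<rightarrow>\<^sub>M (borel :: (real^'d) measure)"
  proof (rule borel_measurable_add)
    have "(\<lambda>z. z) \<in> measure_pmf \<kappa> \<rightarrow>\<^sub>M borel" by simp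
    from measurable_compose[OF measurable_fst this]
    show "(\<lambda>p. fst p) \<in> borel_measurable (measure_pmf \<kappa> \<Otimes>\<^sub>M (lborel :: (real^'d) measure))" .
  qed simp
  have wi: "integrable lborel (\<lambda>y. w (y + z) * bump r 3 (y - x))" for z
    using integrable_bounded_mult[of "\<lambda>y. w (y + z)" lborel K "\<lambda>y. bump r 3 (y - x)"] w ib by simp
  have "integrable (measure_pmf \<kappa> \<Otimes>\<^sub>M lborel) (\<lambda>(z, y). ?f z y)"
  proof (rule P.Fubini_integrable)
    show "(\<lambda>(z, y). ?f z y) \<in> borel_measurable (measure_pmf \<kappa> \<Otimes>\<^sub>M lborel)"
      unfolding case_prod_unfold using w(1) mb measurable_compose[OF madd w(1)] by measurable
    show "integrable (measure_pmf \<kappa>) (\<lambda>z. \<integral>y. norm (case (z, y) of (z, y) \<Rightarrow> ?f z y) \<partial>lborel)"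
    proof (rule measure_pmf.integrable_const_bound[where B = "\<integral>y. K * bump r 3 (y - x) \<partial>lborel"])
      have "(\<integral>y. norm (?f z y) \<partial>lborel) \<le> (\<integral>y. K * bump r 3 (y - x) \<partial>lborel)" for z
        by (intro integral_mono integrable_norm wi integrable_mult_right ib)
          (auto simp: abs_mult bump_nonneg abs_of_nonneg intro: mult_right_mono w(2))
      then show "AE z in measure_pmf \<kappa>. norm (\<integral>y. norm (case (z, y) of (z, y) \<Rightarrow> ?f z y) \<partial>lborel) \<le> (\<integral>y. K * bump r 3 (y - x) \<partial>lborel)"
        by simp
    qed simp
    show "AE z in measure_pmf \<kappa>. integrable lborel (\<lambda>y. case (z, y) of (z, y) \<Rightarrow> ?f z y)"
      using wi by simp
  qed
  from P.Fubini_integral[OF this]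
  have F: "(\<integral>y. measure_pmf.expectation \<kappa> (\<lambda>z. ?f z y) \<partial>lborel) = measure_pmf.expectation \<kappa> (\<lambda>z. \<integral>y. ?f z y \<partial>lborel)" .
  have "(\<integral>y. w y *\<^sub>R bump r 3 (y - (x + z)) \<partial>lborel) = (\<integral>y. ?f z y \<partial>lborel)" for z
  proof -
    have "(\<lambda>y. ?f z y) \<in> borel_measurable borel" using w(1) mb by measurable
    from integral_lborel_shift[OF this, of z] show ?thesis by (simp add: algebra_simps)
  qed
  then show ?thesis using F by (simp add: mollify_def avg_def)
qed

text \<open>Mollifying \<open>local_inf \<delta> u\<close> at the scale \<open>\<delta>\<close> only uses values that are at most \<open>u x\<close>, so the result
is a smooth function below \<open>u\<close>.\<close>
definition local_inf :: "real \<Rightarrow> (real^'d \<Rightarrow> real) \<Rightarrow> real^'d \<Rightarrow> real" where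
  "local_inf \<delta> u x = (INF z\<in>cball 0 \<delta>. u (x + z))"

context
  fixes u :: "real^'d \<Rightarrow> real" and K :: real
  assumes u: "continuous_on UNIV u" "\<And>y. \<bar>u y\<bar> \<le> K"
begin

lemma bdd_below_local_inf: "bdd_below ((\<lambda>z. u (x + z)) ` A)"
  using u(2) by (intro bdd_belowI2[where m = "- K"]) (simp add: abs_le_iff minus_le_iff)

lemma local_inf_le: "norm z \<le> \<delta> \<Longrightarrow> local_inf \<delta> u x \<le> u (x + z)"
  unfolding local_inf_def by (intro cINF_lower bdd_below_local_inf) simp

lemma local_inf_ge: "0 < \<delta> \<Longrightarrow> (\<And>z. norm z \<le> \<delta> \<Longrightarrow> a \<le> u (x + z)) \<Longrightarrow> a \<le> local_inf \<delta> u x"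
  unfolding local_inf_def by (intro cINF_greatest) auto

lemma abs_local_inf_le: "0 < \<delta> \<Longrightarrow> \<bar>local_inf \<delta> u x\<bar> \<le> K"
  using local_inf_le[of 0 \<delta> x] local_inf_ge[of \<delta> "- K" x] u(2)
  by (smt (verit) abs_le_iff add.right_neutral minus_le_iff norm_zero)

lemma borel_measurable_local_inf:
  assumes "0 < \<delta>" shows "local_inf \<delta> u \<in> borel_measurable borel"
  unfolding borel_measurable_iff_less
proof
  fix a
  have "{x. local_inf \<delta> u x < a} = (\<Union>z\<in>cball 0 \<delta>. {x. u (x + z) < a})"
    unfolding local_inf_def using assms
    by (auto simp: cINF_less_iff[OF _ bdd_below_local_inf])
  moreover have "open {x. u (x + z) < a}" for z
    by (intro open_Collect_less continuous_intros continuous_on_compose2[OF u(1)]) auto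
  ultimately have "open {x. local_inf \<delta> u x < a}" by auto
  then show "{x \<in> space borel. local_inf \<delta> u x < a} \<in> sets borel" by simp
qed

lemma mollify_local_inf_le:
  assumes "0 < \<delta>" shows "mollify \<delta> (local_inf \<delta> u) x \<le> u x"
proof -
  have "mollify \<delta> (local_inf \<delta> u) x \<le> mollify \<delta> (\<lambda>_. u x) x"
  proof (rule mollify_mono[OF assms borel_measurable_local_inf[OF assms] abs_local_inf_le[OF assms]])
    fix y assume "norm (y - x) < \<delta>"
    then show "local_inf \<delta> u y \<le> u x"
      using local_inf_le[of "x - y" \<delta> y] by (simp add: norm_minus_commute)
  qed (auto intro: u(2))
  then show ?thesis by (simp add: mollify_const[OF assms])
qed

lemma mollify_local_inf_ge:
  assumes "0 < \<delta>" "\<And>y. norm (y - x) \<le> 2 * \<delta> \<Longrightarrow> a \<le> u y"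
  shows "a \<le> mollify \<delta> (local_inf \<delta> u) x"
proof -
  have "mollify \<delta> (\<lambda>_. a) x \<le> mollify \<delta> (local_inf \<delta> u) x"
  proof (rule mollify_mono[OF assms(1) _ _ borel_measurable_local_inf abs_local_inf_le])
    fix y assume y: "norm (y - x) < \<delta>"
    show "a \<le> local_inf \<delta> u y"
    proof (rule local_inf_ge[OF assms(1)])
      fix z :: "real^'d" assume "norm z \<le> \<delta>"
      then have "norm (y + z - x) \<le> 2 * \<delta>"
        using y norm_triangle_ineq[of "y - x" z] by (simp add: algebra_simps)
      then show "a \<le> u (y + z)" by (rule assms(2))
    qed
  qed (use assms in auto)
  then show ?thesis by (simp add: mollify_const[OF assms(1)])
qed

lemma smooth_minorants:
  obtains w :: "nat \<Rightarrow> real^'d \<Rightarrow> real" where "\<And>n. \<exists>g H. C2b (w n) g H" "\<And>n y. w n y \<le> u y"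
    "\<And>n y. \<bar>w n y\<bar> \<le> K" "\<And>y. (\<lambda>n. w n y) \<longlonglongrightarrow> u y"
proof -
  define \<delta> where "\<delta> n = 1 / real (Suc n)" for n
  have \<delta>: "\<delta> n > 0" for n by (simp add: \<delta>_def)
  define w where "w n = mollify (\<delta> n) (local_inf (\<delta> n) u)" for n
  have 1: "\<exists>g H. C2b (w n) g H" for n
    unfolding w_def using C2b_mollify[OF \<delta> borel_measurable_local_inf[OF \<delta>] abs_local_inf_le[OF \<delta>]] by blast
  have 2: "w n y \<le> u y" for n y unfolding w_def by (rule mollify_local_inf_le[OF \<delta>])
  have "- K \<le> w n y" for n y
    unfolding w_def using u(2) by (intro mollify_local_inf_ge[OF \<delta>]) (simp add: abs_le_iff minus_le_iff)
  then have 3: "\<bar>w n y\<bar> \<le> K" for n y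
    using 2[of n y] u(2)[of y] by (smt (verit))
  have 4: "(\<lambda>n. w n y) \<longlonglongrightarrow> u y" for y
  proof (rule LIMSEQ_I)
    fix e :: real assume e: "e > 0"
    have "isCont u y" using u(1) by (simp add: continuous_on_eq_continuous_at)
    then obtain \<eta> where \<eta>: "\<eta> > 0" "\<And>z. dist z y < \<eta> \<Longrightarrow> dist (u z) (u y) < e / 2"
      using e unfolding continuous_at_eps_delta by (metis half_gt_zero)
    obtain N where N: "\<And>n. n \<ge> N \<Longrightarrow> \<delta> n < \<eta> / 2"
      using LIMSEQ_D[OF LIMSEQ_inverse_real_of_nat, of "\<eta> / 2"] \<eta>(1)
      by (auto simp: \<delta>_def inverse_eq_divide)
    have "norm (w n y - u y) < e" if "n \<ge> N" for n
    proof -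
      have "u y - e / 2 \<le> w n y" unfolding w_def
      proof (rule mollify_local_inf_ge[OF \<delta>])
        fix z assume "norm (z - y) \<le> 2 * \<delta> n"
        then have "dist z y < \<eta>" using N[OF that] by (simp add: dist_norm)
        from \<eta>(2)[OF this] show "u y - e / 2 \<le> u z" by (auto simp: dist_real_def abs_if split: if_splits)
      qed
      with 2[of n y] e show ?thesis by (simp add: abs_less_iff)
    qed
    then show "\<exists>N. \<forall>n\<ge>N. norm (w n y - u y) < e" by blast
  qed
  show thesis by (rule that[OF 1 2 3 4])
qed

end

text \<open>This function detects displacements of size at least \<open>d\<close>. Its average under the law of the resolvent
is of order \<open>\<alpha>\<close> by the resolvent equation, which replaces a moment estimate for the random walk.\<close>
lemma cutoff_exists:
  assumes d: "0 < (d::real)"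
  shows "\<exists>\<theta> g H. C2b \<theta> g H \<and> \<theta> (0::real^'d) = 0 \<and> (\<forall>z. 0 \<le> \<theta> z) \<and> (\<forall>z. d \<le> norm z \<longrightarrow> \<theta> z = 1)"
proof -
  define a where "a = 1 / (d\<^sup>2) ^ 3"
  have a: "a > 0" using d by (simp add: a_def)
  let ?t = "\<lambda>z::real^'d. 1 - a * bump d 3 z"
  have "C2b ?t (\<lambda>z. - a *\<^sub>R bump_grad d z) (\<lambda>z. - a *\<^sub>R bump_hess d z)"
    unfolding C2b_def
  proof (intro conjI allI)
    fix x :: "real^'d"
    show "(?t has_derivative (\<lambda>h. (- a *\<^sub>R bump_grad d x) \<bullet> h)) (at x)"
      by (auto intro!: derivative_eq_intros has_derivative_bump3)
    have "((\<lambda>z. - a *\<^sub>R bump_grad d z) has_derivative (\<lambda>h. - a *\<^sub>R (bump_hess d x *v h))) (at x)"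
      by (intro has_derivative_scaleR_right has_derivative_bump_grad)
    then show "((\<lambda>z. - a *\<^sub>R bump_grad d z) has_derivative (\<lambda>h. (- a *\<^sub>R bump_hess d x) *v h)) (at x)"
      by (simp only: scaleR_matrix_vector_assoc)
    have o: "\<And>y::real^'d. d \<le> norm y \<Longrightarrow> bump d 3 y = 0" using d by (simp add: bump_outside)
    obtain B1 where B1: "\<And>y::real^'d. norm (bump d 3 y) \<le> B1" using bounded_compact_support[OF continuous_on_bump o] by metis
    have "norm (?t y) \<le> 1 + a * B1" for y
    proof -
      have "a * \<bar>bump d 3 y\<bar> \<le> a * B1" using a B1[of y] by (intro mult_left_mono) auto
      moreover have "norm (a * bump d 3 y) = a * \<bar>bump d 3 y\<bar>" using a by (simp add: abs_mult)
      moreover have "norm (?t y) \<le> 1 + norm (a * bump d 3 y)" using norm_triangle_ineq4[of 1 "a * bump d 3 y"] by simp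
      ultimately show ?thesis by linarith
    qed
    then show "bounded (range ?t)" unfolding bounded_iff by blast
    obtain B2 where "\<And>y::real^'d. norm (bump_grad d y) \<le> B2" using bounded_compact_support[OF continuous_on_bump_grad bump_grad_outside[OF d]] by metis
    then show "bounded (range (\<lambda>z::real^'d. - a *\<^sub>R bump_grad d z))"
      using a by (auto simp: bounded_iff intro!: exI[of _ "a * B2"])
    obtain B3 where "\<And>y::real^'d. norm (bump_hess d y) \<le> B3" using bounded_compact_support[OF continuous_on_bump_hess bump_hess_outside[OF d]] by metis
    then show "bounded (range (\<lambda>z::real^'d. - a *\<^sub>R bump_hess d z))"
      using a by (auto simp: bounded_iff intro!: exI[of _ "a * B3"])
    have "uniformly_continuous_on UNIV (bump_hess d :: real^'d \<Rightarrow> _)"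
      unfolding uniformly_continuous_on_def
    proof (intro allI impI)
      fix e :: real assume "e > 0"
      then obtain \<delta> where "\<delta> > 0" "\<And>y y'::real^'d. dist y y' < \<delta> \<Longrightarrow> norm (bump_hess d y - bump_hess d y') \<le> e / 2"
        using uniform_compact_support[OF continuous_on_bump_hess bump_hess_outside[OF d], where e = "e / 2"] by (metis half_gt_zero)
      then show "\<exists>\<delta>>0. \<forall>x\<in>UNIV. \<forall>x'\<in>UNIV. dist x' x < \<delta> \<longrightarrow> dist (bump_hess d x') (bump_hess d x :: real^'d^'d) < e"
        using \<open>e > 0\<close> by (intro exI[of _ \<delta>]) (force simp: dist_norm)
    qed
    then show "uniformly_continuous_on UNIV (\<lambda>z::real^'d. - a *\<^sub>R bump_hess d z)"
      by (rule bounded_linear.uniformly_continuous_on[OF bounded_linear_scaleR_right])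
  qed
  moreover have "?t 0 = 0" using d by (simp add: a_def bump_def max_def)
  moreover have "0 \<le> ?t z" for z
    using bump_le[of d 3 z] d by (simp only: a_def) (simp add: field_simps)
  moreover have "?t z = 1" if "d \<le> norm z" for z using that d by (simp add: bump_outside)
  ultimately show ?thesis by blast
qed

lemma abs_inner_half_le: "\<bar>1/2 * (M \<bullet> A)\<bar> \<le> norm M * norm A"
  using Cauchy_Schwarz_ineq2[of M A] by (simp add: abs_mult)

text \<open>For a smooth \<open>w \<le> u\<close> the comparison principle gives \<open>avg \<kappa> w \<le> u + \<alpha> (c + e S)\<close>. Mollification
commutes with \<open>avg \<kappa>\<close>, and the resolvent equation for \<open>W = mollify r w\<close> expresses \<open>avg \<kappa> W - W\<close>
through second differences, hence through the Hessian of \<open>W\<close>. The outcome \<open>key\<close> is an inequality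
between \<open>w\<close> and \<open>u\<close> whose errors depend on \<open>w\<close> only through \<open>\<bar>w\<bar> \<le> K\<close>. Therefore \<open>w\<close> can tend to \<open>u\<close>
for a fixed \<open>\<alpha>\<close>; the left-over factor \<open>\<alpha>\<close> cancels, and then \<open>\<alpha>\<close> and \<open>e\<close> tend to zero.\<close>
theorem mollified_supersolution:
  fixes B :: "real^'d^'d" and u :: "real^'d \<Rightarrow> real"
  assumes r: "0 < r"
    and u: "continuous_on UNIV u" "\<And>y. \<bar>u y\<bar> \<le> K"
    and touch: "\<And>\<phi> H x. C2_with_hessian \<phi> H \<Longrightarrow> local_minimum (\<lambda>y. u y - \<phi> y) x \<Longrightarrow>
        1/2 * ((B ** transpose B) \<bullet> H x) \<le> c"
  shows "1/2 * ((B ** transpose B) \<bullet> mollify_hess r u x) \<le> c"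
proof -
  define M where "M = B ** transpose B"
  define S where "S = (\<Sum>i\<in>UNIV. (norm (column i B))\<^sup>2)"
  have S: "S \<ge> 0" by (simp add: S_def sum_nonneg)
  define b where "b = 1 + (\<Sum>i\<in>UNIV. norm (column i B))"
  have b: "b > 0" "\<And>i. norm (column i B) < b"
  proof -
    show "b > 0" unfolding b_def by (intro add_pos_nonneg sum_nonneg) auto
    have "norm (column i B) \<le> (\<Sum>i\<in>UNIV. norm (column i B))" for i
      by (rule member_le_sum) auto
    then show "norm (column i B) < b" for i by (simp add: b_def add_strict_increasing)
  qed
  obtain D where D: "D \<ge> 0" "\<And>w x. w \<in> borel_measurable borel \<Longrightarrow> (\<And>y. \<bar>w y\<bar> \<le> K) \<Longrightarrow> norm (mollify_hess r w x :: real^'d^'d) \<le> D"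
    using mollify_hess_bound[OF r] by metis
  let ?L = "\<lambda>A. 1/2 * (M \<bullet> A)"
  have main: "?L (mollify_hess r u x) \<le> c + (2 * S + norm M) * e" if e: "e > 0" for e
  proof -
    obtain d where d: "d > 0" "\<And>w y y'. w \<in> borel_measurable borel \<Longrightarrow> (\<And>y. \<bar>w y\<bar> \<le> K) \<Longrightarrow> dist y y' < d \<Longrightarrow>
        norm (mollify_hess r w y - mollify_hess r w y' :: real^'d^'d) \<le> e"
      using mollify_hess_modulus[OF r e] by metis
    obtain \<theta> g\<theta> H\<theta> where \<theta>: "C2b \<theta> g\<theta> H\<theta>" "\<theta> (0::real^'d) = 0" "\<And>z. 0 \<le> \<theta> z" "\<And>z. d \<le> norm z \<Longrightarrow> \<theta> z = 1"
      using cutoff_exists[OF d(1)] by metis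
    obtain D\<theta> where D\<theta>: "\<And>z. norm (H\<theta> z) \<le> D\<theta>" using \<theta>(1) by (auto simp: C2b_def bounded_iff)
    obtain d\<theta> where d\<theta>: "d\<theta> > 0" "\<And>y y'. dist y y' < d\<theta> \<Longrightarrow> norm (H\<theta> y - H\<theta> y') \<le> 1"
      using \<theta>(1) unfolding C2b_def uniformly_continuous_on_def dist_norm
      by (metis UNIV_I less_imp_le zero_less_one)
    define C\<theta> where "C\<theta> = norm M * D\<theta> + S"
    define C' where "C' = 2 * (norm M * D) * C\<theta>"
    have key: "\<alpha> * (?L (mollify_hess r w x) - c - (2 * S + norm M) * e - \<alpha> * C') \<le> mollify r u x - mollify r w x"
      if \<alpha>: "\<alpha> > 0" and w: "C2b w g H" "\<And>y. w y \<le> u y" "\<And>y. \<bar>w y\<bar> \<le> K" for \<alpha> w g H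
    proof -
      obtain d1 where d1: "d1 > 0" "\<And>y y'. dist y y' < d1 \<Longrightarrow> norm (H y - H y') \<le> e"
        using w(1) e unfolding C2b_def uniformly_continuous_on_def dist_norm
        by (metis UNIV_I less_imp_le)
      \<comment> \<open>one step length for three expansions: those of \<open>w\<close>, of its mollification, and of the cutoff \<open>\<theta>\<close>\<close>
      define h where "h = min d (min d\<theta> d1) / b"
      have h: "h > 0" using d(1) d\<theta>(1) d1(1) b(1) by (simp add: h_def)
      have hb: "h * norm (column i B) < min d (min d\<theta> d1)" for i
      proof -
        have "h * norm (column i B) < h * b" by (rule mult_strict_left_mono[OF b(2) h])
        then show ?thesis using b(1) by (simp add: h_def)
      qed
      obtain \<kappa> where res: "\<And>w x. bounded (range (w :: real^'d \<Rightarrow> real)) \<Longrightarrow> avg \<kappa> w x = w x + \<alpha> * second_diff B h (avg \<kappa> w) x"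
        using resolvent_exists[OF \<alpha> h, of B] by metis
      have bw: "bounded (range w)" using w(1) by (simp add: C2b_def)
      have mw: "w \<in> borel_measurable borel" by (rule borel_measurable_continuous_onI[OF C2b_continuous[OF w(1)]])
      have mu: "u \<in> borel_measurable borel" by (rule borel_measurable_continuous_onI[OF u(1)])
      have C2v: "C2b (avg \<kappa> w) (avg \<kappa> g) (avg \<kappa> H)" by (rule C2b_avg[OF w(1)])
      have mv: "avg \<kappa> w \<in> borel_measurable borel" by (rule borel_measurable_continuous_onI[OF C2b_continuous[OF C2v]])
      have bv: "\<bar>avg \<kappa> w y\<bar> \<le> K" for y using norm_avg_le[of w K \<kappa> y] w(3) by simp
      have 1: "avg \<kappa> w y \<le> u y + \<alpha> * (c + e * S)" for y
        unfolding S_def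
      proof (rule resolvent_comparison[where K = K and d = d1 and H = H and g = g and h = h])
        show "h * norm (column i B) < d1" for i using hb[of i] by simp
      qed (fact u w(1,2) d1(2) h \<alpha> touch res[OF bw])+
      have "mollify r (avg \<kappa> w) x \<le> mollify r (\<lambda>y. u y + \<alpha> * (c + e * S)) x"
        by (rule mollify_mono[OF r mv bv, where L = "K + \<bar>\<alpha> * (c + e * S)\<bar>"])
          (use mu 1 in \<open>auto intro!: order_trans[OF abs_triangle_ineq] add_mono u(2)\<close>)
      also have "\<dots> = mollify r u x + \<alpha> * (c + e * S)" by (rule mollify_add_const[OF r mu u(2)])
      finally have up: "mollify r (avg \<kappa> w) x \<le> mollify r u x + \<alpha> * (c + e * S)" .
      define W where "W = mollify r w"
      define HW where "HW = mollify_hess r w"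
      have C2W: "C2b W (mollify_grad r w) HW" unfolding W_def HW_def by (rule C2b_mollify[OF r mw w(3)])
      have bHW: "bounded (range HW)" using C2W by (simp add: C2b_def)
      have C2aW: "C2b (avg \<kappa> W) (avg \<kappa> (mollify_grad r w)) (avg \<kappa> HW)" by (rule C2b_avg[OF C2W])
      have modW: "norm (HW y - HW y') \<le> e" if "dist y y' < d" for y y'
        unfolding HW_def by (rule d(2)[OF mw w(3) that])
      have "\<bar>second_diff B h (avg \<kappa> W) x - ?L (avg \<kappa> HW x)\<bar> \<le> e * S"
        unfolding S_def M_def
        by (rule second_diff_approx[where g = "avg \<kappa> (mollify_grad r w)" and d = d])
          (use C2aW h hb avg_modulus[OF bHW modW] in \<open>auto simp: C2b_def\<close>)
      then have 2: "?L (avg \<kappa> HW x) - e * S \<le> second_diff B h (avg \<kappa> W) x" by linarith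
      have bt: "bounded (range \<theta>)" using \<theta>(1) by (simp add: C2b_def)
      have bHt: "bounded (range H\<theta>)" using \<theta>(1) by (simp add: C2b_def)
      have C2at: "C2b (avg \<kappa> \<theta>) (avg \<kappa> g\<theta>) (avg \<kappa> H\<theta>)" by (rule C2b_avg[OF \<theta>(1)])
      have "\<bar>second_diff B h (avg \<kappa> \<theta>) 0 - ?L (avg \<kappa> H\<theta> 0)\<bar> \<le> 1 * S"
        unfolding S_def M_def
        by (rule second_diff_approx[where g = "avg \<kappa> g\<theta>" and d = d\<theta>])
          (use C2at h hb avg_modulus[OF bHt d\<theta>(2)] in \<open>auto simp: C2b_def\<close>)
      moreover have "\<bar>?L (avg \<kappa> H\<theta> 0)\<bar> \<le> norm M * D\<theta>"
        by (rule order_trans[OF abs_inner_half_le mult_left_mono[OF norm_avg_le[OF D\<theta>]]]) simp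
      ultimately have "second_diff B h (avg \<kappa> \<theta>) 0 \<le> C\<theta>" unfolding C\<theta>_def by linarith
      then have 3: "avg \<kappa> \<theta> 0 \<le> \<alpha> * C\<theta>"
        using res[OF bt, of 0] \<theta>(2) \<alpha> by (simp add: mult_left_mono)
      have near: "?L (HW x) - ?L (HW (x + z)) \<le> norm M * e + 2 * (norm M * D) * \<theta> z" for z
      proof (cases "norm z < d")
        case True
        have "?L (HW x) - ?L (HW (x + z)) = ?L (HW x - HW (x + z))" by (simp add: inner_diff_right)
        also have "\<dots> \<le> norm M * norm (HW x - HW (x + z))" using abs_inner_half_le abs_le_D1 by blast
        also have "\<dots> \<le> norm M * e" using True by (intro mult_left_mono modW) (auto simp: dist_norm)
        finally show ?thesis using D(1) \<theta>(3)[of z] by (smt (verit) mult_nonneg_nonneg norm_ge_zero)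
      next
        case False
        have *: "\<bar>?L (HW y)\<bar> \<le> norm M * D" for y
          unfolding HW_def by (rule order_trans[OF abs_inner_half_le mult_left_mono[OF D(2)[OF mw w(3)]]]) simp
        have "0 \<le> norm M * e" using e by simp
        then show ?thesis using *[of x] *[of "x + z"] \<theta>(4)[of z] False by simp
      qed
      have "?L (HW x) - ?L (avg \<kappa> HW x) = measure_pmf.expectation \<kappa> (\<lambda>z. ?L (HW x) - ?L (HW (x + z)))"
        unfolding avg_def
        by (simp add: integrable_pmf_bounded[OF bHW] integral_inner_right integrable_inner_right)
      also have "\<dots> \<le> measure_pmf.expectation \<kappa> (\<lambda>z. norm M * e + 2 * (norm M * D) * \<theta> z)"
        by (intro integral_mono near Bochner_Integration.integrable_diff Bochner_Integration.integrable_add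
            integrable_mult_right integrable_inner_right integrable_pmf_bounded[OF bHW] integrable_pmf_bounded[OF bt, of _ "\<lambda>z. z"]) auto
      also have "\<dots> = norm M * e + 2 * (norm M * D) * avg \<kappa> \<theta> 0"
        using integrable_pmf_bounded[OF bt, of \<kappa> "\<lambda>z. z"] by (simp add: avg_def)
      also have "\<dots> \<le> norm M * e + 2 * (norm M * D) * (\<alpha> * C\<theta>)"
        using 3 D(1) by (intro add_left_mono mult_left_mono) auto
      finally have 4: "?L (HW x) - ?L (avg \<kappa> HW x) \<le> norm M * e + \<alpha> * C'" by (simp add: C'_def mult_ac)
      have "mollify r (avg \<kappa> w) x = avg \<kappa> W x" unfolding W_def by (rule mollify_avg[OF r mw w(3)])
      also have "\<dots> = W x + \<alpha> * second_diff B h (avg \<kappa> W) x"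
        using C2W by (intro res) (simp add: C2b_def)
      finally have "W x + \<alpha> * second_diff B h (avg \<kappa> W) x \<le> mollify r u x + \<alpha> * (c + e * S)"
        using up by simp
      moreover have "\<alpha> * (?L (HW x) - norm M * e - \<alpha> * C' - e * S) \<le> \<alpha> * second_diff B h (avg \<kappa> W) x"
        using 2 4 \<alpha> by (intro mult_left_mono) auto
      ultimately show ?thesis unfolding W_def[symmetric] HW_def[symmetric] by (simp add: algebra_simps)
    qed
    obtain w where w: "\<And>n. \<exists>g H. C2b (w n) g H" "\<And>n y. w n y \<le> u y"
      "\<And>n y. \<bar>w n y\<bar> \<le> K" "\<And>y. (\<lambda>n. w n y) \<longlonglongrightarrow> u y"
      using smooth_minorants[OF u] by metis
    have mw: "w n \<in> borel_measurable borel" for n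
      using w(1)[of n] C2b_continuous borel_measurable_continuous_onI by blast
    have lim: "?L (mollify_hess r u x) - c - (2 * S + norm M) * e - \<alpha> * C' \<le> 0" if \<alpha>: "\<alpha> > 0" for \<alpha>
    proof -
      have "\<alpha> * (?L (mollify_hess r u x) - c - (2 * S + norm M) * e - \<alpha> * C') \<le> mollify r u x - mollify r u x"
      proof (rule LIMSEQ_le)
        show "(\<lambda>n. \<alpha> * (?L (mollify_hess r (w n) x) - c - (2 * S + norm M) * e - \<alpha> * C')) \<longlonglongrightarrow>
           \<alpha> * (?L (mollify_hess r u x) - c - (2 * S + norm M) * e - \<alpha> * C')"
          by (intro tendsto_intros tendsto_mollify(2)[OF r mw w(3,4)])
        show "(\<lambda>n. mollify r u x - mollify r (w n) x) \<longlonglongrightarrow> mollify r u x - mollify r u x"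
          by (intro tendsto_intros tendsto_mollify(1)[OF r mw w(3,4)])
        show "\<exists>N. \<forall>n\<ge>N. \<alpha> * (?L (mollify_hess r (w n) x) - c - (2 * S + norm M) * e - \<alpha> * C')
            \<le> mollify r u x - mollify r (w n) x"
          using key[OF \<alpha> _ w(2,3)] w(1) by meson
      qed
      then show ?thesis using \<alpha> by (simp add: mult_le_0_iff)
    qed
    have "?L (mollify_hess r u x) \<le> c + (2 * S + norm M) * e + \<delta>" if \<delta>: "\<delta> > 0" for \<delta>
    proof -
      have "\<delta> / (\<bar>C'\<bar> + 1) * C' \<le> \<delta> / (\<bar>C'\<bar> + 1) * (\<bar>C'\<bar> + 1)" using \<delta> by (intro mult_left_mono) auto
      also have "\<dots> = \<delta>" by simp
      finally show ?thesis using lim[of "\<delta> / (\<bar>C'\<bar> + 1)"] \<delta> by simp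
    qed
    then show ?thesis by (rule field_le_epsilon)
  qed
  have "?L (mollify_hess r u x) \<le> c + \<delta>" if \<delta>: "\<delta> > 0" for \<delta>
  proof -
    define q where "q = 2 * S + norm M"
    have q: "q \<ge> 0" using S by (simp add: q_def)
    have "?L (mollify_hess r u x) \<le> c + q * (\<delta> / (q + 1))"
      unfolding q_def using \<delta> q by (intro main) (simp add: q_def)
    also have "q * (\<delta> / (q + 1)) \<le> \<delta>" using \<delta> q by (simp add: field_simps)
    finally show ?thesis by simp
  qed
  then have "?L (mollify_hess r u x) \<le> c" by (rule field_le_epsilon)
  then show ?thesis by (simp add: M_def)
qed

section \<open>The polar density of a matrix-valued measure\<close>

text \<open>Adding \<open>\<mu>\<close> turns \<open>\<nu>\<close> into a nonnegative measure that is absolutely continuous with respect to \<open>\<mu>\<close>.\<close>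
lemma signed_Radon_Nikodym:
  fixes \<nu> :: "'a set \<Rightarrow> real"
  assumes "finite_measure \<mu>"
    and sums: "\<And>A. range A \<subseteq> sets \<mu> \<Longrightarrow> disjoint_family A \<Longrightarrow> (\<lambda>n. \<nu> (A n)) sums \<nu> (\<Union>n. A n)"
    and le: "\<And>E. E \<in> sets \<mu> \<Longrightarrow> \<bar>\<nu> E\<bar> \<le> measure \<mu> E"
  shows "\<exists>g. integrable \<mu> g \<and> (\<forall>E\<in>sets \<mu>. \<nu> E = (\<integral>x\<in>E. g x \<partial>\<mu>))"
proof -
  interpret finite_measure \<mu> by fact
  define N where "N = measure_of (space \<mu>) (sets \<mu>) (\<lambda>E. ennreal (\<nu> E + measure \<mu> E))"
  have nn: "0 \<le> \<nu> E + measure \<mu> E" if "E \<in> sets \<mu>" for E using le[OF that] by linarith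
  have eN: "emeasure N E = ennreal (\<nu> E + measure \<mu> E)" if "E \<in> sets \<mu>" for E
    unfolding N_def
  proof (rule emeasure_measure_of_sigma[OF sets.sigma_algebra_axioms _ _ that])
    have "\<nu> {} = 0" using le[of "{}"] by simp
    then show "positive (sets \<mu>) (\<lambda>E. ennreal (\<nu> E + measure \<mu> E))" by (simp add: positive_def)
    show "countably_additive (sets \<mu>) (\<lambda>E. ennreal (\<nu> E + measure \<mu> E))"
    proof (rule countably_additiveI)
      fix A :: "nat \<Rightarrow> 'a set" assume A: "range A \<subseteq> sets \<mu>" "disjoint_family A" "(\<Union>i. A i) \<in> sets \<mu>"
      have "(\<lambda>n. \<nu> (A n) + measure \<mu> (A n)) sums (\<nu> (\<Union>i. A i) + measure \<mu> (\<Union>i. A i))"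
        by (intro sums_add sums A finite_measure_UNION)
      then show "(\<Sum>i. ennreal (\<nu> (A i) + measure \<mu> (A i))) = ennreal (\<nu> (\<Union>i. A i) + measure \<mu> (\<Union>i. A i))"
        using A nn by (intro suminf_ennreal_eq) auto
    qed
  qed
  have sN: "sets N = sets \<mu>" by (simp add: N_def)
  have "absolutely_continuous \<mu> N"
    unfolding absolutely_continuous_def
  proof
    fix E assume "E \<in> null_sets \<mu>"
    then have E: "E \<in> sets \<mu>" "measure \<mu> E = 0" by (auto simp: null_sets_def measure_def)
    then show "E \<in> null_sets N" using le[OF E(1)] by (simp add: null_sets_def sN eN)
  qed
  from Radon_Nikodym[OF this sN] obtain f where f: "f \<in> borel_measurable \<mu>" "density \<mu> f = N" by auto
  have Nint: "(\<integral>\<^sup>+x\<in>E. f x \<partial>\<mu>) = ennreal (\<nu> E + measure \<mu> E)" if "E \<in> sets \<mu>" for E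
    using eN[OF that] emeasure_density[OF f(1) that] f(2) by simp
  have "(\<integral>\<^sup>+x. f x \<partial>\<mu>) < \<infinity>"
    using Nint[of "space \<mu>"] by (simp add: nn_integral_set_ennreal[symmetric] cong: nn_integral_cong_simp)
  then have fin: "AE x in \<mu>. f x \<noteq> \<infinity>"
    by (intro nn_integral_PInf_AE f(1)) simp
  define g where "g x = enn2real (f x)" for x
  have gm: "g \<in> borel_measurable \<mu>" unfolding g_def using f(1) by measurable
  have gint: "(\<integral>\<^sup>+x. ennreal (indicator E x * g x) \<partial>\<mu>) = ennreal (\<nu> E + measure \<mu> E)" if "E \<in> sets \<mu>" for E
  proof -
    have "(\<integral>\<^sup>+x. ennreal (indicator E x * g x) \<partial>\<mu>) = (\<integral>\<^sup>+x\<in>E. f x \<partial>\<mu>)"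
      using fin by (intro nn_integral_cong_AE) (auto simp: g_def indicator_def less_top)
    then show ?thesis using Nint[OF that] by simp
  qed
  have hb: "has_bochner_integral \<mu> (\<lambda>x. indicator E x * g x) (\<nu> E + measure \<mu> E)" if "E \<in> sets \<mu>" for E
  proof (rule has_bochner_integral_nn_integral)
    show "(\<lambda>x. indicator E x * g x) \<in> borel_measurable \<mu>" using that gm by measurable
    show "AE x in \<mu>. 0 \<le> indicator E x * g x" by (simp add: g_def)
  qed (use gint nn that in auto)
  have ig: "integrable \<mu> g"
  proof -
    have "integrable \<mu> (\<lambda>x. indicator (space \<mu>) x * g x)" using hb[of "space \<mu>"] by (auto intro: integrable.intros)
    then show ?thesis by (rule Bochner_Integration.integrable_cong[THEN iffD1, rotated -1]) auto
  qed
  show ?thesis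
  proof (intro exI[of _ "\<lambda>x. g x - 1"] conjI ballI)
    show "integrable \<mu> (\<lambda>x. g x - 1)" using ig by simp
    fix E assume E: "E \<in> sets \<mu>"
    have "(\<integral>x\<in>E. (g x - 1) \<partial>\<mu>) = (\<integral>x. indicator E x * g x - indicator E x \<partial>\<mu>)"
      unfolding set_lebesgue_integral_def by (intro Bochner_Integration.integral_cong) (auto simp: algebra_simps)
    also have "\<dots> = (\<integral>x. indicator E x * g x \<partial>\<mu>) - (\<integral>x. indicator E x \<partial>\<mu>)"
      using E hb[OF E] by (intro Bochner_Integration.integral_diff) (auto intro: integrable.intros simp: emeasure_eq_measure)
    also have "\<dots> = \<nu> E" using hb[OF E] E by (simp add: has_bochner_integral_integral_eq)
    finally show "\<nu> E = (\<integral>x\<in>E. (g x - 1) \<partial>\<mu>)" by simp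
  qed
qed

text \<open>One inequality is the triangle inequality on each part of a partition. For the other, approximate \<open>\<sigma>\<close>
by simple functions and partition \<open>E\<close> into the level sets of such a function: on each of them the
norm of the integral equals the integral of the norm, up to the approximation error.\<close>
lemma total_variation_density:
  fixes \<sigma> :: "'a \<Rightarrow> real^'d^'d"
  assumes s: "sets \<mu> = sets M" and \<sigma>: "integrable \<mu> \<sigma>"
    and \<Lambda>: "\<And>E. E \<in> sets M \<Longrightarrow> \<Lambda> E = (\<integral>x\<in>E. \<sigma> x \<partial>\<mu>)"
  shows "total_var M \<Lambda> = density \<mu> (\<lambda>x. ennreal (norm (\<sigma> x)))"
proof -
  define N where "N = density \<mu> (\<lambda>x. ennreal (norm (\<sigma> x)))"
  have sp: "space \<mu> = space M" using s by (rule sets_eq_imp_space_eq)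
  have sN: "sets N = sets M" by (simp add: N_def s)
  have \<sigma>m: "\<sigma> \<in> borel_measurable \<mu>" using \<sigma> by simp
  have eN: "emeasure N E = (\<integral>\<^sup>+x\<in>E. ennreal (norm (\<sigma> x)) \<partial>\<mu>)" if "E \<in> sets M" for E
    using that \<sigma>m unfolding N_def by (intro emeasure_density) (auto simp: s)
  have eq: "(SUP A\<in>{A :: nat \<Rightarrow> 'a set. range A \<subseteq> sets M \<and> disjoint_family A \<and> (\<Union>n. A n) = E}.
        (\<Sum>n. ennreal (norm (\<Lambda> (A n))))) = emeasure N E" (is "(SUP A\<in>?P. ?v A) = _") if E: "E \<in> sets M" for E
  proof (rule antisym)
    show "(SUP A\<in>?P. ?v A) \<le> emeasure N E"
    proof (rule SUP_least)
      fix A assume A: "A \<in> ?P"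
      have "?v A \<le> (\<Sum>n. emeasure N (A n))"
      proof (rule suminf_le)
        fix n
        have An: "A n \<in> sets M" using A by auto
        have "ennreal (norm (\<Lambda> (A n))) \<le> (\<integral>\<^sup>+x. ennreal (norm (indicator (A n) x *\<^sub>R \<sigma> x)) \<partial>\<mu>)"
          unfolding \<Lambda>[OF An] set_lebesgue_integral_def
          using An \<sigma> s by (intro integral_norm_bound_ennreal integrable_mult_indicator) auto
        also have "\<dots> = emeasure N (A n)"
          unfolding eN[OF An] by (intro nn_integral_cong) (auto simp: indicator_def)
        finally show "ennreal (norm (\<Lambda> (A n))) \<le> emeasure N (A n)" .
      qed auto
      also have "\<dots> = emeasure N E" using A by (intro suminf_emeasure[THEN trans]) (auto simp: sN)
      finally show "?v A \<le> emeasure N E" .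
    qed
  next
    obtain F where F: "\<And>i. simple_function \<mu> (F i)" "\<And>x. x \<in> space \<mu> \<Longrightarrow> (\<lambda>i. F i x) \<longlonglongrightarrow> \<sigma> x"
      "\<And>i x. x \<in> space \<mu> \<Longrightarrow> dist (F i x) 0 \<le> 2 * dist (\<sigma> x) 0"
      using borel_measurable_implies_sequence_metric[OF \<sigma>m, of 0] by metis
    have Fm: "F i \<in> borel_measurable \<mu>" for i using F(1) by (rule borel_measurable_simple_function)
    have Fi: "integrable \<mu> (F i)" for i
      by (rule Bochner_Integration.integrable_bound[OF integrable_mult_right[OF integrable_norm[OF \<sigma>], of 2] Fm])
        (use F(3) in \<open>auto intro!: AE_I2\<close>)
    have step: "emeasure N E \<le> (SUP A\<in>?P. ?v A) + 2 * ennreal (\<integral>x. norm (\<sigma> x - F i x) \<partial>\<mu>)" for i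
    proof -
      \<comment> \<open>number the finitely many values of \<open>F i\<close>, so that its level sets form a sequence\<close>
      define k where "k = to_nat_on (F i ` space \<mu>)"
      have inj: "inj_on k (F i ` space \<mu>)"
        unfolding k_def using simple_functionD(1)[OF F(1)] by (intro inj_on_to_nat_on uncountable_infinite countable_finite)
      define A where "A n = E \<inter> ((\<lambda>x. k (F i x)) -` {n} \<inter> space \<mu>)" for n
      have Am: "A n \<in> sets M" for n
      proof -
        have "F i -` (k -` {n}) \<inter> space \<mu> \<in> sets \<mu>" by (rule simple_functionD(2)[OF F(1)])
        then show ?thesis unfolding A_def using E s by (auto simp: vimage_comp comp_def)
      qed
      have AP: "A \<in> ?P"
        using Am sets.sets_into_space[OF E] sp by (auto simp: disjoint_family_on_def A_def)
      have bound: "emeasure N (A n) \<le> ennreal (norm (\<Lambda> (A n))) + 2 * ennreal (\<integral>x. norm (indicator (A n) x *\<^sub>R (\<sigma> x - F i x)) \<partial>\<mu>)" for n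
      proof -
        let ?I = "\<lambda>x. indicator (A n) x :: real"
        have An: "A n \<in> sets \<mu>" using Am s by simp
        have i1: "integrable \<mu> (\<lambda>x. ?I x *\<^sub>R \<sigma> x)" by (rule integrable_mult_indicator[OF An \<sigma>])
        have i2: "integrable \<mu> (\<lambda>x. ?I x *\<^sub>R F i x)" by (rule integrable_mult_indicator[OF An Fi])
        have i3: "integrable \<mu> (\<lambda>x. ?I x *\<^sub>R (\<sigma> x - F i x))"
          by (rule integrable_mult_indicator[OF An Bochner_Integration.integrable_diff[OF \<sigma> Fi]])
        have const: "\<exists>c. \<forall>x\<in>A n. F i x = c"
        proof (cases "A n = {}")
          case False
          then obtain y where y: "y \<in> A n" by blast
          have "F i x = F i y" if "x \<in> A n" for x
            using that y inj by (auto simp: A_def inj_on_def)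
          then show ?thesis by blast
        qed simp
        then obtain c where c: "\<And>x. x \<in> A n \<Longrightarrow> F i x = c" by blast
        have "(\<lambda>x. ?I x *\<^sub>R F i x) = (\<lambda>x. ?I x *\<^sub>R c)" using c by (auto simp: indicator_def fun_eq_iff)
        moreover have "(\<lambda>x. norm (?I x *\<^sub>R F i x)) = (\<lambda>x. ?I x *\<^sub>R norm c)" using c by (auto simp: indicator_def fun_eq_iff)
        moreover have "integrable \<mu> (\<lambda>x. ?I x *\<^sub>R c)" using i2 calculation(1) by simp
        ultimately have eqn: "(\<integral>x. norm (?I x *\<^sub>R F i x) \<partial>\<mu>) = norm (\<integral>x. ?I x *\<^sub>R F i x \<partial>\<mu>)"
        proof (cases "c = 0")
          case False
          assume a: "(\<lambda>x. ?I x *\<^sub>R F i x) = (\<lambda>x. ?I x *\<^sub>R c)" "(\<lambda>x. norm (?I x *\<^sub>R F i x)) = (\<lambda>x. ?I x *\<^sub>R norm c)"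
            "integrable \<mu> (\<lambda>x. ?I x *\<^sub>R c)"
          have "integrable \<mu> ?I" using integrable_norm[OF a(3)] False by (simp add: integrable_mult_left_iff)
          then show ?thesis unfolding a(1,2) by simp
        qed simp
        have "(\<integral>x. norm (?I x *\<^sub>R \<sigma> x) \<partial>\<mu>) \<le> (\<integral>x. norm (?I x *\<^sub>R F i x) + norm (?I x *\<^sub>R (\<sigma> x - F i x)) \<partial>\<mu>)"
          by (intro integral_mono integrable_norm i1 Bochner_Integration.integrable_add i2 i3)
            (use norm_triangle_sub in \<open>auto simp: indicator_def norm_minus_commute\<close>)
        also have "\<dots> = norm (\<integral>x. ?I x *\<^sub>R F i x \<partial>\<mu>) + (\<integral>x. norm (?I x *\<^sub>R (\<sigma> x - F i x)) \<partial>\<mu>)"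
          using eqn by (subst Bochner_Integration.integral_add) (auto intro: integrable_norm i2 i3 simp del: norm_scaleR)
        also have "norm (\<integral>x. ?I x *\<^sub>R F i x \<partial>\<mu>) \<le> norm (\<Lambda> (A n)) + (\<integral>x. norm (?I x *\<^sub>R (\<sigma> x - F i x)) \<partial>\<mu>)"
        proof -
          have "(\<integral>x. ?I x *\<^sub>R F i x \<partial>\<mu>) = \<Lambda> (A n) - (\<integral>x. ?I x *\<^sub>R (\<sigma> x - F i x) \<partial>\<mu>)"
            unfolding \<Lambda>[OF Am] set_lebesgue_integral_def
            by (subst Bochner_Integration.integral_diff[OF i1 i3, symmetric]) (simp add: scaleR_diff_right)
          then show ?thesis
            using norm_triangle_ineq4[of "\<Lambda> (A n)" "\<integral>x. ?I x *\<^sub>R (\<sigma> x - F i x) \<partial>\<mu>"]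
              integral_norm_bound[of \<mu> "\<lambda>x. ?I x *\<^sub>R (\<sigma> x - F i x)"] by simp
        qed
        finally have le: "(\<integral>x. norm (?I x *\<^sub>R \<sigma> x) \<partial>\<mu>) \<le> norm (\<Lambda> (A n)) + 2 * (\<integral>x. norm (?I x *\<^sub>R (\<sigma> x - F i x)) \<partial>\<mu>)" by simp
        have "emeasure N (A n) = (\<integral>\<^sup>+x. ennreal (norm (?I x *\<^sub>R \<sigma> x)) \<partial>\<mu>)"
          unfolding eN[OF Am] by (intro nn_integral_cong) (auto simp: indicator_def)
        also have "\<dots> = ennreal (\<integral>x. norm (?I x *\<^sub>R \<sigma> x) \<partial>\<mu>)"
          by (rule nn_integral_eq_integral[OF integrable_norm[OF i1]]) simp
        also have "\<dots> \<le> ennreal (norm (\<Lambda> (A n)) + 2 * (\<integral>x. norm (?I x *\<^sub>R (\<sigma> x - F i x)) \<partial>\<mu>))"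
          by (rule ennreal_leI[OF le])
        also have "\<dots> = ennreal (norm (\<Lambda> (A n))) + 2 * ennreal (\<integral>x. norm (?I x *\<^sub>R (\<sigma> x - F i x)) \<partial>\<mu>)"
          by (simp add: ennreal_plus ennreal_mult del: norm_scaleR)
        finally show ?thesis .
      qed
      define Q where "Q = density \<mu> (\<lambda>x. ennreal (norm (\<sigma> x - F i x)))"
      have di: "integrable \<mu> (\<lambda>x. \<sigma> x - F i x)" by (rule Bochner_Integration.integrable_diff[OF \<sigma> Fi])
      have eQ: "emeasure Q X = ennreal (\<integral>x. norm (indicator X x *\<^sub>R (\<sigma> x - F i x)) \<partial>\<mu>)" if X: "X \<in> sets M" for X
      proof -
        have "emeasure Q X = (\<integral>\<^sup>+x. ennreal (norm (\<sigma> x - F i x)) * indicator X x \<partial>\<mu>)"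
          unfolding Q_def using X s \<sigma>m Fm by (intro emeasure_density) auto
        also have "\<dots> = (\<integral>\<^sup>+x. ennreal (norm (indicator X x *\<^sub>R (\<sigma> x - F i x))) \<partial>\<mu>)"
          by (intro nn_integral_cong) (auto simp: indicator_def)
        also have "\<dots> = ennreal (\<integral>x. norm (indicator X x *\<^sub>R (\<sigma> x - F i x)) \<partial>\<mu>)"
          using X s by (intro nn_integral_eq_integral integrable_norm integrable_mult_indicator[OF _ di]) auto
        finally show ?thesis .
      qed
      have sQ: "sets Q = sets M" by (simp add: Q_def s)
      have "emeasure N E = (\<Sum>n. emeasure N (A n))"
        using AP by (intro suminf_emeasure[THEN trans, symmetric]) (auto simp: sN)
      also have "\<dots> \<le> (\<Sum>n. ennreal (norm (\<Lambda> (A n))) + 2 * emeasure Q (A n))"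
        using bound by (intro suminf_le) (auto simp: eQ[OF Am])
      also have "\<dots> = ?v A + 2 * (\<Sum>n. emeasure Q (A n))"
        by (subst suminf_add[symmetric]) auto
      also have "(\<Sum>n. emeasure Q (A n)) = emeasure Q E"
        using AP by (intro suminf_emeasure[THEN trans]) (auto simp: sQ)
      finally have le1: "emeasure N E \<le> ?v A + 2 * emeasure Q E" .
      have "emeasure Q E \<le> emeasure Q (space M)"
        using sets.sets_into_space[OF E] by (intro emeasure_mono) (auto simp: sQ)
      also have "emeasure Q (space M) = ennreal (\<integral>x. norm (\<sigma> x - F i x) \<partial>\<mu>)"
        unfolding eQ[OF sets.top]
        by (intro arg_cong[where f = ennreal] Bochner_Integration.integral_cong) (auto simp: sp)
      finally have le2: "emeasure Q E \<le> ennreal (\<integral>x. norm (\<sigma> x - F i x) \<partial>\<mu>)" .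
      have "?v A \<le> (SUP A\<in>?P. ?v A)" by (rule SUP_upper[OF AP])
      then show ?thesis by (intro order_trans[OF le1] add_mono mult_left_mono le2) auto
    qed
    have "(\<lambda>i. \<integral>x. norm (\<sigma> x - F i x) \<partial>\<mu>) \<longlonglongrightarrow> (\<integral>x. 0 \<partial>\<mu>)"
    proof (rule integral_dominated_convergence[where w = "\<lambda>x. 3 * norm (\<sigma> x)"])
      show "AE x in \<mu>. (\<lambda>i. norm (\<sigma> x - F i x)) \<longlonglongrightarrow> 0"
      proof (rule AE_I2)
        fix x assume "x \<in> space \<mu>"
        from tendsto_norm[OF tendsto_diff[OF tendsto_const F(2)[OF this], of "\<sigma> x"]]
        show "(\<lambda>i. norm (\<sigma> x - F i x)) \<longlonglongrightarrow> 0" by simp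
      qed
      show "AE x in \<mu>. norm (norm (\<sigma> x - F i x)) \<le> 3 * norm (\<sigma> x)" for i
      proof (rule AE_I2)
        fix x assume "x \<in> space \<mu>"
        from F(3)[OF this, of i] norm_triangle_ineq4[of "\<sigma> x" "F i x"]
        show "norm (norm (\<sigma> x - F i x)) \<le> 3 * norm (\<sigma> x)" by simp
      qed
    qed (use \<sigma> \<sigma>m Fm in auto)
    then have lim0: "(\<lambda>i. \<integral>x. norm (\<sigma> x - F i x) \<partial>\<mu>) \<longlonglongrightarrow> 0" by simp
    define S where "S = (SUP A\<in>?P. ?v A)"
    have "(\<lambda>i. S + 2 * ennreal (\<integral>x. norm (\<sigma> x - F i x) \<partial>\<mu>)) \<longlonglongrightarrow> S + 2 * ennreal 0"
      by (intro tendsto_add tendsto_const ennreal_tendsto_cmult tendsto_ennrealI lim0) auto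
    then have lim: "(\<lambda>i. S + 2 * ennreal (\<integral>x. norm (\<sigma> x - F i x) \<partial>\<mu>)) \<longlonglongrightarrow> S" by simp
    have "\<exists>K. \<forall>i\<ge>K. emeasure N E \<le> S + 2 * ennreal (\<integral>x. norm (\<sigma> x - F i x) \<partial>\<mu>)"
      unfolding S_def using step by blast
    from LIMSEQ_le_const[OF lim this]
    show "emeasure N E \<le> (SUP A\<in>?P. ?v A)" unfolding S_def .
  qed
  have "total_var M \<Lambda> = measure_of (space M) (sets M) (emeasure N)"
    unfolding total_var_def
    by (rule measure_of_eq) (auto simp: sets.space_closed sets.sigma_sets_eq eq)
  also have "\<dots> = N"
    using measure_of_of_measure[of N] sN sp by (simp add: N_def)
  finally show ?thesis by (simp add: N_def)
qed

text \<open>Evaluate the quadratic form at \<open>e\<^sub>i \<plusminus> e\<^sub>j\<close>.\<close>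
lemma psd_entry_le_trace:
  assumes A: "A \<in> psd_mats" shows "\<bar>A $ i $ j\<bar> \<le> trace A" and "0 \<le> trace A"
proof -
  have sym: "A $ k $ l = A $ l $ k" for k l
    using A by (simp add: psd_mats_def sym_mats_def transpose_def vec_eq_iff)
  have q: "0 \<le> x \<bullet> (A *v x)" for x using A by (simp add: psd_mats_def)
  have form: "axis k 1 \<bullet> (A *v axis l 1) = A $ k $ l" for k l
    by (simp add: inner_axis' matrix_vector_mult_basis column_def)
  have diag: "0 \<le> A $ k $ k" for k using q[of "axis k 1"] by (simp add: form)
  then show t0: "0 \<le> trace A" by (simp add: trace_def sum_nonneg)
  have "0 \<le> A $ i $ i + A $ j $ j + 2 * A $ i $ j" "0 \<le> A $ i $ i + A $ j $ j - 2 * A $ i $ j"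
    using q[of "axis i 1 + axis j 1"] q[of "axis i 1 - axis j 1"] sym[of i j]
    by (simp_all add: matrix_vector_right_distrib matrix_vector_mult_diff_distrib inner_add_left inner_add_right
        inner_diff_left inner_diff_right form)
  moreover have "A $ k $ k \<le> trace A" for k
    unfolding trace_def by (rule member_le_sum) (auto intro: diag)
  ultimately show "\<bar>A $ i $ j\<bar> \<le> trace A"
    using \<open>\<And>k. A $ k $ k \<le> trace A\<close>[of i] \<open>\<And>k. A $ k $ k \<le> trace A\<close>[of j] by linarith
qed

lemma matrix_eq_sum_entries: "A = (\<Sum>i\<in>UNIV. \<Sum>j\<in>UNIV. A $ i $ j *\<^sub>R axis i (axis j 1))" for A :: "real^'d^'d"
proof -
  have "A $ x $ y * axis x (axis y (1::real)) $ i $ j = (if y = j then (if x = i then A $ x $ y else 0) else 0)" for x y i j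
    by (simp add: axis_def)
  then show ?thesis by (simp add: vec_eq_iff)
qed

text \<open>The trace of a positive semidefinite matrix dominates its entries, so all entries of \<open>\<Lambda>\<close> have
densities with respect to the finite measure \<open>trace \<Lambda>\<close>.\<close>
lemma mat_measure_density:
  fixes \<Lambda> :: "'a set \<Rightarrow> real^'d^'d"
  assumes "\<Lambda> \<in> mat_measures M"
  shows "\<exists>\<mu> \<sigma>. finite_measure \<mu> \<and> sets \<mu> = sets M \<and> integrable \<mu> \<sigma> \<and> (\<forall>E\<in>sets M. \<Lambda> E = (\<integral>x\<in>E. \<sigma> x \<partial>\<mu>))"
proof -
  have psd: "\<And>E. E \<in> sets M \<Longrightarrow> \<Lambda> E \<in> psd_mats"
    and sums: "\<And>A :: nat \<Rightarrow> 'a set. range A \<subseteq> sets M \<Longrightarrow> disjoint_family A \<Longrightarrow> (\<lambda>n. \<Lambda> (A n)) sums \<Lambda> (\<Union>n. A n)"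
    using assms by (auto simp: mat_measures_def)
  have bl: "bounded_linear (\<lambda>A :: real^'d^'d. A $ i $ j)" for i j
    by (intro bounded_linear_compose[OF bounded_linear_vec_nth bounded_linear_vec_nth])
  have sums_ij: "(\<lambda>n. \<Lambda> (A n) $ i $ j) sums (\<Lambda> (\<Union>n. A n) $ i $ j)"
    if "range A \<subseteq> sets M" "disjoint_family A" for A :: "nat \<Rightarrow> 'a set" and i j
    by (rule bounded_linear.sums[OF bl sums[OF that]])
  have sums_tr: "(\<lambda>n. trace (\<Lambda> (A n))) sums trace (\<Lambda> (\<Union>n. A n))"
    if "range A \<subseteq> sets M" "disjoint_family A" for A :: "nat \<Rightarrow> 'a set"
    unfolding trace_def by (intro sums_sum sums_ij that)
  have empty: "\<Lambda> {} = 0"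
  proof -
    have "(\<lambda>n::nat. \<Lambda> {}) sums \<Lambda> {}" using sums[of "\<lambda>_. {}"] by (simp add: disjoint_family_on_def)
    then have "(\<lambda>n::nat. \<Lambda> {}) \<longlonglongrightarrow> 0" by (auto intro: summable_LIMSEQ_zero sums_summable)
    then show ?thesis by (simp add: LIMSEQ_const_iff)
  qed
  define \<mu> where "\<mu> = measure_of (space M) (sets M) (\<lambda>E. ennreal (trace (\<Lambda> E)))"
  have s\<mu>: "sets \<mu> = sets M" and sp: "space \<mu> = space M" by (auto simp: \<mu>_def)
  have e\<mu>: "emeasure \<mu> E = ennreal (trace (\<Lambda> E))" if "E \<in> sets M" for E
    unfolding \<mu>_def
  proof (rule emeasure_measure_of_sigma[OF sets.sigma_algebra_axioms _ _ that])
    show "positive (sets M) (\<lambda>E. ennreal (trace (\<Lambda> E)))" by (simp add: positive_def empty trace_def)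
    show "countably_additive (sets M) (\<lambda>E. ennreal (trace (\<Lambda> E)))"
      by (rule countably_additiveI)
        (auto intro!: suminf_ennreal_eq sums_tr psd_entry_le_trace(2) psd)
  qed
  interpret \<mu>: finite_measure \<mu>
    by (rule finite_measureI) (simp add: sp e\<mu>)
  have m\<mu>: "measure \<mu> E = trace (\<Lambda> E)" if "E \<in> sets M" for E
    using e\<mu>[OF that] psd_entry_le_trace(2)[OF psd[OF that]] by (simp add: measure_def)
  have "\<exists>g. integrable \<mu> g \<and> (\<forall>E\<in>sets \<mu>. \<Lambda> E $ i $ j = (\<integral>x\<in>E. g x \<partial>\<mu>))" for i j
    by (rule signed_Radon_Nikodym[OF \<mu>.finite_measure_axioms])
      (auto simp: s\<mu> m\<mu> intro!: sums_ij psd_entry_le_trace psd)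
  then obtain g where g: "\<And>i j. integrable \<mu> (g i j)" "\<And>i j E. E \<in> sets M \<Longrightarrow> \<Lambda> E $ i $ j = (\<integral>x\<in>E. g i j x \<partial>\<mu>)"
    unfolding s\<mu> by metis
  define \<sigma> where "\<sigma> x = (\<Sum>i\<in>UNIV. \<Sum>j\<in>UNIV. g i j x *\<^sub>R axis i (axis j (1::real)) :: real^'d^'d)" for x
  have "integrable \<mu> \<sigma>" unfolding \<sigma>_def[abs_def]
    by (intro Bochner_Integration.integrable_sum integrable_scaleR_left g)
  moreover have "\<Lambda> E = (\<integral>x\<in>E. \<sigma> x \<partial>\<mu>)" if E: "E \<in> sets M" for E
  proof -
    have ie: "integrable \<mu> (\<lambda>x. indicator E x * g i j x)" for i j
      using integrable_mult_indicator[OF _ g(1), of E i j] E s\<mu> by simp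
    have "(\<integral>x\<in>E. \<sigma> x \<partial>\<mu>) = (\<integral>x. (\<Sum>i\<in>UNIV. \<Sum>j\<in>UNIV. (indicator E x * g i j x) *\<^sub>R axis i (axis j 1)) \<partial>\<mu>)"
      unfolding set_lebesgue_integral_def \<sigma>_def by (simp add: scaleR_sum_right)
    also have "\<dots> = (\<Sum>i\<in>UNIV. \<Sum>j\<in>UNIV. (\<integral>x. indicator E x * g i j x \<partial>\<mu>) *\<^sub>R axis i (axis j 1))"
      using ie by (simp add: Bochner_Integration.integral_sum)
    also have "\<dots> = \<Lambda> E"
      by (subst matrix_eq_sum_entries[of "\<Lambda> E"]) (simp add: g(2)[OF E] set_lebesgue_integral_def)
    finally show ?thesis by simp
  qed
  ultimately show ?thesis using \<mu>.finite_measure_axioms s\<mu> by blast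
qed

lemma
  fixes \<Lambda> :: "'a set \<Rightarrow> real^'d^'d"
  assumes "\<Lambda> \<in> mat_measures M"
  shows finite_measure_total_var: "finite_measure (total_var M \<Lambda>)"
    and integrable_polar_density: "integrable (total_var M \<Lambda>) (polar_density M \<Lambda>)"
    and set_integral_polar_density: "E \<in> sets M \<Longrightarrow> \<Lambda> E = (\<integral>x\<in>E. polar_density M \<Lambda> x \<partial>total_var M \<Lambda>)"
proof -
  obtain \<mu> \<sigma> where \<mu>: "finite_measure \<mu>" "sets \<mu> = sets M" "integrable \<mu> \<sigma>" "\<And>E. E \<in> sets M \<Longrightarrow> \<Lambda> E = (\<integral>x\<in>E. \<sigma> x \<partial>\<mu>)"
    using mat_measure_density[OF assms] by metis
  have tv: "total_var M \<Lambda> = density \<mu> (\<lambda>x. ennreal (norm (\<sigma> x)))"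
    by (rule total_variation_density[OF \<mu>(2-4)])
  have \<sigma>m: "\<sigma> \<in> borel_measurable \<mu>" using \<mu>(3) by simp
  have sm: "(\<lambda>x. sgn (\<sigma> x)) \<in> borel_measurable \<mu>" using \<sigma>m unfolding sgn_div_norm by measurable
  have ns: "norm y *\<^sub>R sgn y = y" for y :: "real^'d^'d" by (cases "y = 0") (simp_all add: sgn_div_norm)
  show "finite_measure (total_var M \<Lambda>)"
  proof (rule finite_measureI)
    have "emeasure (total_var M \<Lambda>) (space (total_var M \<Lambda>)) = (\<integral>\<^sup>+x. ennreal (norm (\<sigma> x)) \<partial>\<mu>)"
      unfolding tv using \<sigma>m by (subst emeasure_density) (auto intro!: nn_integral_cong)
    then show "emeasure (total_var M \<Lambda>) (space (total_var M \<Lambda>)) \<noteq> \<infinity>"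
      using \<mu>(3) unfolding integrable_iff_bounded by auto
  qed
  have "integrable (total_var M \<Lambda>) (\<lambda>x. sgn (\<sigma> x))"
    unfolding tv using \<sigma>m sm \<mu>(3) by (subst integrable_density) (auto simp: ns)
  moreover have "\<Lambda> E = (\<integral>x\<in>E. sgn (\<sigma> x) \<partial>total_var M \<Lambda>)" if E: "E \<in> sets M" for E
  proof -
    have "(\<integral>x\<in>E. sgn (\<sigma> x) \<partial>total_var M \<Lambda>) = (\<integral>x. norm (\<sigma> x) *\<^sub>R (indicator E x *\<^sub>R sgn (\<sigma> x)) \<partial>\<mu>)"
      unfolding tv set_lebesgue_integral_def using \<sigma>m sm E \<mu>(2) by (intro integral_density) auto
    also have "\<dots> = \<Lambda> E"
      unfolding \<mu>(4)[OF E] set_lebesgue_integral_def by (simp only: scaleR_left_commute[of "norm _"] ns)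
    finally show ?thesis by simp
  qed
  ultimately have "\<exists>\<sigma>. integrable (total_var M \<Lambda>) \<sigma> \<and> (\<forall>E\<in>sets M. \<Lambda> E = (\<integral>x\<in>E. \<sigma> x \<partial>total_var M \<Lambda>))"
    by blast
  from someI_ex[OF this, folded polar_density_def]
  show "integrable (total_var M \<Lambda>) (polar_density M \<Lambda>)"
    and "E \<in> sets M \<Longrightarrow> \<Lambda> E = (\<integral>x\<in>E. polar_density M \<Lambda> x \<partial>total_var M \<Lambda>)"
    by blast+
qed

lemma sets_total_var: "sets (total_var M \<Lambda>) = sets M"
  by (simp add: total_var_def)

lemma AE_polar_density_symmetric:
  fixes \<Lambda> :: "'a set \<Rightarrow> real^'d^'d"
  assumes \<Lambda>: "\<Lambda> \<in> mat_measures M"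
  shows "AE x in total_var M \<Lambda>. polar_density M \<Lambda> x \<in> sym_mats"
proof -
  have bl: "bounded_linear (transpose :: real^'d^'d \<Rightarrow> real^'d^'d)"
    by (intro linear_conv_bounded_linear[THEN iffD1] linearI) (auto simp: transpose_def vec_eq_iff)
  note i = integrable_polar_density[OF \<Lambda>]
  interpret finite_measure "total_var M \<Lambda>" by (rule finite_measure_total_var[OF \<Lambda>])
  have "AE x in total_var M \<Lambda>. transpose (polar_density M \<Lambda> x) = polar_density M \<Lambda> x"
  proof (rule density_unique_banach)
    show "integrable (total_var M \<Lambda>) (\<lambda>x. transpose (polar_density M \<Lambda> x))"
      by (rule integrable_bounded_linear[OF bl i])
    fix E assume "E \<in> sets (total_var M \<Lambda>)"
    then have E: "E \<in> sets M" by (simp add: sets_total_var)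
    have "(\<integral>x\<in>E. transpose (polar_density M \<Lambda> x) \<partial>total_var M \<Lambda>) =
        (\<integral>x. transpose (indicator E x *\<^sub>R polar_density M \<Lambda> x) \<partial>total_var M \<Lambda>)"
      unfolding set_lebesgue_integral_def
      by (simp add: linear_cmul[OF bounded_linear.linear[OF bl]])
    also have "\<dots> = transpose (\<Lambda> E)"
      unfolding set_integral_polar_density[OF \<Lambda> E] set_lebesgue_integral_def
      by (intro integral_bounded_linear[OF bl] integrable_mult_indicator i) (simp add: sets_total_var E)
    also have "\<dots> = \<Lambda> E" using \<Lambda> E by (auto simp: mat_measures_def psd_mats_def sym_mats_def)
    finally show "(\<integral>x\<in>E. transpose (polar_density M \<Lambda> x) \<partial>total_var M \<Lambda>) = (\<integral>x\<in>E. polar_density M \<Lambda> x \<partial>total_var M \<Lambda>)"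
      by (simp add: set_integral_polar_density[OF \<Lambda> E])
  qed (rule i)
  then show ?thesis by (simp add: sym_mats_def)
qed

section \<open>A spreading profile\<close>

lemma continuous_on_integral_bounded:
  fixes F :: "'t::metric_space \<Rightarrow> 'a \<Rightarrow> 'b::{banach,second_countable_topology}"
  assumes "finite_measure M"
    and meas: "\<And>t. t \<in> S \<Longrightarrow> F t \<in> borel_measurable M"
    and cont: "AE y in M. continuous_on S (\<lambda>t. F t y)"
    and bnd: "\<And>t. t \<in> S \<Longrightarrow> AE y in M. norm (F t y) \<le> K"
  shows "continuous_on S (\<lambda>t. \<integral>y. F t y \<partial>M)"
proof -
  interpret finite_measure M by fact
  show ?thesis unfolding continuous_on_sequentially comp_def
  proof (intro allI ballI impI)
    fix s t assume t: "t \<in> S" and s: "(\<forall>n. s n \<in> S) \<and> s \<longlonglongrightarrow> t"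
    show "(\<lambda>n. \<integral>y. F (s n) y \<partial>M) \<longlonglongrightarrow> (\<integral>y. F t y \<partial>M)"
    proof (rule integral_dominated_convergence[where w = "\<lambda>_. K"])
      show "AE y in M. (\<lambda>n. F (s n) y) \<longlonglongrightarrow> F t y"
        using cont by eventually_elim (use s t in \<open>auto simp: continuous_on_sequentially comp_def\<close>)
    qed (use t s meas bnd in auto)
  qed
qed

text \<open>The integral of the translates of \<open>w\<close> is constant, so its derivative vanishes.\<close>
lemma integral_partial_zero:
  fixes w :: "real^'d \<Rightarrow> real"
  assumes cw: "continuous_on UNIV w" and w: "\<And>y. (w has_derivative w' y) (at y)" "\<And>y. r \<le> norm y \<Longrightarrow> w y = 0"
    and w': "\<And>y h. norm (w' y h) \<le> B * norm h" "\<And>y h. r \<le> norm y \<Longrightarrow> w' y h = 0"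
      "\<And>h. continuous_on UNIV (\<lambda>y. w' y h)"
  shows "(\<integral>y. w' y e \<partial>lborel) = 0"
proof -
  have "((\<lambda>x. \<integral>y. 1 *\<^sub>R w (y - x) \<partial>lborel) has_derivative (\<lambda>h. - (\<integral>y. 1 *\<^sub>R w' (y - 0) h \<partial>lborel))) (at 0)"
    by (rule has_derivative_kernel_integral[where K = 1]) (use assms in auto)
  moreover have "(\<lambda>x. \<integral>y. 1 *\<^sub>R w (y - x) \<partial>lborel) = (\<lambda>x. \<integral>y. w y \<partial>lborel)"
    using integral_lborel_shift[OF borel_measurable_continuous_onI[OF cw]] by simp
  ultimately have "((\<lambda>x::real^'d. \<integral>y. w y \<partial>lborel) has_derivative (\<lambda>h. - (\<integral>y. w' y h \<partial>lborel))) (at 0)" by simp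
  from has_derivative_unique[OF this has_derivative_const]
  show ?thesis by (metis neg_equal_0_iff_equal)
qed

text \<open>The divergence theorem for \<open>bump 1 2 * V\<close>, using that the gradient of \<open>bump 1 2\<close> is
\<open>- 4 bump 1 1 y\<close> times \<open>y\<close>.\<close>
lemma bump_integration_by_parts:
  fixes V :: "real^'d \<Rightarrow> real^'d"
  assumes V: "\<And>y. (V has_derivative (\<lambda>h. A y *v h)) (at y)" and A: "continuous_on UNIV A"
  shows "(\<integral>y. bump 1 2 y * trace (A y) \<partial>lborel) = (\<integral>y. 4 * bump 1 1 y * (y \<bullet> V y) \<partial>lborel)"
proof -
  have cV: "continuous_on UNIV V" using V by (intro continuous_at_imp_continuous_on) (auto intro: has_derivative_continuous)
  have o1: "bump 1 1 y = 0" if "1 \<le> norm y" for y :: "real^'d" using that by (simp add: bump_outside)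
  have o2: "bump 1 2 y = 0" if "1 \<le> norm y" for y :: "real^'d" using that by (simp add: bump_outside)
  have cb: "continuous_on UNIV (\<lambda>y. bump 1 2 y *\<^sub>R A y)" "continuous_on UNIV (\<lambda>y. (4 * bump 1 1 y) *\<^sub>R V y)"
    by (intro continuous_intros A cV)+
  obtain C1 where C1: "\<And>y. norm (bump 1 2 y *\<^sub>R A y) \<le> C1"
    using bounded_compact_support[OF cb(1), of 1] o2 by auto
  obtain C2 where C2: "\<And>y. norm ((4 * bump 1 1 y) *\<^sub>R V y) \<le> C2"
    using bounded_compact_support[OF cb(2), of 1] o1 by auto
  have part: "(\<integral>y. bump 1 2 y * A y $ i $ i - 4 * bump 1 1 y * (y $ i * V y $ i) \<partial>lborel) = 0" for i
  proof -
    define w' where "w' y h = bump 1 2 y * ((A y *v h) $ i) + (- 4 * bump 1 1 y * (y \<bullet> h)) * V y $ i" for y h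
    have "(\<integral>y. w' y (axis i 1) \<partial>lborel) = 0"
    proof (rule integral_partial_zero[where r = 1 and w = "\<lambda>y. bump 1 2 y * V y $ i" and B = "C1 + C2"])
      show "continuous_on UNIV (\<lambda>y. bump 1 2 y * V y $ i)" by (intro continuous_intros cV)
      show "((\<lambda>y. bump 1 2 y * V y $ i) has_derivative w' y) (at y)" for y
      proof -
        have "(bump 1 2 has_derivative (\<lambda>h. (- 4 * bump 1 1 y) * (y \<bullet> h))) (at y)"
          using has_derivative_bump[of 1 0 y] by (simp add: numeral_2_eq_2)
        moreover have "((\<lambda>y. V y $ i) has_derivative (\<lambda>h. (A y *v h) $ i)) (at y)"
          by (rule bounded_linear.has_derivative[OF bounded_linear_vec_nth V])
        ultimately show ?thesis unfolding w'_def by (rule has_derivative_mult)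
      qed
      show "norm (w' y h) \<le> (C1 + C2) * norm h" for y h
      proof (cases "norm y < 1")
        case True
        have "norm (bump 1 2 y * ((A y *v h) $ i)) \<le> norm (bump 1 2 y *\<^sub>R (A y *v h))"
          using component_le_norm_cart[of "bump 1 2 y *\<^sub>R (A y *v h)" i] by simp
        also have "\<dots> \<le> norm (bump 1 2 y *\<^sub>R A y) * norm h"
          using norm_matrix_vector_mult_le[of "bump 1 2 y *\<^sub>R A y" h] by (simp only: scaleR_matrix_vector_assoc)
        also have "\<dots> \<le> C1 * norm h" by (intro mult_right_mono C1) simp
        finally have a: "norm (bump 1 2 y * ((A y *v h) $ i)) \<le> C1 * norm h" .
        have "\<bar>y \<bullet> h\<bar> \<le> norm y * norm h" by (rule Cauchy_Schwarz_ineq2)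
        also have "\<dots> \<le> 1 * norm h" using True by (intro mult_right_mono) auto
        finally have yh: "\<bar>y \<bullet> h\<bar> \<le> norm h" by simp
        have v: "\<bar>4 * bump 1 1 y * V y $ i\<bar> \<le> C2"
          using component_le_norm_cart[of "(4 * bump 1 1 y) *\<^sub>R V y" i] C2[of y] by simp
        have "norm ((- 4 * bump 1 1 y * (y \<bullet> h)) * V y $ i) = \<bar>4 * bump 1 1 y * V y $ i\<bar> * \<bar>y \<bullet> h\<bar>"
          by (simp add: abs_mult mult_ac)
        also have "\<dots> \<le> C2 * norm h" by (intro mult_mono v yh) (use v in auto)
        finally show ?thesis using a norm_triangle_ineq[of "bump 1 2 y * ((A y *v h) $ i)" "(- 4 * bump 1 1 y * (y \<bullet> h)) * V y $ i"]
          unfolding w'_def distrib_right by linarith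
      next
        case False
        have "0 \<le> C1" "0 \<le> C2" using C1[of 0] C2[of 0] norm_ge_zero order_trans by blast+
        then show ?thesis using False by (simp add: w'_def o1[unfolded One_nat_def] o2)
      qed
      show "continuous_on UNIV (\<lambda>y. w' y h)" for h
        unfolding w'_def matrix_vector_mult_def by (simp, intro continuous_intros A cV)
    qed (use o1[unfolded One_nat_def] o2 in \<open>auto simp: w'_def\<close>)
    moreover have "w' y (axis i 1) = bump 1 2 y * A y $ i $ i - 4 * bump 1 1 y * (y $ i * V y $ i)" for y
      by (simp add: w'_def matrix_vector_mult_basis column_def inner_axis)
    ultimately show ?thesis by simp
  qed
  have i1: "integrable lborel (\<lambda>y. bump 1 2 y * A y $ i $ i)" for i
    by (rule integrable_compact_support[where r = 1]) (use o2 in \<open>auto intro!: continuous_intros A\<close>)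
  have i2: "integrable lborel (\<lambda>y. 4 * bump 1 1 y * (y $ i * V y $ i))" for i
    by (rule integrable_compact_support[where r = 1]) (use o1 in \<open>auto intro!: continuous_intros cV\<close>)
  have "(\<integral>y. bump 1 2 y * A y $ i $ i \<partial>lborel) = (\<integral>y. 4 * bump 1 1 y * (y $ i * V y $ i) \<partial>lborel)" for i
    using part[of i] i1 i2 by simp
  moreover have "(\<integral>y. bump 1 2 y * trace (A y) \<partial>lborel) = (\<Sum>i\<in>UNIV. \<integral>y. bump 1 2 y * A y $ i $ i \<partial>lborel)"
    unfolding trace_def sum_distrib_left by (rule Bochner_Integration.integral_sum) (rule i1)
  moreover have "(\<integral>y. 4 * bump 1 1 y * (y \<bullet> V y) \<partial>lborel) = (\<Sum>i\<in>UNIV. \<integral>y. 4 * bump 1 1 y * (y $ i * V y $ i) \<partial>lborel)"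
    unfolding inner_vec_def inner_real_def sum_distrib_left by (rule Bochner_Integration.integral_sum) (rule i2)
  ultimately show ?thesis by simp
qed

text \<open>This constant turns \<open>4 bump 1 1\<close> into a probability density. The flux is divided by the same
constant, in order not to disturb the relation between the two profiles.\<close>
definition profile_mass :: "'d::finite itself \<Rightarrow> real" where
  "profile_mass _ = (\<integral>z. 4 * bump 1 1 (z :: real^'d) \<partial>lborel)"

definition spread_law :: "(real^'d) measure" where
  "spread_law = density lborel (\<lambda>y. ennreal (4 * bump 1 1 y / profile_mass TYPE('d)))"

definition flux_law :: "(real^'d) measure" where
  "flux_law = density lborel (\<lambda>y. ennreal (bump 1 2 y / profile_mass TYPE('d)))"

lemma profile_mass_pos: "profile_mass TYPE('d::finite) > 0"
  using integral_bump_pos[of 1 1, where 'd = 'd] by (simp add: profile_mass_def)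

lemma bump_measurable [measurable]: "bump r k \<in> borel_measurable borel"
  by (rule borel_measurable_continuous_onI[OF continuous_on_bump])

lemma sets_spread_law [measurable_cong, simp]: "sets spread_law = sets borel"
  and sets_flux_law [measurable_cong, simp]: "sets flux_law = sets borel"
  and space_spread_law [simp]: "space spread_law = UNIV"
  and space_flux_law [simp]: "space flux_law = UNIV"
  by (simp_all add: spread_law_def flux_law_def)

lemma integral_spread_law:
  fixes F :: "real^'d \<Rightarrow> 'b::{banach,second_countable_topology}"
  assumes [measurable]: "F \<in> borel_measurable borel"
  shows "(\<integral>y. F y \<partial>spread_law) = (\<integral>y. (4 * bump 1 1 y / profile_mass TYPE('d)) *\<^sub>R F y \<partial>lborel)"
  unfolding spread_law_def using profile_mass_pos[where 'd = 'd]
  by (intro integral_density) (auto simp: bump_nonneg)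

lemma integral_flux_law:
  fixes F :: "real^'d \<Rightarrow> 'b::{banach,second_countable_topology}"
  assumes [measurable]: "F \<in> borel_measurable borel"
  shows "(\<integral>y. F y \<partial>flux_law) = (\<integral>y. (bump 1 2 y / profile_mass TYPE('d)) *\<^sub>R F y \<partial>lborel)"
  unfolding flux_law_def using profile_mass_pos[where 'd = 'd]
  by (intro integral_density) (auto simp: bump_nonneg)

lemma prob_space_spread_law: "prob_space (spread_law :: (real^'d) measure)"
proof
  have m: "profile_mass TYPE('d) > 0" by (rule profile_mass_pos)
  have "emeasure (spread_law :: (real^'d) measure) (space spread_law) = (\<integral>\<^sup>+y. ennreal (4 * bump 1 1 (y::real^'d) / profile_mass TYPE('d)) \<partial>lborel)"
    by (simp add: spread_law_def emeasure_density)
  also have "\<dots> = ennreal (\<integral>y. 4 * bump 1 1 (y::real^'d) / profile_mass TYPE('d) \<partial>lborel)"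
    using m integrable_bump[of 1 1, where 'a = 'd] by (intro nn_integral_eq_integral) (auto simp: bump_nonneg)
  also have "\<dots> = 1" using m by (simp add: profile_mass_def)
  finally show "emeasure (spread_law :: (real^'d) measure) (space spread_law) = 1" .
qed

lemma finite_measure_flux_law: "finite_measure (flux_law :: (real^'d) measure)"
  and flux_mass_pos: "measure (flux_law :: (real^'d) measure) UNIV > 0"
proof -
  have m: "profile_mass TYPE('d) > 0" by (rule profile_mass_pos)
  have "emeasure (flux_law :: (real^'d) measure) UNIV = (\<integral>\<^sup>+y. ennreal (bump 1 2 (y::real^'d) / profile_mass TYPE('d)) \<partial>lborel)"
    by (simp add: flux_law_def emeasure_density)
  also have "\<dots> = ennreal (\<integral>y. bump 1 2 (y::real^'d) / profile_mass TYPE('d) \<partial>lborel)"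
    using m integrable_bump[of 1 2, where 'a = 'd] by (intro nn_integral_eq_integral) (auto simp: bump_nonneg)
  finally have e: "emeasure (flux_law :: (real^'d) measure) UNIV = ennreal (\<integral>y. bump 1 2 (y::real^'d) / profile_mass TYPE('d) \<partial>lborel)" .
  show "finite_measure (flux_law :: (real^'d) measure)" by (rule finite_measureI) (simp add: e)
  show "measure (flux_law :: (real^'d) measure) UNIV > 0"
    using m integral_bump_pos[of 1 2, where 'd = 'd] by (simp add: measure_def e bump_nonneg)
qed

lemma AE_spread_law: "AE y in spread_law. norm (y::real^'d) \<le> 1"
  and AE_flux_law: "AE y in flux_law. norm (y::real^'d) \<le> 1"
proof -
  have *: "norm (y::real^'d) \<le> 1" if "0 < bump 1 k y" "0 < k" for y k
    using that bump_outside[of 1 k y] by (cases "norm y \<le> 1") auto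
  show "AE y in spread_law. norm (y::real^'d) \<le> 1"
    unfolding spread_law_def using profile_mass_pos[where 'd = 'd]
    by (subst AE_density) (auto simp: zero_less_divide_iff intro!: AE_I2 *[of 1])
  show "AE y in flux_law. norm (y::real^'d) \<le> 1"
    unfolding flux_law_def using profile_mass_pos[where 'd = 'd]
    by (subst AE_density) (auto simp: zero_less_divide_iff intro!: AE_I2 *[of 2])
qed

definition spread_path :: "real^'d \<Rightarrow> real^'d^'d \<Rightarrow> real \<Rightarrow> real^'d \<Rightarrow> real^'d" where
  "spread_path x B t y = x + sqrt t *\<^sub>R (B *v y)"

lemma continuous_on_mult_vec [continuous_intros]:
  fixes f :: "'a::topological_space \<Rightarrow> real^'n^'m" and g :: "'a \<Rightarrow> real^'n"
  assumes "continuous_on S f" "continuous_on S g"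
  shows "continuous_on S (\<lambda>z. f z *v g z)"
  unfolding matrix_vector_mult_def by (intro continuous_on_vec_lambda continuous_intros assms)

lemma continuous_on_spread_path [continuous_intros]:
  assumes "continuous_on S f" "continuous_on S g"
  shows "continuous_on S (\<lambda>z. spread_path x B (f z) (g z))"
  unfolding spread_path_def by (intro continuous_intros assms)

lemma norm_spread_path_le:
  assumes "0 \<le> t" "t \<le> 1" "norm y \<le> 1"
  shows "norm (spread_path x B t y) \<le> norm x + norm B"
proof -
  have "norm (sqrt t *\<^sub>R (B *v y)) \<le> 1 * (norm B * norm y)"
    unfolding norm_scaleR using assms norm_matrix_vector_mult_le[of B y] by (intro mult_mono) auto
  also have "\<dots> \<le> norm B" using assms mult_left_mono[of "norm y" 1 "norm B"] by simp
  finally show ?thesis unfolding spread_path_def using norm_triangle_ineq[of x "sqrt t *\<^sub>R (B *v y)"] by linarith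
qed

lemma trace_conjugate: "trace (transpose B ** H ** B) = (B ** transpose B) \<bullet> H" for B H :: "real^'d^'d"
proof -
  have "(transpose B ** H ** B) $ i $ i = column i B \<bullet> (H *v column i B)" for i
  proof -
    have "(transpose B ** H ** B) $ i $ i = axis i 1 \<bullet> ((transpose B ** H ** B) *v axis i 1)"
      by (simp add: inner_axis' matrix_vector_mult_basis column_def)
    also have "\<dots> = axis i 1 \<bullet> (transpose B *v (H *v (B *v axis i 1)))"
      by (simp add: matrix_vector_mul_assoc matrix_mul_assoc)
    also have "\<dots> = (B *v axis i 1) \<bullet> (H *v (B *v axis i 1))"
      using dot_lmul_matrix[of "axis i 1" "transpose B" "H *v (B *v axis i 1)"] by (simp add: vector_transpose_matrix)
    also have "\<dots> = column i B \<bullet> (H *v column i B)" by (simp add: matrix_vector_mult_basis)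
    finally show ?thesis .
  qed
  then show ?thesis by (simp add: trace_def inner_matrix_mult_transpose)
qed

text \<open>The chain rule produces \<open>\<nabla>\<phi> \<cdot> B y / (2 \<surd>t)\<close> under the spreading law. The integration by parts
moves the factor \<open>y\<close> onto the gradient as a divergence, whose inner derivative \<open>\<surd>t B\<close> cancels the
singular factor and leaves \<open>1/2 (B B\<^sup>T) : \<nabla>\<^sup>2\<phi>\<close> under the flux law.\<close>
lemma spread_derivative:
  fixes \<phi> :: "real \<times> (real^'d) \<Rightarrow> real" and B :: "real^'d^'d"
  assumes d: "\<And>t x. t \<in> {0<..<1} \<Longrightarrow> ((\<lambda>s. \<phi> (s, x)) has_real_derivative \<phi>t (t, x)) (at t)"
      "\<And>t x. t \<in> {0<..<1} \<Longrightarrow> ((\<lambda>y. \<phi> (t, y)) has_derivative (\<lambda>h. g (t, x) \<bullet> h)) (at x)"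
      "\<And>t x. t \<in> {0<..<1} \<Longrightarrow> ((\<lambda>y. g (t, y)) has_derivative (\<lambda>h. H (t, x) *v h)) (at x)"
    and c: "continuous_on cylinder \<phi>t" "continuous_on cylinder g" "continuous_on cylinder H"
    and t: "t \<in> {0<..<1}"
  shows "((\<lambda>s. \<integral>y. \<phi> (s, spread_path x B s y) \<partial>spread_law) has_real_derivative
     (\<integral>y. \<phi>t (t, spread_path x B t y) \<partial>spread_law)
     + 1/2 * (\<integral>y. (B ** transpose B) \<bullet> H (t, spread_path x B t y) \<partial>flux_law)) (at t)"
proof -
  let ?X = "spread_path x B"
  define Z where "Z = profile_mass TYPE('d)"
  have Z: "Z > 0" unfolding Z_def by (rule profile_mass_pos)
  have joint: "(\<phi> has_derivative (\<lambda>(ts, th). ts * \<phi>t (s, z) + g (s, z) \<bullet> th)) (at (s, z))" if s: "s \<in> {0<..<1}" for s z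
  proof -
    have at: "at (s, z) within {0<..<1} \<times> UNIV = at (s, z)"
      using s by (intro at_within_open open_Times) auto
    have "((\<lambda>(s, z). \<phi> (s, z)) has_derivative (\<lambda>(ts, th). \<phi>t (s, z) * ts + blinfun_inner_right (g (s, z)) th)) (at (s, z) within {0<..<1} \<times> UNIV)"
    proof (rule has_derivative_partialsI[where f = "\<lambda>s z. \<phi> (s, z)" and fy = "\<lambda>s z. blinfun_inner_right (g (s, z))"])
      show "((\<lambda>s. \<phi> (s, z)) has_derivative (*) (\<phi>t (s, z))) (at s within {0<..<1})"
        using d(1)[OF s, of z] by (auto simp: has_field_derivative_def intro: has_derivative_at_withinI)
      show "((\<lambda>z. \<phi> (s, z)) has_derivative blinfun_inner_right (g (s, z))) (at z within UNIV)" if "s \<in> {0<..<1}" for s z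
        using d(2)[OF that, of z] by simp
      have "continuous_on cylinder (\<lambda>z. blinfun_inner_right (g z))"
        by (intro bounded_linear.continuous_on[OF bounded_linear_blinfun_inner_right] c)
      then show "continuous (at (s, z) within {0<..<1} \<times> UNIV) (\<lambda>(s, z). blinfun_inner_right (g (s, z)))"
        using s by (simp add: continuous_on_eq_continuous_within case_prod_unfold)
    qed auto
    then show ?thesis unfolding at by (simp add: case_prod_unfold mult.commute)
  qed
  have dX: "((\<lambda>s. ?X s y) has_vector_derivative (1 / (2 * sqrt s)) *\<^sub>R (B *v y)) (at s)" if "s > 0" for s y
    unfolding spread_path_def has_vector_derivative_def
    using that by (auto intro!: derivative_eq_intros simp: divide_simps)
  define D where "D s y = \<phi>t (s, ?X s y) + (1 / (2 * sqrt s)) * (g (s, ?X s y) \<bullet> (B *v y))" for s y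
  have dphi: "((\<lambda>s. \<phi> (s, ?X s y)) has_derivative (\<lambda>h. h * D s y)) (at s)" if s: "s \<in> {0<..<1}" for s y
  proof -
    have "((\<lambda>s. (s, ?X s y)) has_derivative (\<lambda>h. (h, h *\<^sub>R ((1 / (2 * sqrt s)) *\<^sub>R (B *v y))))) (at s)"
      using dX[of s y] s by (intro has_derivative_Pair has_derivative_ident) (auto simp: has_vector_derivative_def)
    from has_derivative_compose[OF this joint[OF s]] show ?thesis
      by (simp add: D_def algebra_simps)
  qed
  have cont_comp: "continuous_on ({0<..<1} \<times> UNIV) (\<lambda>(s, y). F (s, ?X s y))"
    if "continuous_on cylinder F" for F :: "real \<times> (real^'d) \<Rightarrow> 'b::topological_space"
    unfolding case_prod_unfold
    by (rule continuous_on_compose2[OF that]) (auto intro!: continuous_intros)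
  have cD: "continuous_on ({0<..<1} \<times> UNIV) (\<lambda>(s, y). D s y)"
    unfolding D_def case_prod_unfold
    using cont_comp[OF c(1)] cont_comp[OF c(2)]
    by (intro continuous_intros) (auto simp: case_prod_unfold)
  have sect: "continuous_on UNIV (\<lambda>y. F (s, ?X s y))" if "continuous_on cylinder F" "s \<in> {0<..<1}" for F :: "real \<times> (real^'d) \<Rightarrow> 'b::topological_space" and s
    by (rule continuous_on_compose2[OF that(1)]) (use that(2) in \<open>auto intro!: continuous_intros\<close>)
  have mphi: "continuous_on UNIV (\<lambda>y. \<phi> (s, ?X s y))" if "s \<in> {0<..<1}" for s
  proof -
    have "continuous_on UNIV (\<lambda>z. \<phi> (s, z))"
      using d(2)[OF that] by (intro continuous_at_imp_continuous_on) (auto intro: has_derivative_continuous)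
    then show ?thesis by (rule continuous_on_compose2) (auto intro!: continuous_intros)
  qed
  define r where "r = min t (1 - t) / 2"
  have r: "r > 0" using t by (simp add: r_def)
  have rI: "cball t r \<subseteq> {0<..<1}" using t unfolding r_def by (auto simp: dist_real_def abs_if min_def split: if_splits)
  have "compact ((\<lambda>(s, y). D s y) ` (cball t r \<times> cball 0 1))"
    by (intro compact_continuous_image compact_Times compact_cball continuous_on_subset[OF cD]) (use rI in auto)
  moreover have sI: "s \<in> {0<..<1}" if "s \<in> ball t r" for s
    using rI ball_subset_cball that by blast
  ultimately have "bounded ((\<lambda>(s, y). D s y) ` (cball t r \<times> cball 0 1))" by (simp add: compact_imp_bounded)
  then obtain K where K0: "\<forall>z \<in> (\<lambda>(s, y). D s y) ` (cball t r \<times> cball 0 1). norm z \<le> K"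
    unfolding bounded_iff by blast
  have K: "\<bar>D s y\<bar> \<le> K" if "s \<in> cball t r" "norm y \<le> 1" for s y
    using bspec[OF K0, of "D s y"] that by (force simp: image_iff)
  define b where "b y = 4 * bump 1 1 y / Z" for y :: "real^'d"
  have b0: "b y \<ge> 0" for y using Z by (simp add: b_def bump_nonneg)
  have bo: "b y = 0" if "1 < norm y" for y using that by (simp add: b_def bump_outside)
  have bcont: "continuous_on UNIV b" unfolding b_def by (intro continuous_intros) (use Z in auto)
  have ib: "integrable lborel b"
    unfolding b_def using integrable_bump[of 1 1, where 'a = 'd] by simp
  have ibF: "integrable lborel (\<lambda>y. b y * F y)" if "continuous_on UNIV F" for F :: "real^'d \<Rightarrow> real"
  proof (rule integrable_compact_support[where r = 1])
    show "continuous_on UNIV (\<lambda>y. b y * F y)" by (rule continuous_on_mult[OF bcont that])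
  qed (simp add: b_def bump_outside)
  have cDs: "continuous_on UNIV (D s)" if "s \<in> {0<..<1}" for s
    unfolding D_def using that by (intro continuous_intros sect c) auto
  have "((\<lambda>s. \<integral>y. b y * \<phi> (s, ?X s y) \<partial>lborel) has_derivative (\<lambda>h. \<integral>y. b y * (h * D t y) \<partial>lborel)) (at t)"
  proof (rule has_derivative_integral_dominated[OF r, where w = "\<lambda>y. K * b y"
        and F = "\<lambda>y s. b y * \<phi> (s, ?X s y)" and F' = "\<lambda>y s h. b y * (h * D s y)"])
    show "integrable lborel (\<lambda>y. b y * \<phi> (s, ?X s y))" if "s \<in> ball t r" for s
      by (intro ibF mphi sI that)
    show "((\<lambda>s. b y * \<phi> (s, ?X s y)) has_derivative (\<lambda>h. b y * (h * D s y))) (at s)" if "s \<in> ball t r" for y s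
      by (intro has_derivative_mult_right dphi sI that)
    show "norm (b y * (h * D s y)) \<le> (K * b y) * norm h" if "s \<in> ball t r" for y s h
    proof (cases "norm y \<le> 1")
      case True
      have "b y * (norm h * \<bar>D s y\<bar>) \<le> b y * (norm h * K)"
        using that True by (intro mult_left_mono K b0) auto
      then show ?thesis using b0[of y] by (simp add: abs_mult mult_ac)
    qed (simp add: bo)
    show "(\<lambda>y. b y * (h * D t y)) \<in> borel_measurable lborel" for h
      by (rule borel_measurable_integrable[OF ibF]) (intro continuous_intros cDs[OF t])
  qed (use ib in auto)
  moreover have "(\<integral>y. b y * (h * D t y) \<partial>lborel) = h * (\<integral>y. b y * D t y \<partial>lborel)" for h
    by (simp add: mult.left_commute)
  ultimately have "((\<lambda>s. \<integral>y. b y * \<phi> (s, ?X s y) \<partial>lborel) has_real_derivative (\<integral>y. b y * D t y \<partial>lborel)) (at t)"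
    by (simp add: has_field_derivative_def mult.commute[of _ "\<integral>y. b y * D t y \<partial>lborel"])
  moreover have "(\<integral>y. \<phi> (s, ?X s y) \<partial>spread_law) = (\<integral>y. b y * \<phi> (s, ?X s y) \<partial>lborel)" if "s \<in> {0<..<1}" for s
    by (subst integral_spread_law[OF borel_measurable_continuous_onI[OF mphi[OF that]]]) (simp add: b_def Z_def)
  ultimately have main: "((\<lambda>s. \<integral>y. \<phi> (s, ?X s y) \<partial>spread_law) has_real_derivative (\<integral>y. b y * D t y \<partial>lborel)) (at t)"
    using has_field_derivative_transform_within_open[of "\<lambda>s. \<integral>y. b y * \<phi> (s, ?X s y) \<partial>lborel" _ t "{0<..<1}" "\<lambda>s. \<integral>y. \<phi> (s, ?X s y) \<partial>spread_law"] t
    by simp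
  have c1: "continuous_on UNIV (\<lambda>y. \<phi>t (t, ?X t y))" by (rule sect[OF c(1) t])
  have c2: "continuous_on UNIV (\<lambda>y. (1 / (2 * sqrt t)) * (g (t, ?X t y) \<bullet> (B *v y)))"
    by (intro continuous_intros sect c t)
  have "(\<integral>y. b y * D t y \<partial>lborel) = (\<integral>y. b y * \<phi>t (t, ?X t y) \<partial>lborel) + (\<integral>y. b y * ((1 / (2 * sqrt t)) * (g (t, ?X t y) \<bullet> (B *v y))) \<partial>lborel)"
    unfolding D_def distrib_left by (rule Bochner_Integration.integral_add[OF ibF[OF c1] ibF[OF c2]])
  also have "(\<integral>y. b y * \<phi>t (t, ?X t y) \<partial>lborel) = (\<integral>y. \<phi>t (t, ?X t y) \<partial>spread_law)"
    by (subst integral_spread_law[OF borel_measurable_continuous_onI[OF c1]]) (simp add: b_def Z_def)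
  also have "(\<integral>y. b y * ((1 / (2 * sqrt t)) * (g (t, ?X t y) \<bullet> (B *v y))) \<partial>lborel)
      = 1/2 * (\<integral>y. (B ** transpose B) \<bullet> H (t, ?X t y) \<partial>flux_law)"
  proof -
    define V where "V y = transpose B *v g (t, ?X t y)" for y
    define A where "A y = sqrt t *\<^sub>R (transpose B ** H (t, ?X t y) ** B)" for y
    have dV: "(V has_derivative (\<lambda>h. A y *v h)) (at y)" for y
    proof -
      have "(?X t has_derivative (\<lambda>h. sqrt t *\<^sub>R (B *v h))) (at y)"
        unfolding spread_path_def
        by (auto intro!: derivative_eq_intros bounded_linear.has_derivative[OF matrix_vector_mul_bounded_linear])
      from bounded_linear.has_derivative[OF matrix_vector_mul_bounded_linear[of "transpose B"] has_derivative_compose[OF this d(3)[OF t]]]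
      show ?thesis unfolding V_def A_def
        by (rule has_derivative_eq_rhs)
          (simp add: fun_eq_iff matrix_vector_mul_assoc matrix_mul_assoc matrix_vector_mult_scaleR scaleR_matrix_vector_assoc[symmetric])
    qed
    have cA: "continuous_on UNIV A"
      unfolding A_def matrix_matrix_mult_def transpose_def
      using sect[OF c(3) t] by (intro continuous_intros continuous_on_vec_lambda) (auto intro!: continuous_intros)
    have cH: "continuous_on UNIV (\<lambda>y. (B ** transpose B) \<bullet> H (t, ?X t y))"
      by (intro continuous_intros sect c t)
    have s0: "sqrt t > 0" using t by simp
    have "(\<integral>y. b y * ((1 / (2 * sqrt t)) * (g (t, ?X t y) \<bullet> (B *v y))) \<partial>lborel)
      = (1 / (2 * sqrt t * Z)) * (\<integral>y. 4 * bump 1 1 y * (y \<bullet> V y) \<partial>lborel)"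
    proof -
      have "g z \<bullet> (B *v y) = y \<bullet> (transpose B *v g z)" for z y
        using dot_lmul_matrix[of "g z" B y] by (simp add: inner_commute matrix_transpose_mul flip: vector_transpose_matrix)
      then show ?thesis
        by (simp add: V_def b_def flip: integral_mult_right_zero)
    qed
    also have "(\<integral>y. 4 * bump 1 1 y * (y \<bullet> V y) \<partial>lborel) = (\<integral>y. bump 1 2 y * trace (A y) \<partial>lborel)"
      by (rule bump_integration_by_parts[OF dV cA, symmetric])
    also have "(\<lambda>y. bump 1 2 y * trace (A y)) = (\<lambda>y. sqrt t * Z * ((bump 1 2 y / Z) * ((B ** transpose B) \<bullet> H (t, ?X t y))))"
    proof -
      have "trace (A y) = sqrt t * ((B ** transpose B) \<bullet> H (t, ?X t y))" for y
        unfolding A_def trace_conjugate[symmetric] by (simp add: trace_def sum_distrib_left)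
      then show ?thesis using Z by (simp add: fun_eq_iff)
    qed
    also have "(\<integral>y. sqrt t * Z * ((bump 1 2 y / Z) * ((B ** transpose B) \<bullet> H (t, ?X t y))) \<partial>lborel)
       = sqrt t * Z * (\<integral>y. (B ** transpose B) \<bullet> H (t, ?X t y) \<partial>flux_law)"
      by (subst integral_flux_law[OF borel_measurable_continuous_onI[OF cH]]) (simp add: Z_def)
    finally show ?thesis using s0 Z by simp
  qed
  finally show ?thesis using main by simp
qed

section \<open>A solution of the Fokker-Planck equation\<close>

lemma integral_derivative_constant_near_ends:
  fixes F f :: "real \<Rightarrow> real"
  assumes D: "\<And>t. t \<in> {0<..<1} \<Longrightarrow> (F has_real_derivative f t) (at t)"
    and c: "continuous_on {0<..<1} f" and a: "0 < a" "a < 1/2"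
    and A: "\<And>t. 0 < t \<Longrightarrow> t < a \<Longrightarrow> F t = A" and C: "\<And>t. 1 - a < t \<Longrightarrow> t < 1 \<Longrightarrow> F t = C"
  shows "(\<integral>t\<in>{0<..<1}. f t \<partial>lborel) = C - A"
proof -
  define b where "b = a / 2"
  have b: "0 < b" "b < a" "b < 1 - b" "1 - a < 1 - b" using a by (auto simp: b_def)
  have fz: "f t = 0" if t: "t \<in> {0<..<1}" "t < a \<or> 1 - a < t" for t
  proof (cases "t < a")
    case True
    have "(F has_real_derivative 0) (at t)"
      by (rule has_field_derivative_transform_within_open[where f = "\<lambda>_. A" and S = "{0<..<a}"])
        (use t A True in auto)
    with D[OF t(1)] show ?thesis by (rule DERIV_unique)
  next
    case False
    have "(F has_real_derivative 0) (at t)"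
      by (rule has_field_derivative_transform_within_open[where f = "\<lambda>_. C" and S = "{1-a<..<1}"])
        (use t C False in auto)
    with D[OF t(1)] show ?thesis by (rule DERIV_unique)
  qed
  have "(\<integral>t\<in>{0<..<1}. f t \<partial>lborel) = (\<integral>t\<in>{b..1-b}. f t \<partial>lborel)"
    unfolding set_lebesgue_integral_def
    by (intro Bochner_Integration.integral_cong) (use b fz in \<open>auto simp: indicator_def\<close>)
  also have "\<dots> = integral {b..1-b} f"
    using b by (intro set_borel_integral_eq_integral(2) borel_integrable_atLeastAtMost' continuous_on_subset[OF c]) auto
  also have "(f has_integral (F (1 - b) - F b)) {b..1-b}"
    using b D by (intro fundamental_theorem_of_calculus)
      (auto simp flip: has_real_derivative_iff_has_vector_derivative intro: has_field_derivative_at_within)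
  then have "integral {b..1-b} f = C - A" using A[of b] C[of "1 - b"] b a by (simp add: integral_unique)
  finally show ?thesis .
qed

lemma set_integrable_continuous_bounded:
  fixes f :: "real \<Rightarrow> 'b::{banach,second_countable_topology}"
  assumes "continuous_on {0<..<1} f" "\<And>t. t \<in> {0<..<1} \<Longrightarrow> norm (f t) \<le> K"
  shows "set_integrable lborel {0<..<1} f"
  unfolding set_integrable_def
proof (rule Bochner_Integration.integrable_bound[where f = "\<lambda>t. K * indicator {0<..<1} t"])
  show "integrable lborel (\<lambda>t. K * indicator {0<..<1::real} t)" by simp
  show "(\<lambda>t. indicator {0<..<1} t *\<^sub>R f t) \<in> borel_measurable lborel"
    using borel_measurable_continuous_on_indicator[OF _ assms(1)] by simp
qed (use assms(2) in \<open>auto simp: indicator_def intro!: order_trans[OF _ abs_ge_self]\<close>)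

lemma mult_transpose_psd: "B ** transpose B \<in> psd_mats" for B :: "real^'d^'d"
proof -
  have adj: "x \<bullet> (B *v z) = (transpose B *v x) \<bullet> z" for x z
    using dot_lmul_matrix[of x B z] by (simp add: transpose_matrix_vector)
  have "x \<bullet> ((B ** transpose B) *v x) = (transpose B *v x) \<bullet> (transpose B *v x)" for x
    by (simp only: matrix_vector_mul_assoc[symmetric] adj)
  then show ?thesis by (simp add: psd_mats_def sym_mats_def matrix_transpose_mul)
qed

lemma scaleR_psd: "A \<in> psd_mats \<Longrightarrow> 0 \<le> c \<Longrightarrow> c *\<^sub>R A \<in> psd_mats"
  by (auto simp: psd_mats_def sym_mats_def transpose_def vec_eq_iff scaleR_matrix_vector_assoc[symmetric])

definition cyl_path :: "real^'d \<Rightarrow> real^'d^'d \<Rightarrow> real \<times> (real^'d) \<Rightarrow> real \<times> (real^'d)" where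
  "cyl_path x B = (\<lambda>(t, y). (t, spread_path x B t y))"

definition spread_at :: "(real^'d) measure \<Rightarrow> real^'d \<Rightarrow> real^'d^'d \<Rightarrow> real \<Rightarrow> (real^'d) measure" where
  "spread_at Q x B t = distr Q borel (spread_path x B t)"

text \<open>Its disintegration in time is \<open>spread_at\<close>, by Tonelli's theorem. With the spreading law it
gives the moving mass, with the flux law the scalar factor of the matrix measure.\<close>
definition spread_cyl :: "(real^'d) measure \<Rightarrow> real^'d \<Rightarrow> real^'d^'d \<Rightarrow> (real \<times> (real^'d)) measure" where
  "spread_cyl Q x B = distr (restrict_space lborel {0<..<1} \<Otimes>\<^sub>M Q) cylinder_borel (cyl_path x B)"

lemma spread_path_measurable [measurable]: "spread_path x B t \<in> borel_measurable borel"
  by (intro borel_measurable_continuous_onI continuous_intros)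

lemma open_cylinder: "open cylinder" by (intro open_Times) auto

lemma sets_cylinder_borel_iff: "E \<in> sets cylinder_borel \<longleftrightarrow> E \<subseteq> cylinder \<and> E \<in> sets borel"
  using sets_restrict_space_iff[of cylinder borel E] borel_open[OF open_cylinder] by simp

lemma sets_Pair_vimage:
  fixes E :: "(real \<times> (real^'d)) set"
  assumes "E \<in> sets cylinder_borel" shows "Pair t -` E \<in> sets borel"
proof -
  have "E \<in> sets (borel \<Otimes>\<^sub>M borel)" using assms unfolding borel_prod by (simp add: sets_cylinder_borel_iff)
  then show ?thesis by (rule sets_Pair1)
qed

context
  fixes Q :: "(real^'d) measure" and x :: "real^'d" and B :: "real^'d^'d"
  assumes Q: "finite_measure Q" and sQ: "sets Q = sets borel"
begin

interpretation Q: finite_measure Q by (rule Q)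

lemma spaceQ: "space Q = UNIV" using sets_eq_imp_space_eq[OF sQ] by simp

lemma path_measurable_Q: "spread_path x B t \<in> Q \<rightarrow>\<^sub>M borel"
  using spread_path_measurable[of x B t] by (simp add: measurable_cong_sets[OF sQ refl])

lemma cyl_path_measurable:
  assumes "N = restrict_space lborel {0<..<1} \<or> N = restrict_space borel {0<..<1}"
  shows "cyl_path x B \<in> N \<Otimes>\<^sub>M Q \<rightarrow>\<^sub>M cylinder_borel"
proof (rule measurable_restrict_space2)
  have sN: "sets N = sets (restrict_space borel {0<..<1::real})"
    using assms sets_restrict_space_cong[OF sets_lborel, of "{0<..<1::real}"] by auto
  have spN: "space N = {0<..<1}" using sets_eq_imp_space_eq[OF sN] by (simp add: space_restrict_space)
  show "cyl_path x B \<in> space (N \<Otimes>\<^sub>M Q) \<rightarrow> cylinder"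
    by (auto simp: space_pair_measure spN cyl_path_def)
  have "cyl_path x B \<in> borel_measurable borel"
    unfolding cyl_path_def case_prod_unfold by (intro borel_measurable_continuous_onI continuous_intros)
  moreover have "(\<lambda>p. (fst p, snd p)) \<in> N \<Otimes>\<^sub>M Q \<rightarrow>\<^sub>M borel \<Otimes>\<^sub>M borel"
  proof (rule measurable_Pair)
    have "(\<lambda>t. t) \<in> N \<rightarrow>\<^sub>M borel"
      unfolding measurable_cong_sets[OF sN refl] by (intro measurable_restrict_space1) simp
    from measurable_compose[OF measurable_fst this] show "fst \<in> N \<Otimes>\<^sub>M Q \<rightarrow>\<^sub>M borel" .
    have "(\<lambda>t. t) \<in> Q \<rightarrow>\<^sub>M borel" unfolding measurable_cong_sets[OF sQ refl] by simp
    from measurable_compose[OF measurable_snd this] show "snd \<in> N \<Otimes>\<^sub>M Q \<rightarrow>\<^sub>M borel" .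
  qed
  ultimately show "cyl_path x B \<in> N \<Otimes>\<^sub>M Q \<rightarrow>\<^sub>M borel"
    unfolding borel_prod by (auto dest: measurable_compose)
qed

lemma emeasure_spread_at:
  assumes "t \<in> {0<..<1}" "E \<in> sets cylinder_borel"
  shows "emeasure (spread_at Q x B t) (Pair t -` E) = emeasure Q (Pair t -` (cyl_path x B -` E))"
  unfolding spread_at_def
  by (subst emeasure_distr[OF path_measurable_Q sets_Pair_vimage[OF assms(2)]])
    (auto simp: spaceQ cyl_path_def intro!: arg_cong[where f = "emeasure Q"])

lemma Pair_cyl_path:
  assumes "space N = {0<..<1}" "t \<in> {0<..<1}"
  shows "Pair t -` (cyl_path x B -` E \<inter> space (N \<Otimes>\<^sub>M Q)) = Pair t -` (cyl_path x B -` E)"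
  using assms by (auto simp: space_pair_measure spaceQ)

lemma emeasure_spread_cyl:
  assumes E: "E \<in> sets cylinder_borel"
  shows "emeasure (spread_cyl Q x B) E = (\<integral>\<^sup>+t\<in>{0<..<1}. emeasure (spread_at Q x B t) (Pair t -` E) \<partial>lborel)"
proof -
  let ?N = "restrict_space lborel {0<..<1::real}"
  have m: "cyl_path x B \<in> ?N \<Otimes>\<^sub>M Q \<rightarrow>\<^sub>M cylinder_borel" by (rule cyl_path_measurable) simp
  have "emeasure (spread_cyl Q x B) E = emeasure (?N \<Otimes>\<^sub>M Q) (cyl_path x B -` E \<inter> space (?N \<Otimes>\<^sub>M Q))"
    unfolding spread_cyl_def by (rule emeasure_distr[OF m E])
  also have "\<dots> = (\<integral>\<^sup>+t. emeasure Q (Pair t -` (cyl_path x B -` E \<inter> space (?N \<Otimes>\<^sub>M Q))) \<partial>?N)"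
    by (rule Q.emeasure_pair_measure_alt[OF measurable_sets[OF m E]])
  also have "\<dots> = (\<integral>\<^sup>+t. emeasure (spread_at Q x B t) (Pair t -` E) \<partial>?N)"
    by (intro nn_integral_cong, subst Pair_cyl_path) (auto simp: emeasure_spread_at[OF _ E] space_restrict_space)
  also have "\<dots> = (\<integral>\<^sup>+t\<in>{0<..<1}. emeasure (spread_at Q x B t) (Pair t -` E) \<partial>lborel)"
    by (rule nn_integral_restrict_space) simp
  finally show ?thesis .
qed

lemma emeasure_spread_at_measurable:
  assumes E: "E \<in> sets cylinder_borel"
  shows "(\<lambda>t. emeasure (spread_at Q x B t) (Pair t -` E)) \<in> borel_measurable (restrict_space borel {0<..<1})"
proof -
  let ?N = "restrict_space borel {0<..<1::real}"
  have m: "cyl_path x B \<in> ?N \<Otimes>\<^sub>M Q \<rightarrow>\<^sub>M cylinder_borel" by (rule cyl_path_measurable) simp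
  have "(\<lambda>t. emeasure Q (Pair t -` (cyl_path x B -` E \<inter> space (?N \<Otimes>\<^sub>M Q)))) \<in> borel_measurable ?N"
    by (rule Q.measurable_emeasure_Pair[OF measurable_sets[OF m E]])
  then show ?thesis
    by (rule measurable_cong[THEN iffD1, rotated], subst Pair_cyl_path)
      (auto simp: emeasure_spread_at[OF _ E] space_restrict_space)
qed

lemma emeasure_spread_at_set_measurable:
  assumes A: "A \<in> sets borel"
  shows "(\<lambda>t. emeasure (spread_at Q x B t) A) \<in> borel_measurable (restrict_space borel {0<..<1})"
proof -
  have E: "{0<..<1} \<times> A \<in> sets cylinder_borel"
  proof -
    have "{0<..<1::real} \<times> A \<in> sets (borel \<Otimes>\<^sub>M borel)" using A by (intro pair_measureI) auto
    then show ?thesis unfolding borel_prod by (auto simp: sets_cylinder_borel_iff)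
  qed
  from emeasure_spread_at_measurable[OF this] show ?thesis
    by (rule measurable_cong[THEN iffD1, rotated]) (auto simp: space_restrict_space vimage_def)
qed

lemma emeasure_spread_at_UNIV: "emeasure (spread_at Q x B t) UNIV = emeasure Q UNIV"
  unfolding spread_at_def by (subst emeasure_distr[OF path_measurable_Q]) (auto simp: spaceQ)

lemma finite_measure_spread_at: "finite_measure (spread_at Q x B t)"
  unfolding spread_at_def by (rule Q.finite_measure_distr[OF path_measurable_Q])

lemma sets_spread_at: "sets (spread_at Q x B t) = sets borel"
  by (simp add: spread_at_def)

lemma integral_spread_at:
  fixes F :: "real^'d \<Rightarrow> 'b::{banach,second_countable_topology}"
  assumes "F \<in> borel_measurable borel"
  shows "(\<integral>z. F z \<partial>spread_at Q x B t) = (\<integral>y. F (spread_path x B t y) \<partial>Q)"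
  unfolding spread_at_def by (rule integral_distr[OF path_measurable_Q assms])

lemma finite_measure_spread_cyl: "finite_measure (spread_cyl Q x B)"
proof (rule finite_measureI)
  have c: "cylinder \<in> sets (cylinder_borel :: (real \<times> (real^'d)) measure)"
    using borel_open[OF open_cylinder] by (simp add: sets_cylinder_borel_iff)
  have "emeasure (spread_cyl Q x B) (space (spread_cyl Q x B)) = emeasure (spread_cyl Q x B) cylinder"
    by (simp add: spread_cyl_def space_restrict_space)
  also have "\<dots> = (\<integral>\<^sup>+t\<in>{0<..<1}. emeasure (spread_at Q x B t) (Pair t -` cylinder) \<partial>lborel)"
    by (rule emeasure_spread_cyl[OF c])
  also have "\<dots> = (\<integral>\<^sup>+t\<in>{0<..<1::real}. emeasure Q UNIV \<partial>lborel)"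
    by (intro nn_integral_cong) (auto simp: indicator_def vimage_def emeasure_spread_at_UNIV)
  also have "\<dots> = emeasure Q UNIV" by (simp add: nn_integral_cmult_indicator)
  also have "\<dots> < \<infinity>" using Q.emeasure_finite[of UNIV] by (simp add: less_top[symmetric])
  finally show "emeasure (spread_cyl Q x B) (space (spread_cyl Q x B)) \<noteq> \<infinity>" by simp
qed

end

lemma scaled_measure_mat_measures:
  assumes "finite_measure \<mu>" "sets \<mu> = sets N" "M \<in> psd_mats"
  shows "(\<lambda>E. measure \<mu> E *\<^sub>R M) \<in> mat_measures N"
proof -
  interpret finite_measure \<mu> by fact
  show ?thesis unfolding mat_measures_def
    using assms(2,3) by (auto intro!: scaleR_psd sums_scaleR_left finite_measure_UNION)
qed

lemma
  fixes M :: "real^'d^'d"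
  assumes \<mu>: "finite_measure \<mu>" "sets \<mu> = sets N" and M: "M \<in> psd_mats"
  shows total_var_scaled_measure: "total_var N (\<lambda>E. measure \<mu> E *\<^sub>R M) = density \<mu> (\<lambda>_. ennreal (norm M))"
    and AE_polar_density_scaled_measure:
      "AE z in total_var N (\<lambda>E. measure \<mu> E *\<^sub>R M). polar_density N (\<lambda>E. measure \<mu> E *\<^sub>R M) z = sgn M"
proof -
  let ?\<Lambda> = "\<lambda>E. measure \<mu> E *\<^sub>R M"
  interpret \<mu>: finite_measure \<mu> by fact
  show tv: "total_var N ?\<Lambda> = density \<mu> (\<lambda>_. ennreal (norm M))"
  proof (rule total_variation_density[OF \<mu>(2)])
    fix E assume "E \<in> sets N"
    then show "?\<Lambda> E = (\<integral>x\<in>E. M \<partial>\<mu>)" using \<mu>(2) by (simp add: set_lebesgue_integral_def \<mu>.emeasure_eq_measure)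
  qed simp
  have mm: "?\<Lambda> \<in> mat_measures N" by (rule scaled_measure_mat_measures[OF assms])
  interpret T: finite_measure "total_var N ?\<Lambda>" by (rule finite_measure_total_var[OF mm])
  show "AE z in total_var N ?\<Lambda>. polar_density N ?\<Lambda> z = sgn M"
  proof (rule T.density_unique_banach[OF integrable_polar_density[OF mm]])
    fix E assume "E \<in> sets (total_var N ?\<Lambda>)"
    then have E: "E \<in> sets N" by (simp add: sets_total_var)
    have "(\<integral>z\<in>E. sgn M \<partial>total_var N ?\<Lambda>) = (\<integral>z. norm M *\<^sub>R (indicator E z *\<^sub>R sgn M) \<partial>\<mu>)"
      unfolding tv set_lebesgue_integral_def using E \<mu>(2) by (intro integral_density) auto
    also have "\<dots> = (\<integral>z. indicator E z *\<^sub>R M \<partial>\<mu>)"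
      by (intro Bochner_Integration.integral_cong) (auto simp: sgn_div_norm indicator_def)
    also have "\<dots> = ?\<Lambda> E" using E \<mu>(2) by (simp add: \<mu>.emeasure_eq_measure)
    finally show "(\<integral>z\<in>E. polar_density N ?\<Lambda> z \<partial>total_var N ?\<Lambda>) = (\<integral>z\<in>E. sgn M \<partial>total_var N ?\<Lambda>)"
      by (simp add: set_integral_polar_density[OF mm E, symmetric])
  qed simp
qed

lemma mat_integral_scaled_measure:
  fixes M :: "real^'d^'d"
  assumes \<mu>: "finite_measure \<mu>" "sets \<mu> = sets N" and M: "M \<in> psd_mats" and \<Phi>: "\<Phi> \<in> borel_measurable N"
  shows "mat_integral N (\<lambda>E. measure \<mu> E *\<^sub>R M) \<Phi> = (\<integral>z. M \<bullet> \<Phi> z \<partial>\<mu>)"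
proof -
  let ?\<Lambda> = "\<lambda>E. measure \<mu> E *\<^sub>R M"
  note tv = total_var_scaled_measure[OF assms(1-3)]
  have \<Phi>m: "\<Phi> \<in> borel_measurable \<mu>" using \<Phi> by (simp add: measurable_cong_sets[OF \<mu>(2) refl])
  have mm: "?\<Lambda> \<in> mat_measures N" by (rule scaled_measure_mat_measures[OF assms(1-3)])
  have \<Phi>t: "\<Phi> \<in> borel_measurable (total_var N ?\<Lambda>)" using \<Phi> by (simp add: measurable_cong_sets[OF sets_total_var refl])
  have pm: "polar_density N ?\<Lambda> \<in> borel_measurable (total_var N ?\<Lambda>)"
    by (rule borel_measurable_integrable[OF integrable_polar_density[OF mm]])
  have "mat_integral N ?\<Lambda> \<Phi> = (\<integral>z. \<Phi> z \<bullet> sgn M \<partial>total_var N ?\<Lambda>)"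
    unfolding mat_integral_def
  proof (rule integral_cong_AE)
    show "AE z in total_var N ?\<Lambda>. \<Phi> z \<bullet> polar_density N ?\<Lambda> z = \<Phi> z \<bullet> sgn M"
      using AE_polar_density_scaled_measure[OF assms(1-3)] by eventually_elim simp
  qed (use \<Phi>t pm in measurable)
  also have "\<dots> = (\<integral>z. norm M *\<^sub>R (\<Phi> z \<bullet> sgn M) \<partial>\<mu>)"
    unfolding tv using \<Phi>m by (intro integral_density) auto
  also have "\<dots> = (\<integral>z. M \<bullet> \<Phi> z \<partial>\<mu>)"
  proof -
    have "norm M *\<^sub>R sgn M = M" by (cases "M = 0") (simp_all add: sgn_div_norm)
    then have "norm M *\<^sub>R (\<Phi> z \<bullet> sgn M) = M \<bullet> \<Phi> z" for z
      by (metis inner_commute inner_scaleR_right real_scaleR_def)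
    then show ?thesis by simp
  qed
  finally show ?thesis .
qed

text \<open>The closed support of a test function may come arbitrarily close to the times 0 and 1 at infinity
in space. Over a bounded set of positions it is compact and stays away from them.\<close>
lemma test_function_vanishes_near_ends:
  fixes \<phi> :: "real \<times> (real^'d) \<Rightarrow> real"
  assumes supp: "closure {z \<in> cylinder. \<phi> z \<noteq> 0} \<subseteq> cylinder"
  obtains \<epsilon> where "0 < \<epsilon>" "\<epsilon> < 1/2"
    "\<And>t z. t \<in> {0<..<1} \<Longrightarrow> t < \<epsilon> \<or> 1 - \<epsilon> < t \<Longrightarrow> norm z \<le> R \<Longrightarrow> \<phi> (t, z) = 0"
proof -
  define C where "C = closure {z \<in> cylinder. \<phi> z \<noteq> 0} \<inter> (cbox 0 1 \<times> cball 0 R)"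
  have "compact C" unfolding C_def by (intro closed_Int_compact closed_closure compact_Times compact_cbox compact_cball)
  then have cf: "compact (fst ` C)" by (intro compact_continuous_image continuous_intros)
  have sub: "fst ` C \<subseteq> {0<..<1}" using supp by (auto simp: C_def)
  have "\<exists>\<epsilon>>0. \<epsilon> < 1/2 \<and> fst ` C \<subseteq> {\<epsilon>..1-\<epsilon>}"
  proof (cases "C = {}")
    case False
    then obtain lo where lo: "lo \<in> fst ` C" "\<And>s. s \<in> fst ` C \<Longrightarrow> lo \<le> s"
      using compact_attains_inf[OF cf] by (metis image_is_empty)
    from False obtain hi where hi: "hi \<in> fst ` C" "\<And>s. s \<in> fst ` C \<Longrightarrow> s \<le> hi"
      using compact_attains_sup[OF cf] by (metis image_is_empty)
    define \<epsilon> where "\<epsilon> = min (1/3) (min lo (1 - hi))"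
    have "0 < lo" "hi < 1" using lo(1) hi(1) sub by auto
    then have "0 < \<epsilon>" "\<epsilon> < 1/2" "\<epsilon> \<le> lo" "hi \<le> 1 - \<epsilon>" by (auto simp: \<epsilon>_def min_def)
    moreover have "fst ` C \<subseteq> {\<epsilon>..1-\<epsilon>}"
    proof
      fix s assume "s \<in> fst ` C"
      from lo(2)[OF this] hi(2)[OF this] \<open>\<epsilon> \<le> lo\<close> \<open>hi \<le> 1 - \<epsilon>\<close> show "s \<in> {\<epsilon>..1-\<epsilon>}" by simp
    qed
    ultimately show ?thesis by blast
  qed (auto intro: exI[of _ "1/3"])
  then obtain \<epsilon> where \<epsilon>: "\<epsilon> > 0" "\<epsilon> < 1/2" "fst ` C \<subseteq> {\<epsilon>..1-\<epsilon>}" by blast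
  have "\<phi> (t, z) = 0" if "t \<in> {0<..<1}" "t < \<epsilon> \<or> 1 - \<epsilon> < t" "norm z \<le> R" for t z
  proof (rule ccontr)
    assume "\<phi> (t, z) \<noteq> 0"
    with that have "(t, z) \<in> C" using closure_subset[of "{z \<in> cylinder. \<phi> z \<noteq> 0}"] by (auto simp: C_def)
    then have "t \<in> fst ` C" by force
    with \<epsilon>(3) that(2) show False by auto
  qed
  with \<epsilon>(1,2) show thesis by (rule that)
qed

text \<open>By \<open>spread_derivative\<close> the two integrands add up to the derivative of \<open>t \<mapsto> \<integral> \<phi> (t, \<cdot>) dr\<^sub>t\<close>, and this
function vanishes near both ends, because all paths stay in one ball.\<close>
lemma spread_weak_equation:
  fixes x :: "real^'d" and B :: "real^'d^'d"
  defines "M \<equiv> B ** transpose B"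
  assumes test: "test_function \<phi> \<phi>t H"
  shows "(\<integral>t\<in>{0<..<1}. (\<integral>z. \<phi>t (t, z) \<partial>spread_at spread_law x B t) \<partial>lborel) =
        - (\<integral>t\<in>{0<..<1}. mat_integral borel (\<lambda>E. measure (spread_at flux_law x B t) E *\<^sub>R M) (\<lambda>z. (1/2) *\<^sub>R H (t, z)) \<partial>lborel)"
proof -
  interpret SL: prob_space "spread_law :: (real^'d) measure" by (rule prob_space_spread_law)
  interpret FL: finite_measure "flux_law :: (real^'d) measure" by (rule finite_measure_flux_law)
  note S = SL.finite_measure_axioms sets_spread_law
  note F = FL.finite_measure_axioms sets_flux_law
  have M: "M \<in> psd_mats" unfolding M_def by (rule mult_transpose_psd)
  let ?X = "spread_path x B"
  obtain g where dA: "\<forall>t\<in>{0<..<1}. \<forall>x.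
        ((\<lambda>s. \<phi> (s, x)) has_real_derivative \<phi>t (t, x)) (at t) \<and>
        ((\<lambda>y. \<phi> (t, y)) has_derivative (\<lambda>h. g (t, x) \<bullet> h)) (at x) \<and>
        ((\<lambda>y. g (t, y)) has_derivative (\<lambda>h. H (t, x) *v h)) (at x)"
    and c: "continuous_on cylinder \<phi>t" "continuous_on cylinder g" "continuous_on cylinder H"
    and b: "bounded (\<phi>t ` cylinder)" "bounded (H ` cylinder)"
    and supp: "closure {z \<in> cylinder. \<phi> z \<noteq> 0} \<subseteq> cylinder"
    using test unfolding test_function_def by (elim exE conjE)
  have d: "((\<lambda>s. \<phi> (s, x)) has_real_derivative \<phi>t (t, x)) (at t)"
    "((\<lambda>y. \<phi> (t, y)) has_derivative (\<lambda>h. g (t, x) \<bullet> h)) (at x)"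
    "((\<lambda>y. g (t, y)) has_derivative (\<lambda>h. H (t, x) *v h)) (at x)" if "t \<in> {0<..<1}" for t x
    using dA that by blast+
  obtain K1 where K1: "\<And>t z. t \<in> {0<..<1} \<Longrightarrow> norm (\<phi>t (t, z)) \<le> K1" using b(1) by (fastforce simp: bounded_iff)
  obtain K2 where K2: "\<And>t z. t \<in> {0<..<1} \<Longrightarrow> norm (H (t, z)) \<le> K2" using b(2) by (fastforce simp: bounded_iff)
  have sect: "continuous_on UNIV (\<lambda>z. F (t, z))" if "continuous_on cylinder F" "t \<in> {0<..<1}" for F :: "real \<times> (real^'d) \<Rightarrow> 'b::topological_space" and t
    by (rule continuous_on_compose2[OF that(1)]) (use that(2) in \<open>auto intro!: continuous_intros\<close>)
  have path: "continuous_on {0<..<1} (\<lambda>t. F (t, ?X t y))" if "continuous_on cylinder F" for F :: "real \<times> (real^'d) \<Rightarrow> 'b::topological_space" and y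
    by (rule continuous_on_compose2[OF that]) (auto intro!: continuous_intros)
  have spm: "continuous_on UNIV (\<lambda>y. F (t, ?X t y))" if "continuous_on cylinder F" "t \<in> {0<..<1}" for F :: "real \<times> (real^'d) \<Rightarrow> 'b::topological_space" and t
    by (rule continuous_on_compose2[OF that(1)]) (use that(2) in \<open>auto intro!: continuous_intros\<close>)
  define a where "a t = (\<integral>y. \<phi>t (t, ?X t y) \<partial>spread_law)" for t
  define b' where "b' t = 1/2 * (\<integral>y. M \<bullet> H (t, ?X t y) \<partial>flux_law)" for t
  define h where "h t = (\<integral>y. \<phi> (t, ?X t y) \<partial>spread_law)" for t
  have 1: "(\<integral>z. \<phi>t (t, z) \<partial>spread_at spread_law x B t) = a t" if "t \<in> {0<..<1}" for t
    unfolding a_def by (rule integral_spread_at[OF S borel_measurable_continuous_onI[OF sect[OF c(1) that]]])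
  have 2: "mat_integral borel (\<lambda>E. measure (spread_at flux_law x B t) E *\<^sub>R M) (\<lambda>z. (1/2) *\<^sub>R H (t, z)) = b' t" if t: "t \<in> {0<..<1}" for t
  proof -
    have "mat_integral borel (\<lambda>E. measure (spread_at flux_law x B t) E *\<^sub>R M) (\<lambda>z. (1/2) *\<^sub>R H (t, z)) = (\<integral>z. M \<bullet> ((1/2) *\<^sub>R H (t, z)) \<partial>spread_at flux_law x B t)"
      by (rule mat_integral_scaled_measure[OF finite_measure_spread_at[OF F] sets_spread_at[OF F] M borel_measurable_continuous_onI])
        (intro continuous_intros sect c t)
    also have "\<dots> = (\<integral>y. M \<bullet> ((1/2) *\<^sub>R H (t, ?X t y)) \<partial>flux_law)"
      by (rule integral_spread_at[OF F borel_measurable_continuous_onI]) (intro continuous_intros sect c t)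
    finally show ?thesis by (simp add: b'_def)
  qed
  have ca: "continuous_on {0<..<1} a"
    unfolding a_def
  proof (rule continuous_on_integral_bounded[OF S(1), where K = K1])
    show "(\<lambda>y. \<phi>t (t, ?X t y)) \<in> borel_measurable spread_law" if "t \<in> {0<..<1}" for t
      using borel_measurable_continuous_onI[OF spm[OF c(1) that]] by simp
  qed (use K1 path[OF c(1)] in auto)
  have mH: "(\<lambda>y. M \<bullet> H (t, ?X t y)) \<in> borel_measurable borel" if "t \<in> {0<..<1}" for t
    by (rule borel_measurable_continuous_onI) (intro continuous_intros spm c that)
  have leH: "norm (M \<bullet> H (t, z)) \<le> norm M * K2" if "t \<in> {0<..<1}" for t z
    using order_trans[OF Cauchy_Schwarz_ineq2[of M "H (t, z)"] mult_left_mono[OF K2[OF that]]] by auto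
  have cb: "continuous_on {0<..<1} (\<lambda>t. \<integral>y. M \<bullet> H (t, ?X t y) \<partial>flux_law)"
  proof (rule continuous_on_integral_bounded[OF F(1), where K = "norm M * K2"])
    show "AE y in flux_law. continuous_on {0<..<1} (\<lambda>t. M \<bullet> H (t, ?X t y))"
      by (intro AE_I2 continuous_intros path c)
  qed (use leH mH in auto)
  then have cb': "continuous_on {0<..<1} b'" unfolding b'_def by (intro continuous_intros)
  have ba: "norm (a t) \<le> K1" if t: "t \<in> {0<..<1}" for t
  proof -
    have "integrable spread_law (\<lambda>y. \<phi>t (t, ?X t y))"
      by (rule SL.integrable_const_bound[where B = K1])
        (use K1[OF t] borel_measurable_continuous_onI[OF spm[OF c(1) t]] in auto)
    then show ?thesis unfolding a_def
      by (intro order_trans[OF integral_norm_bound SL.integral_le_const] integrable_norm AE_I2 K1 t)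
  qed
  have bb: "norm (b' t) \<le> norm M * K2 * measure (flux_law :: (real^'d) measure) UNIV" if t: "t \<in> {0<..<1}" for t
  proof -
    have "integrable flux_law (\<lambda>y. M \<bullet> H (t, ?X t y))"
      by (rule FL.integrable_const_bound[where B = "norm M * K2"]) (use leH[OF t] mH[OF t] in auto)
    then have "norm (\<integral>y. M \<bullet> H (t, ?X t y) \<partial>flux_law) \<le> (\<integral>y. norm M * K2 \<partial>(flux_law :: (real^'d) measure))"
      by (intro order_trans[OF integral_norm_bound integral_mono] integrable_norm leH t) auto
    also have "\<dots> = norm M * K2 * measure (flux_law :: (real^'d) measure) UNIV" by simp
    finally show ?thesis unfolding b'_def by (simp add: abs_mult)
  qed
  have ia: "set_integrable lborel {0<..<1} a" by (rule set_integrable_continuous_bounded[OF ca ba])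
  have ib: "set_integrable lborel {0<..<1} b'" by (rule set_integrable_continuous_bounded[OF cb' bb])
  have dh: "(h has_real_derivative (a t + b' t)) (at t)" if "t \<in> {0<..<1}" for t
    unfolding h_def a_def b'_def M_def by (rule spread_derivative[OF d c that])
  obtain \<epsilon> where \<epsilon>: "0 < \<epsilon>" "\<epsilon> < 1/2" "\<And>t z. t \<in> {0<..<1} \<Longrightarrow> t < \<epsilon> \<or> 1 - \<epsilon> < t \<Longrightarrow> norm z \<le> norm x + norm B \<Longrightarrow> \<phi> (t, z) = 0"
    using test_function_vanishes_near_ends[OF supp] by metis
  have hz: "h t = 0" if t: "t \<in> {0<..<1}" "t < \<epsilon> \<or> 1 - \<epsilon> < t" for t
  proof -
    have "AE y in spread_law. \<phi> (t, ?X t y) = 0"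
      using AE_spread_law
    proof eventually_elim
      case (elim y)
      then show ?case using t by (intro \<epsilon>(3) norm_spread_path_le) auto
    qed
    then show ?thesis unfolding h_def by (rule integral_eq_zero_AE)
  qed
  have "(\<integral>t\<in>{0<..<1}. (a t + b' t) \<partial>lborel) = 0"
    by (subst integral_derivative_constant_near_ends[OF dh _ \<epsilon>(1,2), where A = 0 and C = 0])
      (use hz \<epsilon>(1,2) in \<open>auto intro!: continuous_intros ca cb'\<close>)
  then have "(\<integral>t\<in>{0<..<1}. a t \<partial>lborel) = - (\<integral>t\<in>{0<..<1}. b' t \<partial>lborel)"
    using set_integral_add(2)[OF ia ib] by simp
  moreover have "(\<integral>t\<in>{0<..<1}. (\<integral>z. \<phi>t (t, z) \<partial>spread_at spread_law x B t) \<partial>lborel) = (\<integral>t\<in>{0<..<1}. a t \<partial>lborel)"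
    by (rule set_lebesgue_integral_cong) (use 1 in auto)
  moreover have "(\<integral>t\<in>{0<..<1}. mat_integral borel (\<lambda>E. measure (spread_at flux_law x B t) E *\<^sub>R M) (\<lambda>z. (1/2) *\<^sub>R H (t, z)) \<partial>lborel) = (\<integral>t\<in>{0<..<1}. b' t \<partial>lborel)"
    by (rule set_lebesgue_integral_cong) (use 2 in auto)
  ultimately show ?thesis by simp
qed

lemma spread_fokker_planck:
  fixes x :: "real^'d" and B :: "real^'d^'d"
  defines "M \<equiv> B ** transpose B"
  shows "fokker_planck (spread_cyl spread_law x B) (\<lambda>E. measure (spread_cyl flux_law x B) E *\<^sub>R M)
     (spread_at spread_law x B) (\<lambda>t E. measure (spread_at flux_law x B t) E *\<^sub>R M)"
    (is "fokker_planck ?\<rho> ?\<Lambda> ?r ?l")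
proof -
  interpret SL: prob_space "spread_law :: (real^'d) measure" by (rule prob_space_spread_law)
  interpret FL: finite_measure "flux_law :: (real^'d) measure" by (rule finite_measure_flux_law)
  note S = SL.finite_measure_axioms sets_spread_law
  note F = FL.finite_measure_axioms sets_flux_law
  have M: "M \<in> psd_mats" unfolding M_def by (rule mult_transpose_psd)
  have probr: "prob_space (?r t)" for t
    unfolding spread_at_def by (rule SL.prob_space_distr[OF path_measurable_Q[OF S]])
  let ?N = "restrict_space lborel {0<..<1::real}"
  have mS: "cyl_path x B \<in> ?N \<Otimes>\<^sub>M spread_law \<rightarrow>\<^sub>M cylinder_borel" by (rule cyl_path_measurable[OF S]) simp
  interpret N: prob_space ?N
    by (intro prob_spaceI) (simp add: space_restrict_space emeasure_restrict_space)
  interpret P: pair_prob_space ?N "spread_law :: (real^'d) measure" ..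
  have P2: "?\<rho> \<in> P2_cylinder"
    unfolding P2_cylinder_def
  proof (intro CollectI conjI)
    show "sets ?\<rho> = sets cylinder_borel" by (simp add: spread_cyl_def)
    show "prob_space ?\<rho>" unfolding spread_cyl_def by (rule P.prob_space_distr[OF mS])
    have "(\<lambda>z. (norm (snd z))\<^sup>2) \<in> borel_measurable (borel :: (real \<times> (real^'d)) measure)"
      by (intro borel_measurable_continuous_onI continuous_intros)
    then have msnd: "(\<lambda>z. ennreal ((norm (snd z))\<^sup>2)) \<in> borel_measurable (cylinder_borel :: (real \<times> (real^'d)) measure)"
      by (intro measurable_restrict_space1 measurable_compose[OF _ measurable_ennreal])
    have "(\<integral>\<^sup>+z. ennreal ((norm (snd z))\<^sup>2) \<partial>?\<rho>) = (\<integral>\<^sup>+p. ennreal ((norm (snd (cyl_path x B p)))\<^sup>2) \<partial>(?N \<Otimes>\<^sub>M spread_law))"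
      unfolding spread_cyl_def by (rule nn_integral_distr[OF mS]) (simp add: msnd)
    also have "\<dots> = (\<integral>\<^sup>+t. \<integral>\<^sup>+y. ennreal ((norm (snd (cyl_path x B (t, y))))\<^sup>2) \<partial>spread_law \<partial>?N)"
      by (rule SL.nn_integral_fst[symmetric]) (rule measurable_compose[OF mS msnd])
    also have "\<dots> \<le> (\<integral>\<^sup>+t. \<integral>\<^sup>+y. ennreal ((norm x + norm B)\<^sup>2) \<partial>(spread_law :: (real^'d) measure) \<partial>?N)"
    proof (rule nn_integral_mono, rule nn_integral_mono_AE)
      fix t assume "t \<in> space ?N"
      then have t: "0 \<le> t" "t \<le> 1" by (auto simp: space_restrict_space)
      show "AE y in spread_law. ennreal ((norm (snd (cyl_path x B (t, y))))\<^sup>2) \<le> ennreal ((norm x + norm B)\<^sup>2)"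
        using AE_spread_law
      proof eventually_elim
        case (elim y)
        show ?case using norm_spread_path_le[OF t elim, of x B]
          by (intro ennreal_leI power_mono) (auto simp: cyl_path_def)
      qed
    qed
    also have "\<dots> = ennreal ((norm x + norm B)\<^sup>2)"
      by (simp add: SL.emeasure_space_1 emeasure_restrict_space del: space_spread_law)
    also have "\<dots> < top" by simp
    finally show "(\<integral>\<^sup>+z. ennreal ((norm (snd z))\<^sup>2) \<partial>?\<rho>) < top" .
  qed
  have \<Lambda>: "?\<Lambda> \<in> mat_measures cylinder_borel"
    by (rule scaled_measure_mat_measures[OF finite_measure_spread_cyl[OF F] _ M]) (simp add: spread_cyl_def)
  have l: "?l t \<in> mat_measures borel" for t
    by (rule scaled_measure_mat_measures[OF finite_measure_spread_at[OF F] sets_spread_at[OF F] M])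
  have dr: "disintegrates ?\<rho> ?r"
    unfolding disintegrates_def
    using probr emeasure_spread_at_set_measurable[OF S] emeasure_spread_cyl[OF S] sets_spread_at[OF S] by auto
  have mF: "(\<lambda>t. measure (spread_at flux_law x B t) (Pair t -` E)) \<in> borel_measurable (restrict_space borel {0<..<1})"
    if "E \<in> sets cylinder_borel" for E
    unfolding measure_def using emeasure_spread_at_measurable[OF F that] by measurable
  have dl: "mat_disintegrates ?\<Lambda> ?l"
    unfolding mat_disintegrates_def
  proof (intro conjI ballI l)
    fix A :: "(real^'d) set" assume A: "A \<in> sets borel"
    have "(\<lambda>t. measure (spread_at flux_law x B t) A) \<in> borel_measurable (restrict_space borel {0<..<1})"
      unfolding measure_def using emeasure_spread_at_set_measurable[OF F A] by measurable
    then show "(\<lambda>t. ?l t A) \<in> borel_measurable (restrict_space borel {0<..<1})"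
      by (intro borel_measurable_scaleR) auto
  next
    fix E assume E: "E \<in> sets (cylinder_borel :: (real \<times> (real^'d)) measure)"
    let ?m = "\<lambda>t. measure (spread_at flux_law x B t) (Pair t -` E)"
    have mi: "(\<lambda>t. ?m t * indicator {0<..<1} t) \<in> borel_measurable borel"
      using mF[OF E] by (subst (asm) borel_measurable_restrict_space_iff) (auto simp: mult.commute)
    have mle: "?m t \<le> measure (flux_law :: (real^'d) measure) UNIV" for t
    proof -
      interpret X: finite_measure "spread_at flux_law x B t" by (rule finite_measure_spread_at[OF F])
      have "?m t \<le> measure (spread_at flux_law x B t) (space (spread_at flux_law x B t))" by (rule X.bounded_measure)
      also have "\<dots> = measure (flux_law :: (real^'d) measure) UNIV"
        using emeasure_spread_at_UNIV[OF F, of x B t] by (simp add: spread_at_def measure_def)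
      finally show ?thesis .
    qed
    have int: "integrable lborel (\<lambda>t. ?m t * indicator {0<..<1} t)"
    proof (rule Bochner_Integration.integrable_bound[where f = "\<lambda>t. measure (flux_law :: (real^'d) measure) UNIV * indicator {0<..<1} t"])
      show "integrable lborel (\<lambda>t. measure (flux_law :: (real^'d) measure) UNIV * indicator {0<..<1::real} t)" by simp
    qed (use mi mle in \<open>auto simp: indicator_def\<close>)
    have eq: "indicator {0<..<1} t *\<^sub>R ?l t (Pair t -` E) = (?m t * indicator {0<..<1} t) *\<^sub>R M" for t
      by (simp add: mult.commute)
    show "set_integrable lborel {0<..<1} (\<lambda>t. ?l t (Pair t -` E))"
      unfolding set_integrable_def eq by (rule integrable_scaleR_left[OF int])
    have "emeasure (spread_cyl flux_law x B) E = (\<integral>\<^sup>+t. ennreal (?m t * indicator {0<..<1} t) \<partial>lborel)"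
      unfolding emeasure_spread_cyl[OF F E]
    proof (intro nn_integral_cong)
      fix t
      interpret X: finite_measure "spread_at flux_law x B t" by (rule finite_measure_spread_at[OF F])
      show "emeasure (spread_at flux_law x B t) (Pair t -` E) * indicator {0<..<1} t = ennreal (?m t * indicator {0<..<1} t)"
        by (auto simp: indicator_def X.emeasure_eq_measure)
    qed
    also have "\<dots> = ennreal (\<integral>t. ?m t * indicator {0<..<1} t \<partial>lborel)"
      by (rule nn_integral_eq_integral[OF int]) simp
    finally have "measure (spread_cyl flux_law x B) E = (\<integral>t. ?m t * indicator {0<..<1} t \<partial>lborel)"
      by (simp add: measure_def)
    then show "?\<Lambda> E = (\<integral>t\<in>{0<..<1}. ?l t (Pair t -` E) \<partial>lborel)"
      unfolding set_lebesgue_integral_def eq using integral_scaleR_left[OF int, of M] by simp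
  qed
  have etv: "emeasure (total_var borel (?l t)) UNIV = ennreal (norm M) * emeasure (flux_law :: (real^'d) measure) UNIV" for t
    unfolding total_var_scaled_measure[OF finite_measure_spread_at[OF F] sets_spread_at[OF F] M]
    using emeasure_spread_at_UNIV[OF F, of x B t]
    by (subst emeasure_density) (auto simp: spread_at_def)
  have fin: "(\<integral>\<^sup>+t\<in>{0<..<1}. emeasure (total_var borel (?l t)) UNIV \<partial>lborel) < top"
    unfolding etv FL.emeasure_eq_measure
    by (simp add: nn_integral_cmult_indicator ennreal_mult_less_top)
  show ?thesis unfolding fokker_planck_def
    using P2 \<Lambda> dr dl fin spread_weak_equation[of _ _ _ x B, folded M_def] by blast
qed

lemma P2_spread_at:
  fixes x :: "real^'d"
  assumes "t \<in> {0..1}" shows "spread_at spread_law x B t \<in> P2"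
proof -
  interpret SL: prob_space "spread_law :: (real^'d) measure" by (rule prob_space_spread_law)
  note S = SL.finite_measure_axioms sets_spread_law
  have "(\<integral>\<^sup>+z. ennreal ((norm z)\<^sup>2) \<partial>spread_at spread_law x B t) = (\<integral>\<^sup>+y. ennreal ((norm (spread_path x B t y))\<^sup>2) \<partial>spread_law)"
    unfolding spread_at_def by (rule nn_integral_distr[OF path_measurable_Q[OF S]]) simp
  also have "\<dots> \<le> (\<integral>\<^sup>+y. ennreal ((norm x + norm B)\<^sup>2) \<partial>(spread_law :: (real^'d) measure))"
  proof (rule nn_integral_mono_AE)
    show "AE y in spread_law. ennreal ((norm (spread_path x B t y))\<^sup>2) \<le> ennreal ((norm x + norm B)\<^sup>2)"
      using AE_spread_law
    proof eventually_elim
      case (elim y)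
      show ?case using norm_spread_path_le[OF _ _ elim, of t x B] assms
        by (intro ennreal_leI power_mono) auto
    qed
  qed
  also have "\<dots> = ennreal ((norm x + norm B)\<^sup>2)" by (simp add: SL.emeasure_space_1 del: space_spread_law)
  also have "\<dots> < top" by simp
  finally show ?thesis
    unfolding P2_def using SL.prob_space_distr[OF path_measurable_Q[OF S]] by (simp add: spread_at_def)
qed

lemma narrowly_continuous_spread: "narrowly_continuous (spread_at spread_law x B)" for x :: "real^'d"
  unfolding narrowly_continuous_def
proof
  fix g :: "real^'d \<Rightarrow> real" assume g: "g \<in> bcontfun"
  interpret SL: prob_space "spread_law :: (real^'d) measure" by (rule prob_space_spread_law)
  note S = SL.finite_measure_axioms sets_spread_law
  have gc: "continuous_on UNIV g" using g by (simp add: bcontfun_def)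
  obtain K where K: "\<And>z. norm (g z) \<le> K" using g by (auto simp: bcontfun_def bounded_iff)
  have "continuous_on {0..1} (\<lambda>t. \<integral>y. g (spread_path x B t y) \<partial>spread_law)"
  proof (rule continuous_on_integral_bounded[OF S(1), where K = K])
    show "(\<lambda>y. g (spread_path x B t y)) \<in> borel_measurable spread_law" for t
      using measurable_compose[OF path_measurable_Q[OF S] borel_measurable_continuous_onI[OF gc]] .
    show "AE y in spread_law. continuous_on {0..1} (\<lambda>t. g (spread_path x B t y))"
      by (intro AE_I2 continuous_on_compose2[OF gc] continuous_intros) auto
  qed (use K in auto)
  then show "continuous_on {0..1} (\<lambda>t. \<integral>z. g z \<partial>spread_at spread_law x B t)"
    by (simp add: integral_spread_at[OF S borel_measurable_continuous_onI[OF gc]])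
qed

lemma spread_at_0: "spread_at spread_law x B 0 = return borel x" for x :: "real^'d"
proof -
  interpret SL: prob_space "spread_law :: (real^'d) measure" by (rule prob_space_spread_law)
  have "spread_path x B 0 = (\<lambda>_. x)" by (simp add: spread_path_def fun_eq_iff)
  then show ?thesis by (simp add: spread_at_def SL.distr_const)
qed

text \<open>The polar density of the matrix measure is constantly \<open>sgn M\<close>, so the action is explicit and
homogeneity combines \<open>norm M\<close> and \<open>f (sgn M)\<close> to \<open>f M\<close>.\<close>
lemma dyn_cost_spread_le:
  fixes f :: "real^'d^'d \<Rightarrow> ennreal" and x :: "real^'d"
  assumes hom: "pos_homogeneous f"
  shows "G_cost f x (spread_at spread_law x B 1) \<le> ennreal (measure (flux_law :: (real^'d) measure) UNIV) * f (B ** transpose B)"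
proof -
  define M where "M = B ** transpose B"
  interpret FL: finite_measure "flux_law :: (real^'d) measure" by (rule finite_measure_flux_law)
  note F = FL.finite_measure_axioms sets_flux_law
  have M: "M \<in> psd_mats" unfolding M_def by (rule mult_transpose_psd)
  let ?l = "\<lambda>t E. measure (spread_at flux_law x B t) E *\<^sub>R M"
  note sc = finite_measure_spread_at[OF F] sets_spread_at[OF F] M
  have sgnM: "sgn M \<in> sym_mats" using scaleR_psd[OF M, of "inverse (norm M)"] by (simp add: sgn_div_norm psd_mats_def)
  have "norm M *\<^sub>R sgn M = M" by (cases "M = 0") (simp_all add: sgn_div_norm)
  then have fM: "f M = ennreal (norm M) * f (sgn M)"
    using hom sgnM unfolding pos_homogeneous_def by (metis norm_ge_zero)
  have inner: "(\<integral>\<^sup>+z. f (polar_density borel (?l t) z) \<partial>total_var borel (?l t)) = ennreal (measure (flux_law :: (real^'d) measure) UNIV) * f M" for t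
  proof -
    have "(\<integral>\<^sup>+z. f (polar_density borel (?l t) z) \<partial>total_var borel (?l t)) = (\<integral>\<^sup>+z. f (sgn M) \<partial>total_var borel (?l t))"
    proof (rule nn_integral_cong_AE)
      show "AE z in total_var borel (?l t). f (polar_density borel (?l t) z) = f (sgn M)"
        using AE_polar_density_scaled_measure[OF sc] by eventually_elim simp
    qed
    also have "\<dots> = f (sgn M) * emeasure (total_var borel (?l t)) (space (total_var borel (?l t)))" by simp
    also have "emeasure (total_var borel (?l t)) (space (total_var borel (?l t))) = ennreal (norm M) * emeasure (flux_law :: (real^'d) measure) UNIV"
      unfolding total_var_scaled_measure[OF sc] using emeasure_spread_at_UNIV[OF F, of x B t]
      by (subst emeasure_density) (auto simp: spread_at_def)
    finally show ?thesis by (simp add: fM FL.emeasure_eq_measure mult_ac)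
  qed
  have "action f ?l = ennreal (measure (flux_law :: (real^'d) measure) UNIV) * f M"
    unfolding action_def inner by (simp add: nn_integral_cmult_indicator)
  moreover have "G_cost f x (spread_at spread_law x B 1) \<le> action f ?l"
    unfolding G_cost_def dyn_cost_def
  proof (rule Inf_lower, rule CollectI, intro exI conjI)
    show "fokker_planck (spread_cyl spread_law x B) (\<lambda>E. measure (spread_cyl flux_law x B) E *\<^sub>R M) (spread_at spread_law x B) ?l"
      unfolding M_def by (rule spread_fokker_planck)
  qed (auto simp: narrowly_continuous_spread P2_spread_at spread_at_0)
  ultimately show ?thesis by (simp add: M_def)
qed

section \<open>Factorization of positive semidefinite matrices\<close>

lemma psd_zero_diagonal:
  assumes A: "A \<in> psd_mats" and z: "A $ s $ s = 0" shows "A $ s $ j = 0"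
proof (rule ccontr)
  assume n: "A $ s $ j \<noteq> 0"
  have sym: "A $ k $ l = A $ l $ k" for k l
    using A by (simp add: psd_mats_def sym_mats_def transpose_def vec_eq_iff)
  have form: "axis k 1 \<bullet> (A *v axis l 1) = A $ k $ l" for k l
    by (simp add: inner_axis' matrix_vector_mult_basis column_def)
  \<comment> \<open>without the quadratic term in \<open>t\<close> the form takes the value -1\<close>
  define t where "t = - (A $ j $ j + 1) / (2 * A $ s $ j)"
  have "0 \<le> (axis j 1 + t *\<^sub>R axis s 1) \<bullet> (A *v (axis j 1 + t *\<^sub>R axis s 1))"
    using A by (simp add: psd_mats_def)
  also have "\<dots> = A $ j $ j + 2 * t * A $ s $ j"
    by (simp add: matrix_vector_right_distrib matrix_vector_mult_scaleR inner_add_left inner_add_right form z sym[of j s])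
  also have "\<dots> = -1"
  proof -
    have "2 * t * A $ s $ j = - (A $ j $ j + 1)" using n by (simp add: t_def field_simps)
    then show ?thesis by simp
  qed
  finally show False by simp
qed

text \<open>Elimination with the pivot \<open>s\<close>: subtracting the rank-one matrix built from column \<open>s\<close> clears that row
and column and keeps the matrix positive semidefinite (completing the square). The removed part
becomes column \<open>s\<close> of \<open>B\<close>.\<close>
lemma psd_factorization_on:
  fixes A :: "real^'d^'d"
  assumes "finite S" "A \<in> psd_mats" "\<And>i. i \<notin> S \<Longrightarrow> A $ i = 0"
  shows "\<exists>B. A = B ** transpose B \<and> (\<forall>k. k \<notin> S \<longrightarrow> column k B = 0)"
  using assms
proof (induction S arbitrary: A rule: finite_induct)
  case empty
  then have "A = 0" by (simp add: vec_eq_iff)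
  then show ?case by (intro exI[of _ 0]) (simp add: matrix_matrix_mult_def column_def vec_eq_iff)
next
  case (insert s S)
  have sym: "A $ k $ l = A $ l $ k" for k l
    using insert.prems(1) by (simp add: psd_mats_def sym_mats_def transpose_def vec_eq_iff)
  have q: "0 \<le> x \<bullet> (A *v x)" for x using insert.prems(1) by (simp add: psd_mats_def)
  show ?case
  proof (cases "A $ s $ s = 0")
    case True
    then have "A $ s = 0" using psd_zero_diagonal[OF insert.prems(1) True] by (simp add: vec_eq_iff)
    then have "\<And>i. i \<notin> S \<Longrightarrow> A $ i = 0" using insert.prems(2) by (metis insert_iff)
    from insert.IH[OF insert.prems(1) this] show ?thesis by blast
  next
    case False
    define a where "a = A $ s $ s"
    have "axis s 1 \<bullet> (A *v axis s 1) = a"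
      by (simp add: inner_axis' matrix_vector_mult_basis column_def a_def)
    then have a: "a > 0" using q[of "axis s 1"] False by (simp add: a_def)
    define A' where "A' = (\<chi> i j. A $ i $ j - A $ i $ s * A $ j $ s / a)"
    have "x \<bullet> (A' *v x) \<ge> 0" for x
    proof -
      define c where "c = (\<Sum>i\<in>UNIV. A $ i $ s * x $ i)"
      have xAe: "x \<bullet> (A *v axis s 1) = c"
        by (simp add: matrix_vector_mult_basis column_def inner_vec_def c_def mult.commute)
      have eAx: "axis s 1 \<bullet> (A *v x) = c"
        by (simp add: inner_axis' matrix_vector_mult_def c_def sym[of s])
      have eAe: "axis s 1 \<bullet> (A *v axis s 1) = a"
        by (simp add: inner_axis' matrix_vector_mult_basis column_def a_def)
      have "x \<bullet> (A' *v x) = (\<Sum>i\<in>UNIV. \<Sum>j\<in>UNIV. x $ i * (A $ i $ j * x $ j) - (A $ i $ s * x $ i) * (A $ j $ s * x $ j) / a)"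
        by (simp add: inner_vec_def matrix_vector_mult_def A'_def sum_distrib_left algebra_simps)
      also have "\<dots> = x \<bullet> (A *v x) - c * c / a"
      proof -
        have "(\<Sum>i\<in>UNIV. \<Sum>j\<in>UNIV. x $ i * (A $ i $ j * x $ j)) = x \<bullet> (A *v x)"
          by (simp add: inner_vec_def matrix_vector_mult_def sum_distrib_left)
        moreover have "(\<Sum>i\<in>UNIV. \<Sum>j\<in>UNIV. (A $ i $ s * x $ i) * (A $ j $ s * x $ j) / a) = c * c / a"
          by (simp only: c_def sum_product sum_divide_distrib)
        ultimately show ?thesis by (simp only: sum_subtractf)
      qed
      also have "\<dots> = (x - (c / a) *\<^sub>R axis s 1) \<bullet> (A *v (x - (c / a) *\<^sub>R axis s 1))"
        using a by (simp add: matrix_vector_mult_diff_distrib matrix_vector_mult_scaleR inner_diff_left inner_diff_right xAe eAx eAe)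
      finally show ?thesis using q[of "x - (c / a) *\<^sub>R axis s 1"] by simp
    qed
    then have psd': "A' \<in> psd_mats"
      by (auto simp: psd_mats_def sym_mats_def transpose_def vec_eq_iff A'_def sym mult.commute)
    have "A' $ i = 0" if "i \<notin> S" for i
    proof (cases "i = s")
      case True
      have "A' $ s $ j = 0" for j using a sym[of s j] by (simp add: A'_def a_def[symmetric])
      then show ?thesis by (simp add: True vec_eq_iff)
    next
      case False
      then have "A $ i = 0" using that insert.prems(2) by simp
      then show ?thesis by (simp add: A'_def vec_eq_iff)
    qed
    from insert.IH[OF psd' this] obtain B' where B': "A' = B' ** transpose B'" "\<And>k. k \<notin> S \<Longrightarrow> column k B' = 0" by blast
    define B where "B = (\<chi> i k. if k = s then A $ i $ s / sqrt a else B' $ i $ k)"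
    have B's: "B' $ i $ s = 0" for i using B'(2)[OF insert.hyps(2)] by (simp add: column_def vec_eq_iff)
    have "(B ** transpose B) $ i $ j = A $ i $ j" for i j
    proof -
      have "(B ** transpose B) $ i $ j = (\<Sum>k\<in>UNIV. B $ i $ k * B $ j $ k)"
        by (simp add: matrix_matrix_mult_def transpose_def)
      also have "\<dots> = (\<Sum>k\<in>UNIV. (if k = s then A $ i $ s * A $ j $ s / a else 0) + B' $ i $ k * B' $ j $ k)"
        using a by (intro sum.cong) (auto simp: B_def B's)
      also have "\<dots> = A $ i $ s * A $ j $ s / a + A' $ i $ j"
        by (simp add: sum.distrib B'(1) matrix_matrix_mult_def transpose_def)
      finally show ?thesis by (simp add: A'_def)
    qed
    then have "A = B ** transpose B" by (simp add: vec_eq_iff)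
    moreover have "column k B = 0" if "k \<notin> insert s S" for k
      using that B'(2)[of k] by (auto simp: column_def B_def vec_eq_iff)
    ultimately show ?thesis by blast
  qed
qed

lemma psd_factorization: "A \<in> psd_mats \<Longrightarrow> \<exists>B :: real^'d^'d. A = B ** transpose B" for A :: "real^'d^'d"
proof -
  assume "A \<in> psd_mats"
  then have "\<exists>B :: real^'d^'d. A = B ** transpose B \<and> (\<forall>k. k \<notin> UNIV \<longrightarrow> column k B = 0)"
    by (intro psd_factorization_on) auto
  then show ?thesis by blast
qed

section \<open>Both sides as families of inequalities\<close>

lemma fenchel_conj_le_0_iff:
  "fenchel_conj f A \<le> 0 \<longleftrightarrow> (\<forall>M\<in>sym_mats. ereal (A \<bullet> M) \<le> enn2ereal (f M))"
proof -
  have "ereal a - y \<le> 0 \<longleftrightarrow> ereal a \<le> y" for a y by (cases y) auto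
  then show ?thesis by (simp add: fenchel_conj_def SUP_le_iff)
qed

lemma fenchel_conj_nonneg:
  assumes "pos_homogeneous f" shows "0 \<le> fenchel_conj f A"
proof -
  have s0: "0 \<in> sym_mats" by (simp add: sym_mats_def transpose_def vec_eq_iff)
  have "f (0 *\<^sub>R 0) = ennreal 0 * f 0" using assms s0 unfolding pos_homogeneous_def by blast
  then have "f 0 = 0" by simp
  then have eq: "ereal (A \<bullet> 0) - enn2ereal (f 0) = 0" by (simp add: zero_ennreal.rep_eq)
  show ?thesis
    using SUP_upper[OF s0, of "\<lambda>M. ereal (A \<bullet> M) - enn2ereal (f M)"] unfolding eq fenchel_conj_def .
qed

lemma
  fixes u :: "real^'d \<Rightarrow> real"
  shows lsc_on_continuous: "continuous_on UNIV u \<Longrightarrow> lsc_on UNIV (\<lambda>x. ereal (u x))"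
    and usc_on_continuous: "continuous_on UNIV u \<Longrightarrow> usc_on UNIV (\<lambda>x. ereal (u x))"
proof -
  have *: "((\<lambda>x. ereal (u x)) \<longlongrightarrow> ereal (u x)) (at x)" if "continuous_on UNIV u" for x
    using that by (auto simp: continuous_on_def)
  show "continuous_on UNIV u \<Longrightarrow> lsc_on UNIV (\<lambda>x. ereal (u x))"
    unfolding lsc_on_def using lim_imp_Liminf[OF _ *] by simp
  show "continuous_on UNIV u \<Longrightarrow> usc_on UNIV (\<lambda>x. ereal (u x))"
    unfolding usc_on_def using lim_imp_Limsup[OF _ *] by simp
qed

text \<open>The supersolution property with the conjugate unfolded. The truncation of negative reals to 0 in
the extended nonnegative reals loses nothing, since \<open>f\<close> is nonnegative.\<close>
definition touch_bound :: "(real^'d^'d \<Rightarrow> ennreal) \<Rightarrow> (real^'d \<Rightarrow> real) \<Rightarrow> bool" where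
  "touch_bound f u \<longleftrightarrow> (\<forall>\<phi> H x M. C2_with_hessian \<phi> H \<longrightarrow> local_minimum (\<lambda>y. u y - \<phi> y) x \<longrightarrow>
     M \<in> sym_mats \<longrightarrow> ennreal (1/2 * (M \<bullet> H x)) \<le> f M)"

lemma ennreal_le_iff_ereal: "ennreal a \<le> y \<longleftrightarrow> ereal a \<le> enn2ereal y"
proof (cases "0 \<le> a")
  case True
  then show ?thesis by (simp add: less_eq_ennreal.rep_eq)
next
  case False
  then have "ereal a \<le> enn2ereal y" by (intro order_trans[OF _ enn2ereal_nonneg]) simp
  then show ?thesis using False by (simp add: ennreal_neg)
qed

lemma viscosity_solution_iff_touch_bound:
  fixes u :: "real^'d \<Rightarrow> real"
  assumes "pos_homogeneous f" "continuous_on UNIV u"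
  shows "viscosity_solution (\<lambda>A. - fenchel_conj f ((1/2) *\<^sub>R A)) u \<longleftrightarrow> touch_bound f u"
proof -
  have "0 \<le> - fenchel_conj f ((1/2) *\<^sub>R A) \<longleftrightarrow> (\<forall>M\<in>sym_mats. ennreal (1/2 * (M \<bullet> A)) \<le> f M)" for A
    by (simp add: fenchel_conj_le_0_iff ennreal_le_iff_ereal inner_commute)
  then have "viscosity_supersolution (\<lambda>A. - fenchel_conj f ((1/2) *\<^sub>R A)) u \<longleftrightarrow> touch_bound f u"
    unfolding viscosity_supersolution_def touch_bound_def
    using lsc_on_continuous[OF assms(2)] by auto
  moreover have "viscosity_subsolution (\<lambda>A. - fenchel_conj f ((1/2) *\<^sub>R A)) u"
    unfolding viscosity_subsolution_def
    using usc_on_continuous[OF assms(2)] fenchel_conj_nonneg[OF assms(1)] by auto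
  ultimately show ?thesis by (simp add: viscosity_solution_def)
qed

lemma completion_integral_P2:
  fixes u :: "real^'d \<Rightarrow> real"
  assumes "p \<in> P2" "continuous_on UNIV u"
  shows "(\<integral>y. u y \<partial>completion p) = (\<integral>y. u y \<partial>p)"
proof (rule integral_completion)
  show "u \<in> borel_measurable p"
    using assms by (simp add: P2_def measurable_cong_sets[of p borel] borel_measurable_continuous_onI)
qed

lemma G_transform_ge_iff:
  fixes u :: "real^'d \<Rightarrow> real"
  assumes u: "continuous_on UNIV u"
  shows "ereal (- u x) \<le> G_transform f (\<lambda>y. - u y) x \<longleftrightarrow>
     (\<forall>p\<in>P2. ennreal ((\<integral>y. u y \<partial>p) - u x) \<le> G_cost f x p)"
proof -
  have "ereal (- u x) \<le> ereal (\<integral>y. - u y \<partial>completion p) + enn2ereal (G_cost f x p) \<longleftrightarrow>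
     ennreal ((\<integral>y. u y \<partial>p) - u x) \<le> G_cost f x p" if "p \<in> P2" for p
  proof -
    have e: "(\<integral>y. - u y \<partial>completion p) = - (\<integral>y. u y \<partial>p)"
      using completion_integral_P2[OF that u] by simp
    have "ereal (- u x) \<le> ereal (- I) + y \<longleftrightarrow> ereal (I - u x) \<le> y" for I y by (cases y) auto
    then show ?thesis unfolding e ennreal_le_iff_ereal .
  qed
  then show ?thesis by (simp add: G_transform_def le_INF_iff)
qed

text \<open>The degenerate spreading with \<open>B = 0\<close> stays at \<open>x\<close> and has cost \<open>f 0 = 0\<close>.\<close>
lemma G_transform_le:
  fixes u :: "real^'d \<Rightarrow> real"
  assumes "pos_homogeneous f" and u: "continuous_on UNIV u"
  shows "G_transform f (\<lambda>y. - u y) x \<le> ereal (- u x)"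
proof -
  interpret SL: prob_space "spread_law :: (real^'d) measure" by (rule prob_space_spread_law)
  have "spread_path x 0 1 = (\<lambda>_. x)" by (simp add: spread_path_def fun_eq_iff)
  then have r: "spread_at spread_law x 0 1 = return borel x" by (simp add: spread_at_def SL.distr_const)
  have p: "return borel x \<in> P2" using P2_spread_at[of 1 x 0] r by simp
  have s0: "(0::real^'d^'d) \<in> sym_mats" by (simp add: sym_mats_def transpose_def vec_eq_iff)
  have "f (0 *\<^sub>R 0) = ennreal 0 * f 0" using assms(1) s0 unfolding pos_homogeneous_def by blast
  then have "f 0 = 0" by simp
  moreover have "(0::real^'d^'d) ** transpose 0 = 0" by (simp add: matrix_matrix_mult_def vec_eq_iff)
  ultimately have G: "G_cost f x (return borel x) = 0"
    using dyn_cost_spread_le[OF assms(1), of x 0] r by simp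
  have "G_transform f (\<lambda>y. - u y) x \<le> ereal (\<integral>y. - u y \<partial>completion (return borel x)) + enn2ereal (G_cost f x (return borel x))"
    unfolding G_transform_def by (rule INF_lower[OF p])
  also have "(\<integral>y. - u y \<partial>completion (return borel x)) = - u x"
    using completion_integral_P2[OF p u] borel_measurable_continuous_onI[OF u] by (simp add: integral_return)
  finally show ?thesis by (simp add: G zero_ennreal.rep_eq)
qed

section \<open>From the cost bound to the touching bound\<close>

lemma bounded_on_compact:
  fixes F :: "real^'d \<Rightarrow> real"
  assumes "continuous_on UNIV F" "compact S"
  shows "\<exists>L. \<forall>z\<in>S. \<bar>F z\<bar> \<le> L"
proof -
  have "compact (F ` S)" by (intro compact_continuous_image continuous_on_subset[OF assms(1)] assms(2)) simp
  then show ?thesis by (auto dest!: compact_imp_bounded simp: bounded_iff)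
qed

text \<open>If the bound failed at \<open>x\<close>, then \<open>1/2 M : H\<close> would exceed a constant \<open>c' > f M\<close> near \<open>x\<close>. Along the
spreading solution with the matrix \<open>s B\<close>, confined to that neighbourhood, \<open>\<integral> \<phi> dr\<^sub>t\<close> would gain more
than \<open>s\<^sup>2 c' m0\<close> over a unit of time, and so would \<open>\<integral> u dr\<^sub>t\<close>, at the price \<open>s\<^sup>2 m0 f M\<close>.\<close>
lemma touch_bound_if_G_bound:
  fixes f :: "real^'d^'d \<Rightarrow> ennreal" and u :: "real^'d \<Rightarrow> real"
  assumes hom: "pos_homogeneous f" and dom: "edom f \<subseteq> psd_mats" and u: "u \<in> bcontfun"
    and G: "\<And>x p. p \<in> P2 \<Longrightarrow> ennreal ((\<integral>y. u y \<partial>p) - u x) \<le> G_cost f x p"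
  shows "touch_bound f u"
  unfolding touch_bound_def
proof (intro allI impI)
  fix \<phi> H x and M :: "real^'d^'d"
  assume C2: "C2_with_hessian \<phi> H" and loc: "local_minimum (\<lambda>y. u y - \<phi> y) x" and M: "M \<in> sym_mats"
  show "ennreal (1/2 * (M \<bullet> H x)) \<le> f M"
  proof (cases "f M < top")
    case True
    then have "M \<in> edom f" using M by (simp add: edom_def)
    then obtain B :: "real^'d^'d" where B: "M = B ** transpose B" using dom psd_factorization by blast
    define c where "c = enn2real (f M)"
    have c: "f M = ennreal c" "0 \<le> c" using True by (auto simp: c_def)
    have uc: "continuous_on UNIV u" using u by (simp add: bcontfun_def)
    obtain K where K: "\<And>y. \<bar>u y\<bar> \<le> K" using u by (auto simp: bcontfun_def bounded_iff)
    obtain g where dp: "\<And>x. (\<phi> has_derivative (\<lambda>h. g x \<bullet> h)) (at x)"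
      and dg: "\<And>x. (g has_derivative (\<lambda>h. H x *v h)) (at x)" and cH: "continuous_on UNIV H"
      using C2 unfolding C2_with_hessian_def by auto
    have c\<phi>: "continuous_on UNIV \<phi>" using dp by (intro continuous_at_imp_continuous_on) (auto intro: has_derivative_continuous)
    have cg: "continuous_on UNIV g" using dg by (intro continuous_at_imp_continuous_on) (auto intro: has_derivative_continuous)
    interpret SL: prob_space "spread_law :: (real^'d) measure" by (rule prob_space_spread_law)
    interpret FL: finite_measure "flux_law :: (real^'d) measure" by (rule finite_measure_flux_law)
    note S = SL.finite_measure_axioms sets_spread_law
    define m0 where "m0 = measure (flux_law :: (real^'d) measure) UNIV"
    have m0: "m0 > 0" unfolding m0_def by (rule flux_mass_pos)
    have "1/2 * (M \<bullet> H x) \<le> c"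
    proof (rule ccontr)
      assume "\<not> ?thesis"
      then obtain c' where c': "c < c'" "c' < 1/2 * (M \<bullet> H x)" using dense by (meson not_le)
      obtain \<rho>1 where \<rho>1: "\<rho>1 > 0" "\<And>y. dist y x < \<rho>1 \<Longrightarrow> u x - \<phi> x \<le> u y - \<phi> y"
        using loc unfolding local_minimum_def eventually_nhds_metric by auto
      have "open {y. c' < 1/2 * (M \<bullet> H y)}" by (intro open_Collect_less continuous_intros cH)
      then obtain \<rho>2 where \<rho>2: "\<rho>2 > 0" "\<And>y. dist y x < \<rho>2 \<Longrightarrow> c' < 1/2 * (M \<bullet> H y)"
        using c'(2) unfolding open_dist by auto
      \<comment> \<open>small enough to keep the whole curve within both radii\<close>
      define s where "s = min \<rho>1 \<rho>2 / (norm B + 1)"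
      have s: "s > 0" using \<rho>1(1) \<rho>2(1) by (simp add: s_def add_nonneg_pos)
      define B' where "B' = s *\<^sub>R B"
      have "s * norm B < s * (norm B + 1)" using s by simp
      also have "\<dots> = min \<rho>1 \<rho>2" by (simp add: s_def add_nonneg_eq_0_iff)
      finally have nB: "norm B' < min \<rho>1 \<rho>2" using s by (simp add: B'_def)
      have BB: "B' ** transpose B' = s\<^sup>2 *\<^sub>R M"
        by (simp add: B'_def B matrix_matrix_mult_def transpose_def vec_eq_iff power2_eq_square sum_distrib_left mult_ac)
      have near: "dist (spread_path x B' t y) x < min \<rho>1 \<rho>2" if "0 \<le> t" "t \<le> 1" "norm y \<le> 1" for t y
        using norm_spread_path_le[OF that, of 0 B'] nB by (simp add: spread_path_def dist_norm)
      define h where "h t = (\<integral>y. \<phi> (spread_path x B' t y) \<partial>spread_law)" for t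
      have dh: "(h has_real_derivative 1/2 * (\<integral>y. (s\<^sup>2 *\<^sub>R M) \<bullet> H (spread_path x B' t y) \<partial>flux_law)) (at t)" if "t \<in> {0<..<1}" for t
      proof -
        have "((\<lambda>t. \<integral>y. (\<lambda>(t, y). \<phi> y) (t, spread_path x B' t y) \<partial>spread_law) has_real_derivative
          (\<integral>y. (\<lambda>(t, y). 0) (t, spread_path x B' t y) \<partial>(spread_law :: (real^'d) measure)) +
          1/2 * (\<integral>y. (B' ** transpose B') \<bullet> (\<lambda>(t, y). H y) (t, spread_path x B' t y) \<partial>flux_law)) (at t)"
        proof (rule spread_derivative[where g = "\<lambda>(t, y). g y"])
          show "continuous_on cylinder (\<lambda>(t, y). H y)" "continuous_on cylinder (\<lambda>(t, y). g y)"
            unfolding case_prod_unfold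
            by (intro continuous_on_compose2[OF cH] continuous_on_compose2[OF cg] continuous_intros; simp)+
        qed (use that dp dg in auto)
        then show ?thesis by (simp add: h_def[abs_def] BB)
      qed
      have ch: "continuous_on {0..1} h"
        unfolding h_def
      proof -
        obtain L where L: "\<And>z. z \<in> cball x (min \<rho>1 \<rho>2) \<Longrightarrow> \<bar>\<phi> z\<bar> \<le> L"
          using bounded_on_compact[OF c\<phi> compact_cball] by blast
        show "continuous_on {0..1} (\<lambda>t. \<integral>y. \<phi> (spread_path x B' t y) \<partial>spread_law)"
        proof (rule continuous_on_integral_bounded[OF S(1), where K = L])
          show "(\<lambda>y. \<phi> (spread_path x B' t y)) \<in> borel_measurable spread_law" for t
            using measurable_compose[OF path_measurable_Q[OF S] borel_measurable_continuous_onI[OF c\<phi>]] .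
          show "AE y in spread_law. continuous_on {0..1} (\<lambda>t. \<phi> (spread_path x B' t y))"
            by (intro AE_I2 continuous_on_compose2[OF c\<phi>] continuous_intros) auto
          show "AE y in spread_law. norm (\<phi> (spread_path x B' t y)) \<le> L" if "t \<in> {0..1}" for t
            using AE_spread_law
          proof eventually_elim
            case (elim y)
            then show ?case using near[of t y] that by (intro order_trans[OF _ L]) (auto simp: dist_commute)
          qed
        qed
      qed
      define I where "I t = (\<integral>y. (s\<^sup>2 *\<^sub>R M) \<bullet> H (spread_path x B' t y) \<partial>flux_law)" for t
      have "\<exists>t\<in>{0<..<1}. h 1 - h 0 = (1/2 * I t) * (1 - 0)"
        by (rule mvt[OF _ ch]) (use dh in \<open>auto simp: I_def has_field_derivative_def\<close>)
      then obtain t where t: "t \<in> {0<..<1}" "h 1 - h 0 = 1/2 * I t" by auto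
      have path0: "spread_path x B' 0 y = x" for y by (simp add: spread_path_def)
      have h0: "h 0 = \<phi> x" by (simp add: h_def path0 SL.prob_space[simplified])
      have It: "2 * s\<^sup>2 * c' * m0 \<le> I t"
      proof -
        have "continuous_on UNIV (\<lambda>z. (s\<^sup>2 *\<^sub>R M) \<bullet> H z)" by (intro continuous_intros cH)
        then obtain L where L: "\<And>z. z \<in> cball x (min \<rho>1 \<rho>2) \<Longrightarrow> \<bar>(s\<^sup>2 *\<^sub>R M) \<bullet> H z\<bar> \<le> L"
          using bounded_on_compact[OF _ compact_cball] by blast
        have int: "integrable flux_law (\<lambda>y. (s\<^sup>2 *\<^sub>R M) \<bullet> H (spread_path x B' t y))"
        proof (rule FL.integrable_const_bound[where B = L])
          show "AE y in flux_law. norm ((s\<^sup>2 *\<^sub>R M) \<bullet> H (spread_path x B' t y)) \<le> L"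
            using AE_flux_law
          proof eventually_elim
            case (elim y)
            then show ?case using near[of t y] t(1) by (intro order_trans[OF _ L]) (auto simp: dist_commute)
          qed
          have "continuous_on UNIV (\<lambda>y. (s\<^sup>2 *\<^sub>R M) \<bullet> H (spread_path x B' t y))"
            by (intro continuous_intros continuous_on_compose2[OF cH]) auto
          from borel_measurable_continuous_onI[OF this]
          show "(\<lambda>y. (s\<^sup>2 *\<^sub>R M) \<bullet> H (spread_path x B' t y)) \<in> borel_measurable flux_law"
            unfolding measurable_cong_sets[OF sets_flux_law refl] .
        qed
        have "(\<integral>y. 2 * s\<^sup>2 * c' \<partial>(flux_law :: (real^'d) measure)) \<le> I t"
          unfolding I_def
        proof (rule integral_mono_AE[OF _ int])
          show "AE y in flux_law. 2 * s\<^sup>2 * c' \<le> (s\<^sup>2 *\<^sub>R M) \<bullet> H (spread_path x B' t y)"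
            using AE_flux_law
          proof eventually_elim
            case (elim y)
            have "c' < 1/2 * (M \<bullet> H (spread_path x B' t y))" using near[of t y] t(1) elim by (intro \<rho>2(2)) auto
            then have "s\<^sup>2 * (2 * c') \<le> s\<^sup>2 * (M \<bullet> H (spread_path x B' t y))" by (intro mult_left_mono) auto
            then show ?case by (simp add: mult_ac)
          qed
        qed simp
        then show ?thesis by (simp add: m0_def mult_ac)
      qed
      define p where "p = spread_at spread_law x B' 1"
      have pP2: "p \<in> P2" unfolding p_def by (rule P2_spread_at) simp
      have muc: "u \<in> borel_measurable borel" by (rule borel_measurable_continuous_onI[OF uc])
      have iu: "integrable spread_law (\<lambda>y. u (spread_path x B' 1 y))"
        by (rule SL.integrable_const_bound[where B = K])
          (use K measurable_compose[OF path_measurable_Q[OF S] muc] in auto)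
      have i\<phi>: "integrable spread_law (\<lambda>y. \<phi> (spread_path x B' 1 y))"
      proof -
        obtain L where L: "\<And>z. z \<in> cball x (min \<rho>1 \<rho>2) \<Longrightarrow> \<bar>\<phi> z\<bar> \<le> L"
          using bounded_on_compact[OF c\<phi> compact_cball] by blast
        show ?thesis
        proof (rule SL.integrable_const_bound[where B = L])
          show "AE y in spread_law. norm (\<phi> (spread_path x B' 1 y)) \<le> L"
            using AE_spread_law
          proof eventually_elim
            case (elim y)
            then show ?case using near[of 1 y] by (intro order_trans[OF _ L]) (auto simp: dist_commute)
          qed
          show "(\<lambda>y. \<phi> (spread_path x B' 1 y)) \<in> borel_measurable spread_law"
            using measurable_compose[OF path_measurable_Q[OF S] borel_measurable_continuous_onI[OF c\<phi>]] .
        qed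
      qed
      have "(\<integral>y. \<phi> (spread_path x B' 1 y) + (u x - \<phi> x) \<partial>spread_law) \<le> (\<integral>y. u (spread_path x B' 1 y) \<partial>spread_law)"
      proof (rule integral_mono_AE[OF _ iu])
        show "AE y in spread_law. \<phi> (spread_path x B' 1 y) + (u x - \<phi> x) \<le> u (spread_path x B' 1 y)"
          using AE_spread_law
        proof eventually_elim
          case (elim y)
          have "dist (spread_path x B' 1 y) x < \<rho>1" using near[of 1 y] elim by simp
          from \<rho>1(2)[OF this] show ?case by linarith
        qed
      qed (use i\<phi> in simp)
      also have "(\<integral>y. u (spread_path x B' 1 y) \<partial>spread_law) = (\<integral>z. u z \<partial>p)"
        unfolding p_def by (rule integral_spread_at[OF S muc, symmetric])
      also have "(\<integral>y. \<phi> (spread_path x B' 1 y) + (u x - \<phi> x) \<partial>spread_law) = h 1 + (u x - \<phi> x)"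
        using i\<phi> by (simp add: h_def SL.prob_space[simplified])
      finally have low: "s\<^sup>2 * c' * m0 \<le> (\<integral>z. u z \<partial>p) - u x" using t(2) h0 It by simp
      have "s\<^sup>2 *\<^sub>R M \<in> sym_mats \<and> f (s\<^sup>2 *\<^sub>R M) = ennreal (s\<^sup>2) * f M"
        using hom M s unfolding pos_homogeneous_def by (auto simp: sym_mats_def transpose_def vec_eq_iff)
      then have "G_cost f x p \<le> ennreal m0 * (ennreal (s\<^sup>2) * ennreal c)"
        using dyn_cost_spread_le[OF hom, of x B'] by (simp add: p_def BB m0_def c(1))
      also have "\<dots> = ennreal (m0 * (s\<^sup>2 * c))" using m0 s c(2) by (simp add: ennreal_mult)
      finally have "ennreal ((\<integral>z. u z \<partial>p) - u x) \<le> ennreal (m0 * (s\<^sup>2 * c))" using G[OF pP2, of x] by simp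
      then have "(\<integral>z. u z \<partial>p) - u x \<le> m0 * (s\<^sup>2 * c)" using m0 s c(2) by (simp add: ennreal_le_iff)
      with low have "s\<^sup>2 * c' * m0 \<le> m0 * (s\<^sup>2 * c)" by simp
      then have "(m0 * s\<^sup>2) * c' \<le> (m0 * s\<^sup>2) * c" by (simp add: mult_ac)
      then show False using c'(1) m0 s by simp
    qed
    then show ?thesis unfolding c(1) by (rule ennreal_leI)
  qed (simp add: not_less top_unique)
qed

section \<open>Duality for smooth functions\<close>

lemma tendsto_mollify_radius:
  fixes u :: "real^'d \<Rightarrow> real"
  assumes u: "continuous_on UNIV u" "\<And>y. \<bar>u y\<bar> \<le> K"
  shows "(\<lambda>n. mollify (1 / real (Suc n)) u x) \<longlonglongrightarrow> u x"
proof (rule LIMSEQ_I)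
  fix e :: real assume e: "e > 0"
  have mu: "u \<in> borel_measurable borel" by (rule borel_measurable_continuous_onI[OF u(1)])
  have "isCont u x" using u(1) by (simp add: continuous_on_eq_continuous_at)
  then obtain \<eta> where \<eta>: "\<eta> > 0" "\<And>z. dist z x < \<eta> \<Longrightarrow> dist (u z) (u x) < e / 2"
    using e unfolding continuous_at_eps_delta by (metis half_gt_zero)
  obtain N where N: "\<And>n. n \<ge> N \<Longrightarrow> 1 / real (Suc n) < \<eta>"
    using LIMSEQ_D[OF LIMSEQ_inverse_real_of_nat \<eta>(1)] by (auto simp: inverse_eq_divide)
  have "norm (mollify (1 / real (Suc n)) u x - u x) < e" if "n \<ge> N" for n
  proof -
    let ?r = "1 / real (Suc n)"
    have r: "0 < ?r" by simp
    have near: "u x - e / 2 \<le> u y" "u y \<le> u x + e / 2" if "norm (y - x) < ?r" for y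
      using \<eta>(2)[of y] N[OF \<open>n \<ge> N\<close>] that by (auto simp: dist_norm abs_if split: if_splits)
    have "mollify ?r (\<lambda>_. u x - e / 2) x \<le> mollify ?r u x" "mollify ?r u x \<le> mollify ?r (\<lambda>_. u x + e / 2) x"
      by (rule mollify_mono[OF r _ _ mu u(2)] mollify_mono[OF r mu u(2)]; use near in auto)+
    then show ?thesis using e by (simp add: mollify_const abs_less_iff)
  qed
  then show "\<exists>N. \<forall>n\<ge>N. norm (mollify (1 / real (Suc n)) u x - u x) < e" by blast
qed

text \<open>A quadratic spline: its derivative is the tent with vertices \<open>a\<close>, \<open>3/2 a\<close>, \<open>2 a\<close> and unit mass.\<close>
lemma smooth_step_exists:
  assumes a: "0 < (a::real)"
  obtains T \<tau> :: "real \<Rightarrow> real" where "\<And>t. (T has_real_derivative \<tau> t) (at t)" "continuous_on UNIV \<tau>"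
    "\<And>t. 0 \<le> \<tau> t" "\<And>t. t \<le> a \<or> 2 * a \<le> t \<Longrightarrow> \<tau> t = 0"
    "\<And>t. t \<le> a \<Longrightarrow> T t = 0" "\<And>t. 2 * a \<le> t \<Longrightarrow> T t = 1" "\<And>t. 0 \<le> T t \<and> T t \<le> 1"
proof -
  define P where "P b t = (max 0 (t - b))\<^sup>2" for b t :: real
  define T where "T t = (2 / a\<^sup>2) * (P a t - 2 * P (3/2 * a) t + P (2 * a) t)" for t
  define \<tau> where "\<tau> t = (2 / a\<^sup>2) * (2 * max 0 (t - a) - 2 * (2 * max 0 (t - 3/2 * a)) + 2 * max 0 (t - 2 * a))" for t
  have dP: "(P b has_real_derivative 2 * max 0 (t - b)) (at t)" for b t
  proof -
    have "((\<lambda>t. t - b) has_real_derivative 1) (at t)" by (auto intro!: derivative_eq_intros)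
    from DERIV_chain2[OF DERIV_pos_part_power[of 0] this]
    show ?thesis unfolding P_def[abs_def] by (simp add: numeral_2_eq_2)
  qed
  have dT: "(T has_real_derivative \<tau> t) (at t)" for t
    unfolding T_def[abs_def] \<tau>_def by (intro DERIV_cmult DERIV_add DERIV_diff dP)
  have c: "continuous_on UNIV \<tau>" unfolding \<tau>_def[abs_def] by (intro continuous_intros)
  have \<tau>0: "0 \<le> \<tau> t" for t
  proof -
    have "0 \<le> 2 * max 0 (t - a) - 2 * (2 * max 0 (t - 3/2 * a)) + 2 * max 0 (t - 2 * a)"
      using a by (auto simp: max_def)
    then show ?thesis unfolding \<tau>_def by (intro mult_nonneg_nonneg) auto
  qed
  have \<tau>z: "\<tau> t = 0" if "t \<le> a \<or> 2 * a \<le> t" for t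
    using that a by (auto simp: \<tau>_def max_def)
  have T0: "T t = 0" if "t \<le> a" for t using that a by (simp add: T_def P_def max_def)
  have T1: "T t = 1" if "2 * a \<le> t" for t
  proof -
    have "P a t - 2 * P (3/2 * a) t + P (2 * a) t = a\<^sup>2 / 2"
      using that a by (simp add: P_def max_def power2_eq_square algebra_simps)
    then show ?thesis using a by (simp add: T_def)
  qed
  have mono: "T s \<le> T t" if "s \<le> t" for s t
    by (rule DERIV_nonneg_imp_nondecreasing[OF that]) (use dT \<tau>0 in blast)
  have "0 \<le> T t \<and> T t \<le> 1" for t
    using mono[of "min t a" t] T0[of "min t a"] mono[of t "max t (2 * a)"] T1[of "max t (2 * a)"] by simp
  with dT c \<tau>0 \<tau>z T0 T1 show thesis by (rule that)
qed

lemma ennreal_integral_le_nn_integral: "ennreal (\<integral>x. h x \<partial>M) \<le> (\<integral>\<^sup>+x. ennreal (h x) \<partial>M)"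
proof (cases "integrable M h")
  case True
  have i: "integrable M (\<lambda>x. max 0 (h x))" using True by simp
  have "ennreal (\<integral>x. h x \<partial>M) \<le> ennreal (\<integral>x. max 0 (h x) \<partial>M)"
    by (intro ennreal_leI integral_mono True i) simp
  also have "\<dots> = (\<integral>\<^sup>+x. ennreal (max 0 (h x)) \<partial>M)"
    by (rule nn_integral_eq_integral[OF i, symmetric]) simp
  also have "\<dots> = (\<integral>\<^sup>+x. ennreal (h x) \<partial>M)" by (intro nn_integral_cong) (simp add: max_def ennreal_neg)
  finally show ?thesis .
qed (simp add: not_integrable_integral_eq)

text \<open>The pointwise inequality \<open>1/2 H : \<sigma> \<le> f \<sigma>\<close> at the polar density \<open>\<sigma>\<close>. Only symmetric matrices are
constrained, hence the need for the symmetry of \<open>\<sigma>\<close> almost everywhere.\<close>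
lemma mat_integral_le_cost:
  assumes \<Lambda>: "\<Lambda> \<in> mat_measures borel"
    and H: "\<And>M x. M \<in> sym_mats \<Longrightarrow> ennreal (1/2 * (M \<bullet> H x)) \<le> f M"
  shows "ennreal (mat_integral borel \<Lambda> (\<lambda>x. (1/2) *\<^sub>R H x)) \<le> (\<integral>\<^sup>+x. f (polar_density borel \<Lambda> x) \<partial>total_var borel \<Lambda>)"
  unfolding mat_integral_def
proof (rule order_trans[OF ennreal_integral_le_nn_integral nn_integral_mono_AE])
  show "AE x in total_var borel \<Lambda>. ennreal ((1/2) *\<^sub>R H x \<bullet> polar_density borel \<Lambda> x) \<le> f (polar_density borel \<Lambda> x)"
    using AE_polar_density_symmetric[OF \<Lambda>]
  proof eventually_elim
    case (elim x)
    from H[OF elim, of x] show ?case by (simp add: inner_commute)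
  qed
qed

text \<open>Test the equation with \<open>cut t * w x\<close>. Since \<open>0 \<le> cut \<le> 1\<close>, the Hessian term is at most the action,
for any cut-off in time. Choosing \<open>cut\<close> to rise and fall close to the ends of the interval,
the other term tends to the difference of the integrals of \<open>w\<close> at the end points by narrow continuity.\<close>
lemma smooth_duality:
  fixes f :: "real^'d^'d \<Rightarrow> ennreal" and w :: "real^'d \<Rightarrow> real"
  assumes fp: "fokker_planck \<rho> \<Lambda> r l" and nc: "narrowly_continuous r"
    and prob: "\<And>t. t \<in> {0..1} \<Longrightarrow> r t \<in> P2"
    and w: "C2b w g H" and H: "\<And>M x. M \<in> sym_mats \<Longrightarrow> ennreal (1/2 * (M \<bullet> H x)) \<le> f M"
  shows "ennreal ((\<integral>x. w x \<partial>r 1) - (\<integral>x. w x \<partial>r 0)) \<le> action f l"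
proof -
  note W = w[unfolded C2b_def]
  have cw: "continuous_on UNIV w" by (rule C2b_continuous[OF w])
  have cg: "continuous_on UNIV g" using W by (intro continuous_at_imp_continuous_on) (auto intro: has_derivative_continuous)
  have cH: "continuous_on UNIV H" using W by (auto intro: uniformly_continuous_imp_continuous)
  define m where "m t = (\<integral>x. w x \<partial>r t)" for t
  have cm: "continuous_on {0..1} m"
    using nc cw W unfolding narrowly_continuous_def m_def by (auto simp: bcontfun_def)
  obtain K where K: "\<And>x. norm (w x) \<le> K" using W by (auto simp: bounded_iff)
  obtain KH where KH: "\<And>x. norm (H x) \<le> KH" using W by (auto simp: bounded_iff)
  have bm: "norm (m t) \<le> K" if "t \<in> {0..1}" for t
  proof -
    have "prob_space (r t)" "sets (r t) = sets borel" using prob[OF that] by (auto simp: P2_def)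
    then interpret R: prob_space "r t" by simp
    have "integrable (r t) w"
      by (rule R.integrable_const_bound[where B = K])
        (use K \<open>sets (r t) = sets borel\<close> borel_measurable_continuous_onI[OF cw] in \<open>auto simp: measurable_cong_sets[of "r t" borel]\<close>)
    then show ?thesis unfolding m_def
      by (intro order_trans[OF integral_norm_bound R.integral_le_const] integrable_norm AE_I2 K)
  qed
  have l: "l t \<in> mat_measures borel" if "t \<in> {0<..<1}" for t
    using fp that by (simp add: fokker_planck_def mat_disintegrates_def)
  define k where "k t = mat_integral borel (l t) (\<lambda>x. (1/2) *\<^sub>R H x)" for t
  have weak: "(\<integral>t\<in>{0<..<1}. cut' t * m t \<partial>lborel) = - (\<integral>t\<in>{0<..<1}. cut t * k t \<partial>lborel)"
    if cut: "\<And>t. (cut has_real_derivative cut' t) (at t)" "continuous_on UNIV cut'" "0 < a" "\<And>t. t \<le> a \<or> 1 - a \<le> t \<Longrightarrow> cut t = 0"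
    for cut cut' :: "real \<Rightarrow> real" and a
  proof -
    have ccut: "continuous_on UNIV cut" using cut(1) by (intro continuous_at_imp_continuous_on) (auto intro: DERIV_isCont)
    have bdd: "\<exists>C. \<forall>t\<in>{0<..<1}. norm (p t) \<le> C" if "continuous_on UNIV p" for p :: "real \<Rightarrow> real"
    proof -
      have "compact (p ` {0..1})" by (intro compact_continuous_image continuous_on_subset[OF that]) auto
      then have "bounded (p ` {0..1})" by (rule compact_imp_bounded)
      then obtain C where "\<forall>t\<in>{0..1}. norm (p t) \<le> C" unfolding bounded_iff by blast
      then show ?thesis by (intro exI[of _ C]) simp
    qed
    obtain C1 where C1: "\<And>t. t \<in> {0<..<1} \<Longrightarrow> norm (cut' t) \<le> C1" using bdd[OF cut(2)] by blast
    obtain C0 where C0: "\<And>t. t \<in> {0<..<1} \<Longrightarrow> norm (cut t) \<le> C0" using bdd[OF ccut] by blast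
    have comp: "continuous_on cylinder (\<lambda>z. p (snd z))" if "continuous_on UNIV p" for p :: "real^'d \<Rightarrow> 'b::topological_space"
      by (rule continuous_on_compose2[OF that]) (auto intro!: continuous_intros)
    have compt: "continuous_on cylinder (\<lambda>z :: real \<times> (real^'d). p (fst z))" if "continuous_on UNIV p" for p :: "real \<Rightarrow> real"
      by (rule continuous_on_compose2[OF that]) (auto intro!: continuous_intros)
    have "test_function (\<lambda>z. cut (fst z) * w (snd z)) (\<lambda>z. cut' (fst z) * w (snd z)) (\<lambda>z. cut (fst z) *\<^sub>R H (snd z))"
      unfolding test_function_def
    proof (intro exI[of _ "\<lambda>z. cut (fst z) *\<^sub>R g (snd z)"] conjI ballI allI)
      fix t :: real and x :: "real^'d"
      show "((\<lambda>s. cut (fst (s, x)) * w (snd (s, x))) has_real_derivative cut' (fst (t, x)) * w (snd (t, x))) (at t)"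
        using DERIV_cmult_right[OF cut(1), of "w x" t] by simp
      show "((\<lambda>y. cut (fst (t, y)) * w (snd (t, y))) has_derivative (\<lambda>h. (cut (fst (t, x)) *\<^sub>R g (snd (t, x))) \<bullet> h)) (at x)"
        using W by (auto intro!: derivative_eq_intros)
      have "(g has_derivative (\<lambda>h. H x *v h)) (at x)" using W by blast
      from has_derivative_scaleR_right[OF this, of "cut t"]
      show "((\<lambda>y. cut (fst (t, y)) *\<^sub>R g (snd (t, y))) has_derivative (\<lambda>h. (cut (fst (t, x)) *\<^sub>R H (snd (t, x))) *v h)) (at x)"
        by (simp add: scaleR_matrix_vector_assoc)
    next
      show "continuous_on cylinder (\<lambda>z. cut' (fst z) * w (snd z))" by (intro continuous_intros comp[OF cw] compt[OF cut(2)])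
      show "continuous_on cylinder (\<lambda>z. cut (fst z) *\<^sub>R g (snd z))" by (intro continuous_intros comp[OF cg] compt[OF ccut])
      show "continuous_on cylinder (\<lambda>z. cut (fst z) *\<^sub>R H (snd z))" by (intro continuous_intros comp[OF cH] compt[OF ccut])
      have "norm (cut' t * w x) \<le> C1 * K" if "t \<in> {0<..<1}" for t x
        unfolding norm_mult using C1[OF that] K[of x] by (intro mult_mono) (auto intro: order_trans[OF norm_ge_zero])
      then show "bounded ((\<lambda>z. cut' (fst z) * w (snd z)) ` cylinder)" unfolding bounded_iff by (intro exI[of _ "C1 * K"]) auto
      have "norm (cut t *\<^sub>R H x) \<le> C0 * KH" if "t \<in> {0<..<1}" for t x
        unfolding norm_scaleR using C0[OF that] KH[of x] by (intro mult_mono) (auto intro: order_trans[OF abs_ge_zero])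
      then show "bounded ((\<lambda>z. cut (fst z) *\<^sub>R H (snd z)) ` cylinder)" unfolding bounded_iff by (intro exI[of _ "C0 * KH"]) auto
      have "closure {z \<in> cylinder. cut (fst z) * w (snd z) \<noteq> 0} \<subseteq> {a..1-a} \<times> UNIV"
      proof (rule closure_minimal)
        show "{z \<in> cylinder. cut (fst z) * w (snd z) \<noteq> 0} \<subseteq> {a..1-a} \<times> UNIV"
        proof
          fix z :: "real \<times> (real^'d)" assume "z \<in> {z \<in> cylinder. cut (fst z) * w (snd z) \<noteq> 0}"
          then have "cut (fst z) \<noteq> 0" by simp
          then have "\<not> (fst z \<le> a \<or> 1 - a \<le> fst z)" using cut(4) by blast
          then show "z \<in> {a..1-a} \<times> UNIV" by (auto simp: mem_Times_iff)
        qed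
      qed (intro closed_Times; simp)
      also have "\<dots> \<subseteq> cylinder" using cut(3) by auto
      finally show "closure {z \<in> cylinder. cut (fst z) * w (snd z) \<noteq> 0} \<subseteq> cylinder" .
    qed
    from fp[unfolded fokker_planck_def] this
    have "(\<integral>t\<in>{0<..<1}. (\<integral>x. cut' (fst (t, x)) * w (snd (t, x)) \<partial>r t) \<partial>lborel) =
        - (\<integral>t\<in>{0<..<1}. mat_integral borel (l t) (\<lambda>x. (1/2) *\<^sub>R (cut (fst (t, x)) *\<^sub>R H (snd (t, x)))) \<partial>lborel)"
      by blast
    moreover have "mat_integral borel (l t) (\<lambda>x. (1/2) *\<^sub>R (cut t *\<^sub>R H x)) = cut t * k t" for t
      unfolding k_def mat_integral_def by (simp flip: integral_mult_right_zero add: mult_ac)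
    ultimately show ?thesis by (simp add: m_def)
  qed
  have approx: "(m 1 - m 0) - e \<le> b" if e: "e > 0" and b: "action f l = ennreal b" "0 \<le> b" for e b
  proof -
    have "\<exists>d>0. \<forall>t\<in>{0..1}. dist t s < d \<longrightarrow> dist (m t) (m s) < e / 2" if "s \<in> {0..1}" for s
      using cm e that unfolding continuous_on_iff by (metis half_gt_zero)
    then obtain d0 d1 where d: "d0 > 0" "\<And>t. t \<in> {0..1} \<Longrightarrow> dist t 0 < d0 \<Longrightarrow> dist (m t) (m 0) < e / 2"
      "d1 > 0" "\<And>t. t \<in> {0..1} \<Longrightarrow> dist t 1 < d1 \<Longrightarrow> dist (m t) (m 1) < e / 2"
      by (metis atLeastAtMost_iff order_refl zero_le_one)
    define a where "a = min (1/8) (min d0 d1 / 4)"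
    have a: "0 < a" "2 * a < 1/2" "2 * a < d0" "2 * a < d1" using d(1,3) by (auto simp: a_def min_def)
    obtain T \<tau> where T: "\<And>t. (T has_real_derivative \<tau> t) (at t)" "continuous_on UNIV \<tau>"
      "\<And>t. 0 \<le> \<tau> t" "\<And>t. t \<le> a \<or> 2 * a \<le> t \<Longrightarrow> \<tau> t = 0"
      "\<And>t. t \<le> a \<Longrightarrow> T t = 0" "\<And>t. 2 * a \<le> t \<Longrightarrow> T t = 1" "\<And>t. 0 \<le> T t \<and> T t \<le> 1"
      using smooth_step_exists[OF a(1)] by metis
    define cut where "cut t = T t + T (1 - t) - 1" for t
    define cut' where "cut' t = \<tau> t - \<tau> (1 - t)" for t
    have dT': "((\<lambda>t. T (1 - t)) has_real_derivative - \<tau> (1 - t)) (at t)" for t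
    proof -
      have "((\<lambda>t. 1 - t) has_real_derivative -1) (at t)" by (auto intro!: derivative_eq_intros)
      from DERIV_chain2[OF T(1) this] show ?thesis by simp
    qed
    have dcut: "(cut has_real_derivative cut' t) (at t)" for t
      unfolding cut_def[abs_def] cut'_def
      using DERIV_diff[OF DERIV_add[OF T(1) dT'] DERIV_const, of 1 t] by simp
    have c\<tau>': "continuous_on UNIV (\<lambda>t. \<tau> (1 - t))" by (rule continuous_on_compose2[OF T(2)]) (auto intro!: continuous_intros)
    have ccut': "continuous_on UNIV cut'" unfolding cut'_def[abs_def] by (intro continuous_intros T(2) c\<tau>')
    have cut0: "cut t = 0" if "t \<le> a \<or> 1 - a \<le> t" for t
      using that T(5)[of t] T(6)[of "1 - t"] T(5)[of "1 - t"] T(6)[of t] a by (auto simp: cut_def)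
    have cut01: "0 \<le> cut t \<and> cut t \<le> 1" for t
      using T(7)[of t] T(7)[of "1 - t"] T(6)[of t] T(6)[of "1 - t"] a by (cases "t \<le> 1/2") (auto simp: cut_def)
    have "ennreal (\<integral>t\<in>{0<..<1}. cut t * k t \<partial>lborel) \<le> (\<integral>\<^sup>+t. ennreal (indicator {0<..<1} t * (cut t * k t)) \<partial>lborel)"
      unfolding set_lebesgue_integral_def real_scaleR_def by (rule ennreal_integral_le_nn_integral)
    also have "\<dots> \<le> action f l"
      unfolding action_def
    proof (rule nn_integral_mono)
      fix t
      show "ennreal (indicator {0<..<1} t * (cut t * k t)) \<le> (\<integral>\<^sup>+x. f (polar_density borel (l t) x) \<partial>total_var borel (l t)) * indicator {0<..<1} t"
      proof (cases "t \<in> {0<..<1}")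
        case True
        have "cut t * k t \<le> max 0 (k t)"
          using cut01[of t] mult_left_mono[of "k t" "max 0 (k t)" "cut t"] mult_right_mono[of "cut t" 1 "max 0 (k t)"] by simp
        then have "ennreal (cut t * k t) \<le> ennreal (max 0 (k t))" by (rule ennreal_leI)
        also have "\<dots> = ennreal (k t)" by (simp add: max_def ennreal_neg)
        also have "\<dots> \<le> (\<integral>\<^sup>+x. f (polar_density borel (l t) x) \<partial>total_var borel (l t))"
          unfolding k_def by (rule mat_integral_le_cost[OF l[OF True] H])
        finally show ?thesis using True by simp
      qed simp
    qed
    finally have "(\<integral>t\<in>{0<..<1}. cut t * k t \<partial>lborel) \<le> b"
      unfolding b(1) using b(2) by (simp add: ennreal_le_iff)
    then have 1: "- (\<integral>t\<in>{0<..<1}. cut' t * m t \<partial>lborel) \<le> b"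
      using weak[OF dcut ccut' a(1) cut0] by simp
    have si: "set_integrable lborel {0<..<1} (\<lambda>t. p t * q t)" if "continuous_on UNIV p" "continuous_on {0..1} q" for p q :: "real \<Rightarrow> real"
    proof -
      have c: "continuous_on {0..1} (\<lambda>t. p t * q t)" by (intro continuous_intros that(2) continuous_on_subset[OF that(1)]) auto
      have "set_integrable lborel {0..1} (\<lambda>t. p t * q t)" by (rule borel_integrable_atLeastAtMost'[OF c])
      then show ?thesis by (rule set_integrable_subset) auto
    qed
    have I0: "(\<integral>t\<in>{0<..<1}. \<tau> t \<partial>lborel) = 1"
      by (subst integral_derivative_constant_near_ends[OF T(1) continuous_on_subset[OF T(2)], where a = a and A = 0 and C = 1])
        (use T(5,6) a in auto)
    have I1: "(\<integral>t\<in>{0<..<1}. \<tau> (1 - t) \<partial>lborel) = 1"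
    proof -
      have "(\<integral>t\<in>{0<..<1}. - \<tau> (1 - t) \<partial>lborel) = 0 - 1"
        by (rule integral_derivative_constant_near_ends[OF dT' _ a(1)])
          (use T(5,6) a in \<open>auto intro!: continuous_intros continuous_on_subset[OF c\<tau>']\<close>)
      then show ?thesis by (simp add: set_lebesgue_integral_def)
    qed
    have up: "(\<integral>t\<in>{0<..<1}. \<tau> t * m t \<partial>lborel) \<le> m 0 + e / 2"
    proof -
      have "(\<integral>t\<in>{0<..<1}. \<tau> t * m t \<partial>lborel) \<le> (\<integral>t\<in>{0<..<1}. \<tau> t * (m 0 + e / 2) \<partial>lborel)"
      proof (rule set_integral_mono[OF si[OF T(2) cm] si[OF T(2)]])
        fix t :: real assume t: "t \<in> {0<..<1}"
        show "\<tau> t * m t \<le> \<tau> t * (m 0 + e / 2)"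
        proof (cases "t < 2 * a")
          case True
          then have "dist (m t) (m 0) < e / 2" using t a by (intro d(2)) auto
          then have "m t \<le> m 0 + e / 2" unfolding dist_real_def by linarith
          then show ?thesis using T(3)[of t] by (rule mult_left_mono)
        qed (use T(4)[of t] in auto)
      qed auto
      then show ?thesis using I0 by simp
    qed
    have low: "m 1 - e / 2 \<le> (\<integral>t\<in>{0<..<1}. \<tau> (1 - t) * m t \<partial>lborel)"
    proof -
      have "(\<integral>t\<in>{0<..<1}. \<tau> (1 - t) * (m 1 - e / 2) \<partial>lborel) \<le> (\<integral>t\<in>{0<..<1}. \<tau> (1 - t) * m t \<partial>lborel)"
      proof (rule set_integral_mono[OF si[OF c\<tau>'] si[OF c\<tau>' cm]])
        fix t :: real assume t: "t \<in> {0<..<1}"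
        show "\<tau> (1 - t) * (m 1 - e / 2) \<le> \<tau> (1 - t) * m t"
        proof (cases "1 - t < 2 * a")
          case True
          then have "dist (m t) (m 1) < e / 2" using t a by (intro d(4)) (auto simp: dist_real_def)
          then have "m 1 - e / 2 \<le> m t" unfolding dist_real_def by linarith
          then show ?thesis using T(3)[of "1 - t"] by (rule mult_left_mono)
        qed (use T(4)[of "1 - t"] in auto)
      qed auto
      then show ?thesis using I1 by simp
    qed
    have "(\<integral>t\<in>{0<..<1}. cut' t * m t \<partial>lborel) = (\<integral>t\<in>{0<..<1}. \<tau> t * m t \<partial>lborel) - (\<integral>t\<in>{0<..<1}. \<tau> (1 - t) * m t \<partial>lborel)"
      unfolding cut'_def left_diff_distrib by (rule set_integral_diff(2)[OF si[OF T(2) cm] si[OF c\<tau>' cm]])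
    then show ?thesis using 1 up low by linarith
  qed
  show ?thesis
  proof (cases "action f l")
    case (real b)
    have "m 1 - m 0 \<le> b + e" if "e > 0" for e using approx[OF that real(2,1)] by linarith
    then have "m 1 - m 0 \<le> b" by (rule field_le_epsilon)
    then show ?thesis unfolding real(2) m_def by (rule ennreal_leI)
  qed simp
qed

section \<open>The equivalence\<close>

text \<open>The mollifications of \<open>u\<close> satisfy the pointwise bound for every symmetric matrix, so that smooth
duality applies to them; dominated convergence removes the mollification.\<close>
lemma G_bound_if_touch_bound:
  fixes f :: "real^'d^'d \<Rightarrow> ennreal" and u :: "real^'d \<Rightarrow> real"
  assumes dom: "edom f \<subseteq> psd_mats" and u: "u \<in> bcontfun" and touch: "touch_bound f u" and p: "p \<in> P2"
  shows "ennreal ((\<integral>y. u y \<partial>p) - u x) \<le> G_cost f x p"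
  unfolding G_cost_def dyn_cost_def
proof (rule Inf_greatest, clarify)
  fix \<rho> \<Lambda> r l
  assume fp: "fokker_planck \<rho> \<Lambda> r l" and nc: "narrowly_continuous r" and P: "\<forall>t\<in>{0..1}. r t \<in> P2"
    and r0: "r 0 = return borel x" and r1: "p = r 1"
  have uc: "continuous_on UNIV u" using u by (simp add: bcontfun_def)
  obtain K where K: "\<And>y. \<bar>u y\<bar> \<le> K" using u by (auto simp: bcontfun_def bounded_iff)
  have mu: "u \<in> borel_measurable borel" by (rule borel_measurable_continuous_onI[OF uc])
  define w where "w n = mollify (1 / real (Suc n)) u" for n
  have pos: "0 < 1 / real (Suc n)" for n by simp
  have C2: "C2b (w n) (mollify_grad (1 / real (Suc n)) u) (mollify_hess (1 / real (Suc n)) u)" for n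
    unfolding w_def by (rule C2b_mollify[OF pos mu K])
  have cw: "continuous_on UNIV (w n)" for n by (rule C2b_continuous[OF C2])
  have bw: "\<bar>w n y\<bar> \<le> K" for n y
  proof -
    have mc: "(\<lambda>_. a) \<in> borel_measurable borel" "\<And>y. \<bar>(\<lambda>_. a) y\<bar> \<le> \<bar>a\<bar>" for a :: real by auto
    have bounds: "- K \<le> u y" "u y \<le> K" for y using K[of y] by linarith+
    have "mollify (1 / real (Suc n)) (\<lambda>_. - K) y \<le> w n y"
      unfolding w_def by (rule mollify_mono[OF pos mc mu K bounds(1)])
    moreover have "w n y \<le> mollify (1 / real (Suc n)) (\<lambda>_. K) y"
      unfolding w_def by (rule mollify_mono[OF pos mu K mc bounds(2)])
    ultimately show ?thesis unfolding mollify_const[OF pos] by linarith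
  qed
  have lim: "(\<lambda>n. w n y) \<longlonglongrightarrow> u y" for y unfolding w_def by (rule tendsto_mollify_radius[OF uc K])
  have le: "ennreal ((\<integral>y. w n y \<partial>p) - w n x) \<le> action f l" for n
  proof -
    have "ennreal ((\<integral>y. w n y \<partial>r 1) - (\<integral>y. w n y \<partial>r 0)) \<le> action f l"
    proof (rule smooth_duality[OF fp nc _ C2])
      fix M :: "real^'d^'d" and z assume M: "M \<in> sym_mats"
      show "ennreal (1/2 * (M \<bullet> mollify_hess (1 / real (Suc n)) u z)) \<le> f M"
      proof (cases "f M < top")
        case True
        then have "M \<in> edom f" using M by (simp add: edom_def)
        then obtain B :: "real^'d^'d" where B: "M = B ** transpose B" using dom psd_factorization by blast
        define c where "c = enn2real (f M)"
        have c: "f M = ennreal c" "0 \<le> c" using True by (auto simp: c_def)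
        have "1/2 * ((B ** transpose B) \<bullet> mollify_hess (1 / real (Suc n)) u z) \<le> c"
        proof (rule mollified_supersolution[OF pos uc K])
          fix \<phi> H y assume "C2_with_hessian \<phi> H" "local_minimum (\<lambda>y. u y - \<phi> y) y"
          then have "ennreal (1/2 * (M \<bullet> H y)) \<le> f M" using touch M unfolding touch_bound_def by blast
          then show "1/2 * ((B ** transpose B) \<bullet> H y) \<le> c" using c(2) by (simp only: c(1) ennreal_le_iff B[symmetric])
        qed
        from ennreal_leI[OF this] show ?thesis by (simp only: c(1) B[symmetric])
      qed (simp add: not_less top_unique)
    qed (use P in auto)
    moreover have "(\<integral>y. w n y \<partial>r 0) = w n x"
      unfolding r0 using borel_measurable_continuous_onI[OF cw] by (simp add: integral_return)
    ultimately show ?thesis by (simp add: r1)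
  qed
  have "prob_space p" "sets p = sets borel" using p by (auto simp: P2_def)
  then interpret R: prob_space p by simp
  have mp: "F \<in> borel_measurable borel \<Longrightarrow> F \<in> borel_measurable p" for F :: "real^'d \<Rightarrow> real"
    using \<open>sets p = sets borel\<close> by (simp add: measurable_cong_sets[of p borel])
  have "(\<lambda>n. \<integral>y. w n y \<partial>p) \<longlonglongrightarrow> (\<integral>y. u y \<partial>p)"
    by (rule integral_dominated_convergence[where w = "\<lambda>_. K"])
      (use lim bw mp[OF mu] mp[OF borel_measurable_continuous_onI[OF cw]] in auto)
  then have "(\<lambda>n. ennreal ((\<integral>y. w n y \<partial>p) - w n x)) \<longlonglongrightarrow> ennreal ((\<integral>y. u y \<partial>p) - u x)"
    by (intro tendsto_ennrealI tendsto_diff lim)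
  then have "ennreal ((\<integral>y. u y \<partial>p) - u x) \<le> action f l"
    by (rule LIMSEQ_le_const2) (use le in blast)
  then show "ennreal ((\<integral>y. u y \<partial>r 1) - u x) \<le> action f l" by (simp add: r1)
qed

theorem proposition4p11:
  fixes f :: "real^'d^'d \<Rightarrow> ennreal" and \<psi> :: "real^'d \<Rightarrow> real"
  assumes "convex_fun f"
    and "pos_homogeneous f"
    and "lsc_on sym_mats f"
    and "edom f \<subseteq> psd_mats"
    and "edom f \<noteq> {}"
    and "edom f \<subseteq> closure (edom f \<inter> pd_mats)"
    and "coercive f"
    and "\<psi> \<in> bcontfun"
  shows "(\<forall>x. ereal (- \<psi> x) = G_transform f (\<lambda>y. - \<psi> y) x) \<longleftrightarrow>
         viscosity_solution (\<lambda>A. - fenchel_conj f ((1/2) *\<^sub>R A)) \<psi>"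
proof -
  have c: "continuous_on UNIV \<psi>" using assms(8) by (simp add: bcontfun_def)
  have "(\<forall>x. ereal (- \<psi> x) = G_transform f (\<lambda>y. - \<psi> y) x) \<longleftrightarrow>
      (\<forall>x. ereal (- \<psi> x) \<le> G_transform f (\<lambda>y. - \<psi> y) x)"
    using G_transform_le[OF assms(2) c] by (metis antisym order_refl)
  also have "\<dots> \<longleftrightarrow> (\<forall>x. \<forall>p\<in>P2. ennreal ((\<integral>y. \<psi> y \<partial>p) - \<psi> x) \<le> G_cost f x p)"
    by (simp add: G_transform_ge_iff[OF c])
  also have "\<dots> \<longleftrightarrow> touch_bound f \<psi>"
    using touch_bound_if_G_bound[OF assms(2,4,8)] G_bound_if_touch_bound[OF assms(4,8)] by blast
  also have "\<dots> \<longleftrightarrow> viscosity_solution (\<lambda>A. - fenchel_conj f ((1/2) *\<^sub>R A)) \<psi>"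
    by (rule viscosity_solution_iff_touch_bound[OF assms(2) c, symmetric])
  finally show ?thesis .
qed

end
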